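(* Let $Y$ be a finite-variance ${\rm CARMA}(p,q)$ process and $Z^\Delta$ the noise on the right-hand side of the sampled ARMA equation $\Phi_\Delta(B)Y^\Delta_n=\Theta_{\Delta}(B)Z^{\Delta}_n$. Suppose that all zeroes $\lambda_j$ of $a(\cdot)$ satisfy $\Re(\lambda_j)<0$ and all roots $-\mu_j$ of $b(\cdot)$ satisfy $\Re(\mu_j)\neq 0$, and define $\bar{L}^\Delta:=\sqrt{\Delta}/\sigma_\Delta\, Z^\Delta$. Then, as $\Delta\downarrow 0$, \begin{equation*} \sum_{i=1}^{\lfloor t/\Delta\rfloor}\bar{L}^\Delta_i\overset{L^2}{\rightarrow} L_t,\quad t\in(0,\infty), \end{equation*} if and only if the roots of the moving average polynomial $b(\cdot)$ have negative real parts, i.e. $\Re(\mu_i)>0$ for all $i=1,\dots,q$ (the ${\rm CARMA}$ process is invertible).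
   Context: Let $L=\{L_t\}_{t\in\mathbb{R}}$ be a second-order zero-mean Lévy process with $\mathbb{E}L_1=0$, $\mathbb{E}L_1^2=1$. For integers $0\le q<p$, a ${\rm CARMA}(p,q)$ process $Y$ is the strictly stationary solution of $a(D)Y_t=\sigma b(D)DL_t$ (interpreted via the state-space form $Y_t=\mathbf{b}^\top\mathbf{X}_t$, $d\mathbf{X}_t=A\mathbf{X}_tdt+\mathbf{e}_pdL_t$), where $\sigma>0$, $a(z)=z^p+a_1z^{p-1}+\dots+a_p=\prod_{i=1}^p(z-\lambda_i)$, $b(z)=b_0+b_1z+\dots+b_{p-1}z^{p-1}=\prod_{i=1}^q(z+\mu_i)$ with $b_q=1$, $b_j=0$ for $j>q$, and $a,b$ have no common zeroes. Under $\Re(\lambda_j)<0$ for all $j$, $Y_t=\int_{-\infty}^\infty g(t-u)dL_u$ with $g(t)=\sigma\mathbf{b}^\top e^{At}\mathbf{e}_p\mathbf{1}_{(0,\infty)}(t)$. For $\Delta>0$ the sampled sequence $Y^\Delta_n:=Y_{n\Delta}$, $n\in\mathbb{Z}$, satisfies the ARMA$(p,p-1)$ equation $\Phi_\Delta(B)Y^\Delta_n=\Theta_{\Delta}(B)Z^{\Delta}_n$, where $B$ is the backshift operator, $\Phi_\Delta(B)=\prod_{i=1}^p(1-e^{\Delta\lambda_i}B)$, $\{Z^\Delta_n\}$ is white noise with variance $\sigma^2_\Delta$, and $\Theta_\Delta(\cdot)$ is the MA polynomial of order $p-1$ chosen as the minimum-phase spectral factor (no roots inside the unit circle; under the stated assumptions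 it is invertible for sufficiently small $\Delta$). *)

theory Defs
  imports "HOL-Probability.Probability" "HOL-Computational_Algebra.Polynomial"
begin

definition levy_process :: "'a measure \<Rightarrow> (real \<Rightarrow> 'a \<Rightarrow> real) \<Rightarrow> bool" where
  "levy_process M L \<longleftrightarrow>
     prob_space M \<and>
     (\<forall>t. L t \<in> borel_measurable M) \<and>
     (AE \<omega> in M. L 0 \<omega> = 0) \<and>
     (\<forall>(ts :: nat \<Rightarrow> real) n. (\<forall>i<n. ts i < ts (Suc i)) \<longrightarrow>
        prob_space.indep_vars M (\<lambda>_. borel) (\<lambda>i \<omega>. L (ts (Suc i)) \<omega> - L (ts i) \<omega>) {..<n}) \<and>
     (\<forall>s t. s \<le> t \<longrightarrow> distr M borel (\<lambda>\<omega>. L t \<omega> - L s \<omega>) = distr M borel (L (t - s))) \<and>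
     (AE \<omega> in M. \<forall>t. continuous (at_right t) (\<lambda>s. L s \<omega>) \<and>
                        (\<exists>l. ((\<lambda>s. L s \<omega>) \<longlongrightarrow> l) (at_left t)))"

definition second_order_standard :: "'a measure \<Rightarrow> (real \<Rightarrow> 'a \<Rightarrow> real) \<Rightarrow> bool" where
  "second_order_standard M L \<longleftrightarrow>
     integrable M (\<lambda>\<omega>. (L 1 \<omega>)^2) \<and>
     integral\<^sup>L M (L 1) = 0 \<and> integral\<^sup>L M (\<lambda>\<omega>. (L 1 \<omega>)^2) = 1"

definition step_fun :: "(real \<times> real \<times> real) list \<Rightarrow> real \<Rightarrow> real" where
  "step_fun xs u = (\<Sum>(c,a,b)\<leftarrow>xs. c * indicator {a<..b} u)"

definition step_int :: "(real \<Rightarrow> 'a \<Rightarrow> real) \<Rightarrow> (real \<times> real \<times> real) list \<Rightarrow> 'a \<Rightarrow> real" where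
  "step_int L xs \<omega> = (\<Sum>(c,a,b)\<leftarrow>xs. c * (L b \<omega> - L a \<omega>))"

definition wiener_integral ::
  "'a measure \<Rightarrow> (real \<Rightarrow> 'a \<Rightarrow> real) \<Rightarrow> (real \<Rightarrow> real) \<Rightarrow> ('a \<Rightarrow> real) \<Rightarrow> bool" where
  "wiener_integral M L f X \<longleftrightarrow>
     X \<in> borel_measurable M \<and>
     (\<exists>s :: nat \<Rightarrow> (real \<times> real \<times> real) list.
        (\<forall>n. \<forall>(c,a,b)\<in>set (s n). a \<le> b) \<and>
        ((\<lambda>n. \<integral>\<^sup>+ u. ennreal ((f u - step_fun (s n) u)^2) \<partial>lborel) \<longlonglongrightarrow> 0) \<and>
        ((\<lambda>n. \<integral>\<^sup>+ \<omega>. ennreal ((X \<omega> - step_int L (s n) \<omega>)^2) \<partial>M) \<longlonglongrightarrow> 0))"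

text \<open>Companion matrix A (0-indexed, size p = degree a): ones on the
  superdiagonal, last row (-a_p, ..., -a_1) = (-coeff a 0, ..., -coeff a (p-1)).\<close>
definition carma_A :: "real poly \<Rightarrow> nat \<Rightarrow> nat \<Rightarrow> real" where
  "carma_A a i j = (if i + 1 < degree a then (if j = i + 1 then 1 else 0) else - coeff a j)"

fun mpow :: "nat \<Rightarrow> (nat \<Rightarrow> nat \<Rightarrow> real) \<Rightarrow> nat \<Rightarrow> nat \<Rightarrow> nat \<Rightarrow> real" where
  "mpow p A 0 i j = (if i = j then 1 else 0)"
| "mpow p A (Suc k) i j = (\<Sum>l<p. mpow p A k i l * A l j)"

text \<open>b^T e^{At} e_p written as the exponential series.\<close>
definition carma_kernel :: "real \<Rightarrow> real poly \<Rightarrow> real poly \<Rightarrow> real \<Rightarrow> real" where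
  "carma_kernel \<sigma> a b t =
     (if 0 < t then \<sigma> * (\<Sum>k. t^k / fact k *
        (\<Sum>j<degree a. coeff b j * mpow (degree a) (carma_A a) k j (degree a - 1)))
      else 0)"

definition sampled_ar_poly :: "real \<Rightarrow> complex list \<Rightarrow> complex poly" where
  "sampled_ar_poly \<Delta> lam = (\<Prod>l\<leftarrow>lam. [:1, - exp (complex_of_real \<Delta> * l):])"

definition white_noise :: "'a measure \<Rightarrow> (int \<Rightarrow> 'a \<Rightarrow> real) \<Rightarrow> real \<Rightarrow> bool" where
  "white_noise M Z v \<longleftrightarrow>
     (\<forall>n. Z n \<in> borel_measurable M \<and> integrable M (\<lambda>\<omega>. (Z n \<omega>)^2) \<and>
          integral\<^sup>L M (Z n) = 0 \<and> integral\<^sup>L M (\<lambda>\<omega>. (Z n \<omega>)^2) = v) \<and>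
     (\<forall>n m. n \<noteq> m \<longrightarrow> integral\<^sup>L M (\<lambda>\<omega>. Z n \<omega> * Z m \<omega>) = 0)"

definition min_phase_ma :: "nat \<Rightarrow> real poly \<Rightarrow> bool" where
  "min_phase_ma p \<Theta> \<longleftrightarrow> coeff \<Theta> 0 = 1 \<and> degree \<Theta> \<le> p - 1 \<and>
     (\<forall>z. poly (map_poly complex_of_real \<Theta>) z = 0 \<longrightarrow> 1 \<le> cmod z)"

definition sampled_arma ::
  "'a measure \<Rightarrow> (real \<Rightarrow> 'a \<Rightarrow> real) \<Rightarrow> real \<Rightarrow> complex list \<Rightarrow> real poly \<Rightarrow> (int \<Rightarrow> 'a \<Rightarrow> real) \<Rightarrow> bool" where
  "sampled_arma M Y \<Delta> lam \<Theta> Z \<longleftrightarrow>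
     (\<forall>n::int. AE \<omega> in M.
        (\<Sum>k\<le>length lam. coeff (sampled_ar_poly \<Delta> lam) k *
            complex_of_real (Y ((real_of_int n - real k) * \<Delta>) \<omega>))
        = complex_of_real (\<Sum>j\<le>degree \<Theta>. coeff \<Theta> j * Z (n - int j) \<omega>))"

end

theory Submission
  imports Defs "HOL-Computational_Algebra.Fundamental_Theorem_Algebra"
begin

text \<open>Write \<open>D\<close> for the mesh and test the noise against the Ornstein--Uhlenbeck variables
  \<open>W(m) = \<integral> exp (u - m) dL(u)\<close>, integrated over \<open>u \<le> m\<close>. Solving the moving average recursion backwards in
  time gives, for \<open>n \<le> m\<close>,
  \<open>E[Z(n) W(mD)] = exp (-(m - n) D) H / \<Theta>(exp (-D))\<close> with \<open>H = \<Phi>(exp (-D)) \<sigma> b(1) / a(1)\<close>: only the behaviour of the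
  spectral factor at the single point \<open>exp (-D)\<close> matters. On the unit circle \<open>\<sigma>\<^sub>D |\<Theta>|\<close> is the
  root of the spectral density of the filtered process, and a Riemann sum argument shows that
  \<open>T(w) = D\<^sup>1\<^sup>/\<^sup>2 \<sigma>\<^sub>D \<Theta>(1 - D w) / D\<^sup>p\<close> has asymptotically the modulus \<open>\<sigma> |b|\<close> on the imaginary axis. Since \<open>T\<close> has no
  zeros in the (growing) disc \<open>|1 - D w| < 1\<close>, a compactness argument for the coefficients together with
  Hurwitz' theorem forces \<open>T\<close> to converge to \<open>\<sigma>\<close> times the polynomial obtained from \<open>b\<close> by reflecting its
  roots into the left half plane. Hence the normalised covariance converges to the value at 1 of a finite Blaschke
  product \<open>F\<close>, and \<open>F(1) = 1\<close> iff no root had to be reflected. If \<open>F(1) = 1\<close>, then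
  \<open>V(k) = \<Sum>\<^sub>j exp (-jD) Z(k - j)\<close> (rescaled) is close to \<open>W(kD)\<close> in mean square, and differencing
  turns this into closeness of the partial sums of the noise and of the Levy process; conversely, convergence of the
  partial sums at time 1, tested against \<open>W(1)\<close>, yields \<open>F(1) = 1\<close>.\<close>

section \<open>Square-integrable functions\<close>

text \<open>The test variables reduce mean-square closeness to one number. \<open>V\<close> and
  \<open>W\<close> both have second moment close to 1/2, so E(V - W)^2 is close to 1 minus the
  normalised covariance, and a covariance tending to 1 is asymptotic equality in Cauchy-Schwarz. The
  decay rate 1 of \<open>W\<close> is an arbitrary point of the right half plane, where a
  nonconstant finite Blaschke product has modulus below 1.

  Two obstacles shape the rest. The noise is known only through its covariances and the ARMA
  equation, and \<open>min_phase_ma\<close> admits zeroes on the unit circle, where the inverse of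
  the moving average filter has no convergent expansion. Hence the recursion is solved for the
  covariances with \<open>W\<close>, and Bessel's inequality supplies the decay that singles out one
  solution. Moreover \<Theta> may have degree p - 1 although \<open>b\<close> has degree q, so
  surplus zeroes of \<open>T\<close> run off to infinity and its coefficients have no evident bound.
  They are therefore normalised by their own size, and it is shown afterwards that this size stays
  bounded along a subsequence.\<close>

definition square_integrable :: "'a measure \<Rightarrow> ('a \<Rightarrow> real) \<Rightarrow> bool" where
  "square_integrable N X \<longleftrightarrow> X \<in> borel_measurable N \<and> integrable N (\<lambda>x. (X x)^2)"

lemma square_integrable_measurable:
  "square_integrable N X \<Longrightarrow> X \<in> borel_measurable N"
  by (simp add: square_integrable_def)

lemma square_integrable_square:
  "square_integrable N X \<Longrightarrow> integrable N (\<lambda>x. (X x)^2)"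
  by (simp add: square_integrable_def)

lemma square_integrable_mult:
  assumes "square_integrable N X" "square_integrable N Y"
  shows "integrable N (\<lambda>x. X x * Y x)"
proof (rule Bochner_Integration.integrable_bound)
  show "integrable N (\<lambda>x. (X x)^2 + (Y x)^2)"
    using assms by (auto simp: square_integrable_def)
  show "(\<lambda>x. X x * Y x) \<in> borel_measurable N"
    using assms by (auto simp: square_integrable_def)
  have "\<bar>x * y\<bar> \<le> x^2 + y^2" for x y :: real
  proof -
    have "0 \<le> (\<bar>x\<bar> - \<bar>y\<bar>)^2" by simp
    hence "2 * \<bar>x * y\<bar> \<le> x^2 + y^2"
      by (simp add: power2_eq_square algebra_simps abs_mult)
    moreover have "0 \<le> x^2 + y^2" by simp
    ultimately show ?thesis by linarith
  qed
  thus "AE x in N. norm (X x * Y x) \<le> norm ((X x)^2 + (Y x)^2)" by simp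
qed

lemma square_integrable_cmult:
  "square_integrable N X \<Longrightarrow> square_integrable N (\<lambda>x. c * X x)"
  by (auto simp: square_integrable_def power_mult_distrib)

lemma square_integrable_add:
  assumes "square_integrable N X" "square_integrable N Y"
  shows "square_integrable N (\<lambda>x. X x + Y x)"
  unfolding square_integrable_def
proof
  show "(\<lambda>x. X x + Y x) \<in> borel_measurable N"
    using assms by (auto simp: square_integrable_def)
  have "integrable N (\<lambda>x. (X x)^2 + (Y x)^2 + 2 * (X x * Y x))"
    using assms square_integrable_mult[OF assms] by (auto simp: square_integrable_def)
  thus "integrable N (\<lambda>x. (X x + Y x)^2)"
    by (simp add: power2_sum mult.assoc)
qed

lemma square_integrable_diff:
  assumes "square_integrable N X" "square_integrable N Y"
  shows "square_integrable N (\<lambda>x. X x - Y x)"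
  using square_integrable_add[OF assms(1) square_integrable_cmult[OF assms(2), of "-1"]] by simp

lemma square_integrable_zero: "square_integrable N (\<lambda>x. 0)"
  by (simp add: square_integrable_def)

lemma square_integrable_sum:
  "(\<And>i. i \<in> I \<Longrightarrow> square_integrable N (X i)) \<Longrightarrow> square_integrable N (\<lambda>x. \<Sum>i\<in>I. X i x)"
  by (induction I rule: infinite_finite_induct)
     (auto intro: square_integrable_add square_integrable_zero)

lemma nn_integral_square:
  "square_integrable N X \<Longrightarrow> (\<integral>\<^sup>+x. ennreal ((X x)^2) \<partial>N) = ennreal (\<integral>x. (X x)^2 \<partial>N)"
  by (intro nn_integral_eq_integral) (auto simp: square_integrable_def)

lemma square_integrable_nn:
  assumes "X \<in> borel_measurable N" "(\<integral>\<^sup>+x. ennreal ((X x)^2) \<partial>N) < \<infinity>"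
  shows "square_integrable N X"
  unfolding square_integrable_def using assms
  by (auto intro!: integrableI_bounded)

lemma integral_square_add:
  assumes "square_integrable N X" "square_integrable N Y"
  shows "(\<integral>x. (X x + Y x)^2 \<partial>N) = (\<integral>x. (X x)^2 \<partial>N) + 2 * (\<integral>x. X x * Y x \<partial>N) + (\<integral>x. (Y x)^2 \<partial>N)"
proof -
  have "(\<integral>x. (X x + Y x)^2 \<partial>N) = (\<integral>x. (X x)^2 + 2 * (X x * Y x) + (Y x)^2 \<partial>N)"
    by (intro Bochner_Integration.integral_cong) (auto simp: power2_sum)
  also have "\<dots> = (\<integral>x. (X x)^2 \<partial>N) + 2 * (\<integral>x. X x * Y x \<partial>N) + (\<integral>x. (Y x)^2 \<partial>N)"
    using assms square_integrable_mult[OF assms] by (simp add: square_integrable_square)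
  finally show ?thesis .
qed

lemma integral_square_diff:
  assumes "square_integrable N X" "square_integrable N Y"
  shows "(\<integral>x. (X x - Y x)^2 \<partial>N) = (\<integral>x. (X x)^2 \<partial>N) - 2 * (\<integral>x. X x * Y x \<partial>N) + (\<integral>x. (Y x)^2 \<partial>N)"
  using integral_square_add[OF assms(1) square_integrable_cmult[OF assms(2), of "-1"]] by simp

lemma integral_cauchy_schwarz:
  assumes "square_integrable N X" "square_integrable N Y"
  shows "(\<integral>x. X x * Y x \<partial>N)^2 \<le> (\<integral>x. (X x)^2 \<partial>N) * (\<integral>x. (Y x)^2 \<partial>N)"
proof -
  define A B C where "A = (\<integral>x. (X x)^2 \<partial>N)" and "B = (\<integral>x. X x * Y x \<partial>N)"
    and "C = (\<integral>x. (Y x)^2 \<partial>N)"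
  have nn: "0 \<le> A" "0 \<le> C" by (auto simp: A_def C_def)
  have *: "0 \<le> A * t^2 + 2 * B * t + C" for t
  proof -
    have "0 \<le> (\<integral>x. (t * X x + Y x)^2 \<partial>N)" by simp
    also have "\<dots> = A * t^2 + 2 * B * t + C"
      by (subst integral_square_add[OF square_integrable_cmult[OF assms(1)] assms(2)])
         (simp add: A_def B_def C_def power_mult_distrib mult.assoc)
    finally show ?thesis .
  qed
  have "B^2 \<le> A * C"
  proof (cases "A = 0")
    case True
    have "B = 0"
    proof (rule ccontr)
      assume "B \<noteq> 0"
      \<comment> \<open>With \<open>A = 0\<close> the quadratic is affine in \<open>t\<close>, and
        at this \<open>t\<close> it takes the value -1.\<close>
      from *[of "- (C + 1) / (2 * B)"] True \<open>B \<noteq> 0\<close> show False by simp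
    qed
    thus ?thesis using True by simp
  next
    case False
    with nn have "A > 0" by simp
    \<comment> \<open>The minimiser of the quadratic.\<close>
    from *[of "- B / A"] False have "0 \<le> - (B^2 / A) + C"
      by (simp add: power2_eq_square field_simps)
    thus ?thesis using \<open>A > 0\<close> by (simp add: field_simps)
  qed
  thus ?thesis by (simp add: A_def B_def C_def)
qed

lemma integral_square_sum_le:
  assumes "\<And>i. i \<in> I \<Longrightarrow> square_integrable N (X i)" "finite I"
  shows "(\<integral>x. (\<Sum>i\<in>I. X i x)^2 \<partial>N) \<le> real (card I) * (\<Sum>i\<in>I. \<integral>x. (X i x)^2 \<partial>N)"
proof -
  have "(\<integral>x. (\<Sum>i\<in>I. X i x)^2 \<partial>N) \<le> (\<integral>x. real (card I) * (\<Sum>i\<in>I. (X i x)^2) \<partial>N)"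
  proof (rule integral_mono)
    show "integrable N (\<lambda>x. (\<Sum>i\<in>I. X i x)^2)"
      by (intro square_integrable_square square_integrable_sum assms(1))
    show "integrable N (\<lambda>x. real (card I) * (\<Sum>i\<in>I. (X i x)^2))"
      using assms by (auto simp: square_integrable_def)
    show "(\<Sum>i\<in>I. X i x)^2 \<le> real (card I) * (\<Sum>i\<in>I. (X i x)^2)" for x
      using Cauchy_Schwarz_ineq_sum[of "\<lambda>i. X i x" "\<lambda>_. 1" I] by (simp add: mult.commute)
  qed
  also have "\<dots> = real (card I) * (\<Sum>i\<in>I. \<integral>x. (X i x)^2 \<partial>N)"
    using assms by (auto simp: square_integrable_def)
  finally show ?thesis .
qed

lemma integral_square_add_le:
  assumes "square_integrable N X" "square_integrable N Y"
  shows "(\<integral>x. (X x + Y x)^2 \<partial>N) \<le> 2 * (\<integral>x. (X x)^2 \<partial>N) + 2 * (\<integral>x. (Y x)^2 \<partial>N)"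
  using integral_square_sum_le[of "{False, True}" N "\<lambda>i. if i then X else Y"] assms
  by (simp add: add.commute split: if_splits)

lemma integral_mult_sum_sum:
  assumes "\<And>i. i \<in> I \<Longrightarrow> square_integrable N (X i)" "\<And>j. j \<in> J \<Longrightarrow> square_integrable N (Y j)"
  shows "(\<integral>x. (\<Sum>i\<in>I. c i * X i x) * (\<Sum>j\<in>J. d j * Y j x) \<partial>N) =
           (\<Sum>i\<in>I. \<Sum>j\<in>J. c i * d j * (\<integral>x. X i x * Y j x \<partial>N))"
proof -
  have "(\<integral>x. (\<Sum>i\<in>I. c i * X i x) * (\<Sum>j\<in>J. d j * Y j x) \<partial>N) =
        (\<integral>x. (\<Sum>i\<in>I. \<Sum>j\<in>J. c i * d j * (X i x * Y j x)) \<partial>N)"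
    by (intro Bochner_Integration.integral_cong refl) (simp add: sum_product mult_ac)
  also have "\<dots> = (\<Sum>i\<in>I. \<integral>x. (\<Sum>j\<in>J. c i * d j * (X i x * Y j x)) \<partial>N)"
    using assms by (intro Bochner_Integration.integral_sum Bochner_Integration.integrable_sum
        Bochner_Integration.integrable_mult_right square_integrable_mult) auto
  also have "\<dots> = (\<Sum>i\<in>I. \<Sum>j\<in>J. \<integral>x. c i * d j * (X i x * Y j x) \<partial>N)"
    using assms by (intro sum.cong refl Bochner_Integration.integral_sum
        Bochner_Integration.integrable_mult_right square_integrable_mult) auto
  finally show ?thesis by simp
qed

lemma integral_sum_mult:
  assumes "\<And>i. i \<in> I \<Longrightarrow> square_integrable N (X i)" "square_integrable N Y"
  shows "(\<integral>x. (\<Sum>i\<in>I. c i * X i x) * Y x \<partial>N) = (\<Sum>i\<in>I. c i * (\<integral>x. X i x * Y x \<partial>N))"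
  using integral_mult_sum_sum[of I N X "{()}" "\<lambda>_. Y" c "\<lambda>_. 1"] assms by simp

lemma tendsto_integral_mult:
  assumes S: "\<And>n. square_integrable N (S n)" and X: "square_integrable N X"
    and R: "\<And>n. square_integrable N (R n)" and Y: "square_integrable N Y"
    and SX: "(\<lambda>n. \<integral>x. (S n x - X x)^2 \<partial>N) \<longlonglongrightarrow> 0"
    and RY: "(\<lambda>n. \<integral>x. (R n x - Y x)^2 \<partial>N) \<longlonglongrightarrow> 0"
  shows "(\<lambda>n. \<integral>x. S n x * R n x \<partial>N) \<longlonglongrightarrow> (\<integral>x. X x * Y x \<partial>N)"
proof -
  note d = square_integrable_diff[OF S X] square_integrable_diff[OF R Y]
  have eq: "(\<integral>x. S n x * R n x \<partial>N) = (\<integral>x. (S n x - X x) * (R n x - Y x) \<partial>N) +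
     (\<integral>x. X x * (R n x - Y x) \<partial>N) + (\<integral>x. (S n x - X x) * Y x \<partial>N) + (\<integral>x. X x * Y x \<partial>N)" for n
  proof -
    have "(\<integral>x. S n x * R n x \<partial>N) = (\<integral>x. (S n x - X x) * (R n x - Y x) +
     X x * (R n x - Y x) + (S n x - X x) * Y x + X x * Y x \<partial>N)"
      by (intro Bochner_Integration.integral_cong refl) (simp add: algebra_simps)
    also have "\<dots> = (\<integral>x. (S n x - X x) * (R n x - Y x) \<partial>N) +
     (\<integral>x. X x * (R n x - Y x) \<partial>N) + (\<integral>x. (S n x - X x) * Y x \<partial>N) + (\<integral>x. X x * Y x \<partial>N)"
      using square_integrable_mult[OF d(1) d(2), of n n] square_integrable_mult[OF X d(2), of n]
        square_integrable_mult[OF d(1) Y, of n] square_integrable_mult[OF X Y]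
      by (auto simp del: diff_self)
    finally show ?thesis .
  qed
  have aux: "f \<longlonglongrightarrow> 0" if "\<And>n. (f n)^2 \<le> g n" "g \<longlonglongrightarrow> 0" for f g :: "nat \<Rightarrow> real"
  proof -
    have "(\<lambda>n. (f n)^2) \<longlonglongrightarrow> 0"
      by (rule tendsto_sandwich[of "\<lambda>_. 0" _ _ g]) (use that in auto)
    thus ?thesis by simp
  qed
  have 1: "(\<lambda>n. \<integral>x. (S n x - X x) * (R n x - Y x) \<partial>N) \<longlonglongrightarrow> 0"
    by (rule aux[OF integral_cauchy_schwarz[OF d(1) d(2)]]) (use tendsto_mult[OF SX RY] in simp)
  have 2: "(\<lambda>n. \<integral>x. X x * (R n x - Y x) \<partial>N) \<longlonglongrightarrow> 0"
    by (rule aux[OF integral_cauchy_schwarz[OF X d(2)]]) (use tendsto_mult_left[OF RY] in simp)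
  have 3: "(\<lambda>n. \<integral>x. (S n x - X x) * Y x \<partial>N) \<longlonglongrightarrow> 0"
    by (rule aux[OF integral_cauchy_schwarz[OF d(1) Y]]) (use tendsto_mult_right[OF SX] in simp)
  show ?thesis unfolding eq
    using tendsto_add[OF tendsto_add[OF tendsto_add[OF 1 2] 3] tendsto_const] by simp
qed

text \<open>A single approximant at finite distance already puts \<open>X\<close> into the space.
  After that the extended-valued distances, the form used by \<open>wiener_integral\<close>, can be
  traded for real integrals.\<close>

lemma square_integrable_limit:
  assumes X: "X \<in> borel_measurable N" and S: "\<And>n. square_integrable N (S n)"
    and lim: "(\<lambda>n. \<integral>\<^sup>+ x. ennreal ((X x - S n x)^2) \<partial>N) \<longlonglongrightarrow> 0"
  shows "square_integrable N X" "(\<lambda>n. \<integral>x. (S n x - X x)^2 \<partial>N) \<longlonglongrightarrow> 0"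
proof -
  have "eventually (\<lambda>n. (\<integral>\<^sup>+ x. ennreal ((X x - S n x)^2) \<partial>N) < 1) sequentially"
    using lim by (rule order_tendstoD) simp
  then obtain n where n: "(\<integral>\<^sup>+ x. ennreal ((X x - S n x)^2) \<partial>N) < 1"
    by (auto simp: eventually_sequentially)
  have "square_integrable N (\<lambda>x. X x - S n x)"
    using X S[of n] n by (intro square_integrable_nn) (auto simp: square_integrable_def less_trans[OF n])
  from square_integrable_add[OF this S[of n]] show sX: "square_integrable N X" by simp
  have "(\<integral>\<^sup>+ x. ennreal ((X x - S n x)^2) \<partial>N) = ennreal (\<integral>x. (S n x - X x)^2 \<partial>N)" for n
    using nn_integral_square[OF square_integrable_diff[OF S sX]] by (simp add: power2_commute)
  with lim have "(\<lambda>n. ennreal (\<integral>x. (S n x - X x)^2 \<partial>N)) \<longlonglongrightarrow> ennreal 0" by simp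
  thus "(\<lambda>n. \<integral>x. (S n x - X x)^2 \<partial>N) \<longlonglongrightarrow> 0"
    by (subst (asm) tendsto_ennreal_iff) auto
qed

text \<open>The Riesz-Fischer argument: along a rapidly Cauchy subsequence the increments are almost
  surely absolutely summable, which produces the limit, and Fatou's lemma turns pointwise
  convergence of the subsequence into mean-square convergence of the whole sequence.\<close>

lemma (in prob_space) L2_complete:
  fixes S :: "nat \<Rightarrow> 'a \<Rightarrow> real"
  assumes S: "\<And>n. square_integrable M (S n)"
    and cauchy: "\<And>e. e > 0 \<Longrightarrow> \<exists>K. \<forall>m\<ge>K. \<forall>n\<ge>K. (\<integral>x. (S m x - S n x)^2 \<partial>M) < e"
  shows "\<exists>X. X \<in> borel_measurable M \<and>
           (\<lambda>n. \<integral>\<^sup>+ x. ennreal ((X x - S n x)^2) \<partial>M) \<longlonglongrightarrow> 0"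
proof -
  have [measurable]: "S n \<in> borel_measurable M" for n
    using S by (simp add: square_integrable_def)
  \<comment> \<open>The rate 4^(-k) for squares becomes 2^(-k) for first moments by Cauchy-Schwarz
    on a probability space.\<close>
  have "\<exists>r. strict_mono (r::nat\<Rightarrow>nat) \<and> (\<forall>k. (\<integral>x. (S (r (Suc k)) x - S (r k) x)^2 \<partial>M) < (1/4)^k)"
  proof -
    have "\<forall>k. \<exists>K. \<forall>m\<ge>K. \<forall>n\<ge>K. (\<integral>x. (S m x - S n x)^2 \<partial>M) < (1/4)^k"
      using cauchy by simp
    then obtain K where K: "\<And>k m n. m \<ge> K k \<Longrightarrow> n \<ge> K k \<Longrightarrow> (\<integral>x. (S m x - S n x)^2 \<partial>M) < (1/4)^k"
      by metis
    \<comment> \<open>Summing the thresholds makes \<open>r\<close> exceed each \<open>K k\<close>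
      and increase strictly at the same time.\<close>
    define r where "r k = (\<Sum>i\<le>k. K i + 1)" for k
    have "strict_mono r" by (auto simp: strict_mono_Suc_iff r_def)
    moreover have "r k \<ge> K k" for k
      by (cases k) (auto simp: r_def)
    moreover have "r (Suc k) \<ge> K k" for k
      using \<open>r k \<ge> K k\<close> by (auto simp: r_def)
    ultimately show ?thesis using K by blast
  qed
  then obtain r where r: "strict_mono (r::nat\<Rightarrow>nat)"
    and rk: "\<And>k. (\<integral>x. (S (r (Suc k)) x - S (r k) x)^2 \<partial>M) < (1/4)^k" by blast
  define d where "d k x = S (r (Suc k)) x - S (r k) x" for k x
  have sd: "square_integrable M (d k)" for k
    unfolding d_def using S by (intro square_integrable_diff)
  have [measurable]: "d k \<in> borel_measurable M" for k
    unfolding d_def by measurable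
  have id: "integrable M (d k)" for k
    using square_integrable_mult[OF sd[of k], of "\<lambda>_. 1"] by (simp add: square_integrable_def)
  have bound: "(\<integral>\<^sup>+ x. ennreal \<bar>d k x\<bar> \<partial>M) \<le> ennreal ((1/2)^k)" for k
  proof -
    have "(\<integral>x. \<bar>d k x\<bar> \<partial>M)^2 \<le> (\<integral>x. (d k x)^2 \<partial>M)"
      using integral_cauchy_schwarz[of M "\<lambda>x. \<bar>d k x\<bar>" "\<lambda>_. 1"] sd[of k]
      by (simp add: square_integrable_def prob_space)
    also have "\<dots> \<le> (1/4)^k" using rk[of k] by (simp add: d_def)
    also have "\<dots> = ((1/2)^k)^2" by (simp add: power2_eq_square flip: power_mult_distrib)
    finally have "(\<integral>x. \<bar>d k x\<bar> \<partial>M) \<le> (1/2)^k" by (simp add: power2_le_iff_abs_le)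
    thus ?thesis using id[of k]
      by (subst nn_integral_eq_integral) (auto intro: ennreal_leI)
  qed
  have "(\<integral>\<^sup>+ x. (\<Sum>k. ennreal \<bar>d k x\<bar>) \<partial>M) = (\<Sum>k. \<integral>\<^sup>+ x. ennreal \<bar>d k x\<bar> \<partial>M)"
    by (intro nn_integral_suminf) measurable
  also have "\<dots> \<le> (\<Sum>k. ennreal ((1/2)^k))"
    by (intro suminf_le bound) auto
  also have "\<dots> = ennreal (\<Sum>k. (1/2)^k)"
    by (intro suminf_ennreal2) (auto simp: summable_geometric)
  also have "\<dots> < \<infinity>" by simp
  finally have fin: "(\<integral>\<^sup>+ x. (\<Sum>k. ennreal \<bar>d k x\<bar>) \<partial>M) < \<infinity>" .
  have "AE x in M. (\<Sum>k. ennreal \<bar>d k x\<bar>) \<noteq> \<infinity>"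
    by (rule nn_integral_PInf_AE) (use fin in auto)
  hence conv: "AE x in M. convergent (\<lambda>k. S (r k) x)"
  proof eventually_elim
    case (elim x)
    have "summable (\<lambda>k. \<bar>d k x\<bar>)"
      using elim by (intro summable_suminf_not_top) auto
    hence "summable (\<lambda>k. d k x)" by (rule summable_rabs_cancel)
    hence "convergent (\<lambda>n. \<Sum>k<n. d k x)" by (simp add: summable_iff_convergent)
    moreover have "(\<Sum>k<n. d k x) = S (r n) x - S (r 0) x" for n
      unfolding d_def by (rule sum_lessThan_telescope)
    ultimately have "convergent (\<lambda>n. S (r n) x - S (r 0) x)" by simp
    hence "convergent (\<lambda>n. (S (r n) x - S (r 0) x) + S (r 0) x)"
      by (intro convergent_add convergent_const)
    thus ?case by simp
  qed
  define X where "X x = lim (\<lambda>k. S (r k) x)" for x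
  have X[measurable]: "X \<in> borel_measurable M" unfolding X_def by measurable
  have limAE: "AE x in M. (\<lambda>k. S (r k) x) \<longlonglongrightarrow> X x"
    using conv by eventually_elim (simp add: X_def convergent_LIMSEQ_iff)
  have small: "(\<integral>\<^sup>+ x. ennreal ((X x - S n x)^2) \<partial>M) \<le> ennreal e"
    if K: "\<And>m n. m \<ge> K \<Longrightarrow> n \<ge> K \<Longrightarrow> (\<integral>x. (S m x - S n x)^2 \<partial>M) < e" and n: "n \<ge> K" for K n e
  proof -
    have "(\<integral>\<^sup>+ x. ennreal ((X x - S n x)^2) \<partial>M)
        = (\<integral>\<^sup>+ x. liminf (\<lambda>k. ennreal ((S (r k) x - S n x)^2)) \<partial>M)"
    proof (rule nn_integral_cong_AE, use limAE in eventually_elim)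
      case (elim x)
      have "(\<lambda>k. ennreal ((S (r k) x - S n x)^2)) \<longlonglongrightarrow> ennreal ((X x - S n x)^2)"
        by (intro tendsto_intros elim) 
      thus ?case by (metis lim_imp_Liminf trivial_limit_sequentially)
    qed
    also have "\<dots> \<le> liminf (\<lambda>k. \<integral>\<^sup>+ x. ennreal ((S (r k) x - S n x)^2) \<partial>M)"
      by (intro nn_integral_liminf) measurable
    also have "\<dots> \<le> ennreal e"
    proof (rule order_trans[OF Liminf_mono])
      show "eventually (\<lambda>k. (\<integral>\<^sup>+ x. ennreal ((S (r k) x - S n x)^2) \<partial>M) \<le> ennreal e) sequentially"
        unfolding eventually_sequentially
      proof (intro exI[of _ K] allI impI)
        fix k assume "K \<le> k"
        hence "r k \<ge> K" using seq_suble[OF r, of k] by linarith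
        have "(\<integral>\<^sup>+ x. ennreal ((S (r k) x - S n x)^2) \<partial>M) = ennreal (\<integral>x. (S (r k) x - S n x)^2 \<partial>M)"
          by (intro nn_integral_square square_integrable_diff S)
        also have "\<dots> \<le> ennreal e"
          using K[OF \<open>r k \<ge> K\<close> n] by (intro ennreal_leI) simp
        finally show "(\<integral>\<^sup>+ x. ennreal ((S (r k) x - S n x)^2) \<partial>M) \<le> ennreal e" .
      qed
    qed (simp add: Liminf_const)
    finally show ?thesis .
  qed
  have "(\<lambda>n. \<integral>\<^sup>+ x. ennreal ((X x - S n x)^2) \<partial>M) \<longlonglongrightarrow> 0"
  proof (rule order_tendstoI)
    fix e :: ennreal assume "0 < e"
    then obtain e' where e': "0 < e'" "ennreal e' < e"
    proof (cases e)
      case (real r)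
      with \<open>0 < e\<close> that[of "r / 2"] show ?thesis by (auto simp: ennreal_less_iff)
    next
      case top
      with that[of 1] show ?thesis by simp
    qed
    obtain K where "\<And>m n. m \<ge> K \<Longrightarrow> n \<ge> K \<Longrightarrow> (\<integral>x. (S m x - S n x)^2 \<partial>M) < e'"
      using cauchy[OF e'(1)] by blast
    from small[OF this] e'(2)
    show "eventually (\<lambda>n. (\<integral>\<^sup>+ x. ennreal ((X x - S n x)^2) \<partial>M) < e) sequentially"
      unfolding eventually_sequentially by (meson order_le_less_trans)
  qed auto
  thus ?thesis using X by blast
qed

section \<open>Second moments of a standard Levy process\<close>

text \<open>Cauchy's functional equation with regularity required only near 0. The function vanishes
  at 1 / n and at its multiples, so its value at \<open>t\<close> is its value at an arbitrarily
  small remainder. It serves twice, for the variance minus its linear guess and for the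
  mean.\<close>

lemma additive_eq_zero:
  fixes f :: "real \<Rightarrow> real"
  assumes add: "\<And>s t. 0 < s \<Longrightarrow> 0 < t \<Longrightarrow> f (s + t) = f s + f t"
    and f1: "f 1 = 0" and small: "\<And>e. e > 0 \<Longrightarrow> \<exists>d>0. \<forall>x. 0 < x \<and> x < d \<longrightarrow> \<bar>f x\<bar> < e"
    and t: "0 < t"
  shows "f t = 0"
proof -
  have mult: "f (real (Suc n) * x) = real (Suc n) * f x" if "0 < x" for n x
  proof (induction n)
    case (Suc n)
    have "f (real (Suc (Suc n)) * x) = f (real (Suc n) * x + x)"
      by (simp add: algebra_simps)
    also have "\<dots> = f (real (Suc n) * x) + f x"
      using that by (intro add) auto
    finally show ?case using Suc.IH by (simp add: algebra_simps)
  qed simp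
  have inv: "f (1 / real (Suc n)) = 0" for n
    using mult[of "1 / real (Suc n)" n] f1 by simp
  have "\<bar>f t\<bar> \<le> e" if e: "e > 0" for e
  proof -
    from small[OF e] obtain d where d: "d > 0" "\<And>x. 0 < x \<Longrightarrow> x < d \<Longrightarrow> \<bar>f x\<bar> < e" by blast
    obtain n where n: "1 / real (Suc n) < d" using \<open>d > 0\<close> nat_approx_posE by metis
    define c where "c = 1 / real (Suc n)"
    define k where "k = nat \<lfloor>t / c\<rfloor>"
    have c: "0 < c" "f c = 0" "c < d" using inv n by (auto simp: c_def)
    have k: "real k * c \<le> t" "t < real k * c + c"
    proof -
      have "real k = of_int \<lfloor>t / c\<rfloor>" using t c by (simp add: k_def)
      hence "real k \<le> t / c" "t / c < real k + 1" by linarith+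
      thus "real k * c \<le> t" "t < real k * c + c" using c by (auto simp: field_simps)
    qed
    have fk: "f (real k * c) = 0" if "k > 0"
      using mult[OF c(1), of "k - 1"] c that by simp
    show ?thesis
    proof (cases "real k * c = t")
      case True
      with t have "k > 0" by (cases k) auto
      with True fk e show ?thesis by simp
    next
      case False
      define r where "r = t - real k * c"
      have r: "0 < r" "r < d" using False k c by (auto simp: r_def)
      have "f t = f r"
      proof (cases "k = 0")
        case False
        hence "f (real k * c + r) = f (real k * c) + f r" using c r by (intro add) auto
        thus ?thesis using fk False by (simp add: r_def)
      qed (simp add: r_def)
      thus ?thesis using d(2)[OF r] by simp
    qed
  qed
  hence "\<bar>f t\<bar> \<le> 0" by (rule field_le_epsilon) auto
  thus ?thesis by simp
qed

text \<open>By Fubini E(X + y)^2 is finite for almost every value \<open>y\<close> of the other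
  summand, and one such constant is enough. This carries the moment assumption, which concerns time
  1 alone, to shorter increments.\<close>

lemma (in prob_space) square_integrable_indep_summand:
  assumes ind: "indep_var borel X borel Y" and S: "square_integrable M (\<lambda>x. X x + Y x)"
  shows "square_integrable M X"
proof -
  have [measurable]: "X \<in> borel_measurable M" "Y \<in> borel_measurable M"
    using indep_var_rv1[OF ind] indep_var_rv2[OF ind] by auto
  interpret X: prob_space "distr M borel X" by (rule prob_space_distr) simp
  interpret Y: prob_space "distr M borel Y" by (rule prob_space_distr) simp
  interpret P: pair_prob_space "distr M borel X" "distr M borel Y" ..
  have "(\<integral>\<^sup>+ y. \<integral>\<^sup>+ x. ennreal ((x + y)^2) \<partial>distr M borel X \<partial>distr M borel Y)
      = (\<integral>\<^sup>+ z. ennreal ((fst z + snd z)^2) \<partial>(distr M borel X \<Otimes>\<^sub>M distr M borel Y))"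
    by (subst P.nn_integral_snd[symmetric]) (auto simp: case_prod_beta)
  also have "\<dots> = (\<integral>\<^sup>+ z. ennreal ((fst z + snd z)^2) \<partial>(distr M (borel \<Otimes>\<^sub>M borel) (\<lambda>x. (X x, Y x))))"
    using ind by (simp add: indep_var_distribution_eq)
  also have "\<dots> = (\<integral>\<^sup>+ x. ennreal ((X x + Y x)^2) \<partial>M)"
    by (subst nn_integral_distr) auto
  also have "\<dots> < \<infinity>" using nn_integral_square[OF S] by simp
  finally have "AE y in distr M borel Y. (\<integral>\<^sup>+ x. ennreal ((x + y)^2) \<partial>distr M borel X) \<noteq> \<infinity>"
    by (intro nn_integral_PInf_AE) auto
  then obtain y where y: "(\<integral>\<^sup>+ x. ennreal ((x + y)^2) \<partial>distr M borel X) \<noteq> \<infinity>"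
    using Y.AE_contr[of "\<lambda>_. False"] by (metis (mono_tags, lifting) eventually_mono)
  have "(\<integral>\<^sup>+ x. ennreal ((X x + y)^2) \<partial>M) < \<infinity>"
    using y by (subst (asm) nn_integral_distr) (auto simp: less_top)
  hence "square_integrable M (\<lambda>x. X x + y)" by (intro square_integrable_nn) auto
  from square_integrable_add[OF this, of "\<lambda>_. - y"] show ?thesis
    by (simp add: square_integrable_def)
qed

lemma (in prob_space) integral_mult_indep_var:
  fixes X Y :: "'a \<Rightarrow> real"
  assumes ind: "indep_var borel X borel Y" and "integrable M X" "integrable M Y"
  shows "(\<integral>x. X x * Y x \<partial>M) = (\<integral>x. X x \<partial>M) * (\<integral>x. Y x \<partial>M)"
  using indep_var_lebesgue_integral[OF assms] by simp

locale standard_levy = prob_space M for M :: "'a measure" +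
  fixes L :: "real \<Rightarrow> 'a \<Rightarrow> real"
  assumes levy: "levy_process M L" and standard: "second_order_standard M L"
begin

lemma L_measurable [measurable]: "L t \<in> borel_measurable M"
  using levy unfolding levy_process_def by blast

lemma L_zero: "AE \<omega> in M. L 0 \<omega> = 0"
  using levy unfolding levy_process_def by blast

lemma incr_distr: "s \<le> t \<Longrightarrow> distr M borel (\<lambda>\<omega>. L t \<omega> - L s \<omega>) = distr M borel (L (t - s))"
  using levy unfolding levy_process_def by blast

lemma incr_square_integrable_iff:
  assumes "s \<le> t"
  shows "square_integrable M (\<lambda>\<omega>. L t \<omega> - L s \<omega>) \<longleftrightarrow> square_integrable M (L (t - s))"
proof -
  have "integrable M (\<lambda>\<omega>. (L t \<omega> - L s \<omega>)^2) \<longleftrightarrow>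
        integrable (distr M borel (\<lambda>\<omega>. L t \<omega> - L s \<omega>)) (\<lambda>x. x^2)"
    by (subst integrable_distr_eq) auto
  also have "\<dots> \<longleftrightarrow> integrable M (\<lambda>\<omega>. (L (t - s) \<omega>)^2)"
    unfolding incr_distr[OF assms] by (subst integrable_distr_eq) auto
  finally show ?thesis by (simp add: square_integrable_def)
qed

lemma incr_integral:
  fixes f :: "real \<Rightarrow> real"
  assumes "s \<le> t" "f \<in> borel_measurable borel"
  shows "(\<integral>\<omega>. f (L t \<omega> - L s \<omega>) \<partial>M) = (\<integral>\<omega>. f (L (t - s) \<omega>) \<partial>M)"
proof -
  have "(\<integral>\<omega>. f (L t \<omega> - L s \<omega>) \<partial>M) = (\<integral>x. f x \<partial>distr M borel (\<lambda>\<omega>. L t \<omega> - L s \<omega>))"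
    using assms by (subst integral_distr) auto
  also have "\<dots> = (\<integral>\<omega>. f (L (t - s) \<omega>) \<partial>M)"
    unfolding incr_distr[OF assms(1)] using assms by (subst integral_distr) auto
  finally show ?thesis .
qed

lemma incr_indep:
  assumes "0 < s" "0 < t"
  shows "indep_var borel (\<lambda>\<omega>. L s \<omega> - L 0 \<omega>) borel (\<lambda>\<omega>. L (s + t) \<omega> - L s \<omega>)"
proof -
  define ts :: "nat \<Rightarrow> real" where "ts i = (if i = 0 then 0 else if i = 1 then s else s + t)" for i
  have "\<forall>i<2. ts i < ts (Suc i)" using assms by (auto simp: ts_def less_2_cases_iff)
  hence "indep_vars (\<lambda>_. borel) (\<lambda>i \<omega>. L (ts (Suc i)) \<omega> - L (ts i) \<omega>) {..<2::nat}"
    using levy unfolding levy_process_def by blast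
  moreover have "{..<2::nat} = insert 0 {1}" by auto
  ultimately have "indep_vars (\<lambda>_. borel) (\<lambda>i \<omega>. L (ts (Suc i)) \<omega> - L (ts i) \<omega>) (insert 0 {1::nat})"
    by simp
  from indep_vars_sum[OF _ _ this] show ?thesis by (simp add: ts_def)
qed

text \<open>For t < 1, \<open>L 1\<close> is up to \<open>L 0\<close> the sum of two independent
  increments, one of which has the law of \<open>L t\<close>. Longer times are cut into pieces of
  length below 1.\<close>

lemma L_square_integrable:
  assumes "0 \<le> t"
  shows "square_integrable M (L t)"
proof -
  have one: "square_integrable M (L 1)"
    using standard by (simp add: second_order_standard_def square_integrable_def)
  have lt1: "square_integrable M (L t)" if "0 < t" "t < 1" for t
  proof -
    have "square_integrable M (\<lambda>\<omega>. L t \<omega> - L 0 \<omega>)"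
    proof (rule square_integrable_indep_summand)
      show "indep_var borel (\<lambda>\<omega>. L t \<omega> - L 0 \<omega>) borel (\<lambda>\<omega>. L (t + (1 - t)) \<omega> - L t \<omega>)"
        using that by (intro incr_indep) auto
    qed (use one incr_square_integrable_iff[of 0 1] in simp)
    thus ?thesis using incr_square_integrable_iff[of 0 t] that by simp
  qed
  show ?thesis
  proof (cases "t = 0")
    case True
    have "integrable M (\<lambda>\<omega>. (L 0 \<omega>)^2) \<longleftrightarrow> integrable M (\<lambda>\<omega>. 0 :: real)"
      using L_zero by (intro integrable_cong_AE) auto
    thus ?thesis using True by (simp add: square_integrable_def)
  next
    case False
    obtain n :: nat where n: "t < real n" using reals_Archimedean2 by blast
    have "n > 0" using n assms by (cases n) auto
    have "square_integrable M (\<lambda>\<omega>. \<Sum>i<n. L (real (Suc i) * (t / n)) \<omega> - L (real i * (t / n)) \<omega>)"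
    proof (rule square_integrable_sum)
      fix i
      have "square_integrable M (L (t / n))" using n \<open>n > 0\<close> False assms by (intro lt1) auto
      moreover have "real (Suc i) * (t / n) - real i * (t / n) = t / n" by (simp add: algebra_simps diff_divide_distrib add_divide_distrib)
      ultimately show "square_integrable M (\<lambda>\<omega>. L (real (Suc i) * (t / n)) \<omega> - L (real i * (t / n)) \<omega>)"
        using assms \<open>n > 0\<close> by (subst incr_square_integrable_iff) (auto simp: divide_right_mono mult_right_mono)
    qed
    moreover have "(\<Sum>i<n. L (real (Suc i) * (t / n)) \<omega> - L (real i * (t / n)) \<omega>) = L t \<omega> - L 0 \<omega>" for \<omega>
      using sum_lessThan_telescope[of "\<lambda>i. L (real i * (t / n)) \<omega>" n] \<open>n > 0\<close> by simp
    ultimately have "square_integrable M (\<lambda>\<omega>. L t \<omega> - L 0 \<omega>)" by simp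
    thus ?thesis using incr_square_integrable_iff[of 0 t] assms by simp
  qed
qed

lemma L_integrable: "0 \<le> t \<Longrightarrow> integrable M (L t)"
  using square_integrable_mult[OF L_square_integrable[of t], of "\<lambda>_. 1"]
  by (simp add: square_integrable_def)

lemma incr_square_integrable: "square_integrable M (\<lambda>\<omega>. L t \<omega> - L s \<omega>)"
proof (cases "s \<le> t")
  case True
  thus ?thesis by (simp add: incr_square_integrable_iff L_square_integrable)
next
  case False
  hence "square_integrable M (\<lambda>\<omega>. L s \<omega> - L t \<omega>)"
    by (simp add: incr_square_integrable_iff L_square_integrable)
  from square_integrable_cmult[OF this, of "-1"] show ?thesis by simp
qed

lemma incr_integrable: "integrable M (\<lambda>\<omega>. L t \<omega> - L s \<omega>)"
  using square_integrable_mult[OF incr_square_integrable[of t s], of "\<lambda>_. 1"]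
  by (simp add: square_integrable_def)

text \<open>The cross term has to be kept: at this point the mean is known to vanish at time 1
  only.\<close>

lemma moments_add:
  assumes "0 < s" "0 < t"
  defines "m \<equiv> \<lambda>t. \<integral>\<omega>. L t \<omega> \<partial>M" and "w \<equiv> \<lambda>t. \<integral>\<omega>. (L t \<omega>)^2 \<partial>M"
  shows "m (s + t) = m s + m t" "w (s + t) = w s + 2 * (m s * m t) + w t"
proof -
  let ?X = "\<lambda>\<omega>. L s \<omega> - L 0 \<omega>" and ?Y = "\<lambda>\<omega>. L (s + t) \<omega> - L s \<omega>"
  have mX: "(\<integral>\<omega>. ?X \<omega> \<partial>M) = m s" using incr_integral[of 0 s "\<lambda>x. x"] assms by (simp add: m_def)
  have mY: "(\<integral>\<omega>. ?Y \<omega> \<partial>M) = m t" using incr_integral[of s "s + t" "\<lambda>x. x"] assms by (simp add: m_def)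
  have wX: "(\<integral>\<omega>. (?X \<omega>)^2 \<partial>M) = w s" using incr_integral[of 0 s "\<lambda>x. x^2"] assms by (simp add: w_def)
  have wY: "(\<integral>\<omega>. (?Y \<omega>)^2 \<partial>M) = w t" using incr_integral[of s "s + t" "\<lambda>x. x^2"] assms by (simp add: w_def)
  have "m (s + t) = (\<integral>\<omega>. L (s + t) \<omega> - L 0 \<omega> \<partial>M)"
    using incr_integral[of 0 "s + t" "\<lambda>x. x"] assms by (simp add: m_def)
  also have "\<dots> = (\<integral>\<omega>. ?X \<omega> + ?Y \<omega> \<partial>M)" by simp
  also have "\<dots> = m s + m t"
    by (subst Bochner_Integration.integral_add) (auto intro: incr_integrable simp: mX mY simp del: diff_add_cancel)
  finally show "m (s + t) = m s + m t" .
  have "w (s + t) = (\<integral>\<omega>. (L (s + t) \<omega> - L 0 \<omega>)^2 \<partial>M)"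
    using incr_integral[of 0 "s + t" "\<lambda>x. x^2"] assms by (simp add: w_def)
  also have "\<dots> = (\<integral>\<omega>. (?X \<omega> + ?Y \<omega>)^2 \<partial>M)" by simp
  also have "\<dots> = w s + 2 * (m s * m t) + w t"
    by (subst integral_square_add[OF incr_square_integrable incr_square_integrable])
       (simp only: wX wY mX mY integral_mult_indep_var[OF incr_indep[OF assms(1,2)] incr_integrable incr_integrable])
  finally show "w (s + t) = w s + 2 * (m s * m t) + w t" .
qed

text \<open>The variance is additive and nonnegative, hence monotone, and monotonicity replaces any
  regularity of the paths: additivity fixes the values at 1 / n, which squeeze the variance near
  0.\<close>

lemma L_variance:
  assumes "0 < t"
  shows "(\<integral>\<omega>. (L t \<omega>)^2 \<partial>M) = t + (\<integral>\<omega>. L t \<omega> \<partial>M)^2"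
proof -
  define m where "m t = (\<integral>\<omega>. L t \<omega> \<partial>M)" for t
  define w where "w t = (\<integral>\<omega>. (L t \<omega>)^2 \<partial>M)" for t
  define v where "v t = w t - (m t)^2" for t
  have add: "v (s + t) = v s + v t" if "0 < s" "0 < t" for s t
    using moments_add[OF that] by (simp add: v_def m_def w_def power2_sum)
  have nn: "0 \<le> v t" if "0 < t" for t
    using integral_cauchy_schwarz[OF L_square_integrable, of t "\<lambda>_. 1"] that
    by (simp add: v_def m_def w_def square_integrable_def prob_space)
  have v1: "v 1 = 1" using standard by (simp add: v_def m_def w_def second_order_standard_def)
  have mono: "v s \<le> v t" if "0 < s" "s \<le> t" for s t
    using that add[of s "t - s"] nn[of "t - s"] by (cases "s = t") auto
  have inv: "v (1 / real (Suc n)) = 1 / real (Suc n)" for n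
  proof -
    have "v (real (Suc k) * (1 / real (Suc n))) = real (Suc k) * v (1 / real (Suc n))" for k
    proof (induction k)
      case (Suc k)
      have "v (real (Suc (Suc k)) * (1 / real (Suc n))) = v (real (Suc k) * (1 / real (Suc n)) + 1 / real (Suc n))"
        by (simp add: add_divide_distrib)
      also have "\<dots> = v (real (Suc k) * (1 / real (Suc n))) + v (1 / real (Suc n))"
        by (intro add) auto
      finally show ?case using Suc.IH by (simp add: algebra_simps)
    qed simp
    from this[of n] v1 show ?thesis by (simp add: field_simps)
  qed
  have "v t - t = 0"
  proof (rule additive_eq_zero[where f = "\<lambda>t. v t - t"])
    fix e :: real assume "e > 0"
    then obtain n where n: "1 / real (Suc n) < e" using nat_approx_posE by metis
    show "\<exists>d>0. \<forall>x. 0 < x \<and> x < d \<longrightarrow> \<bar>v x - x\<bar> < e"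
    proof (intro exI[of _ "1 / real (Suc n)"] conjI allI impI)
      fix x assume x: "0 < x \<and> x < 1 / real (Suc n)"
      hence "v x \<le> 1 / real (Suc n)" using mono[of x "1 / real (Suc n)"] inv by simp
      with x nn[of x] n show "\<bar>v x - x\<bar> < e" by auto
    qed simp
  qed (use add v1 assms in auto)
  thus ?thesis by (simp add: v_def m_def w_def)
qed

text \<open>Right-continuity is what excludes a non-measurable additive drift here.\<close>
lemma L_mean:
  assumes "0 < t"
  shows "(\<integral>\<omega>. L t \<omega> \<partial>M) = 0"
proof -
  define m where "m t = (\<integral>\<omega>. L t \<omega> \<partial>M)" for t
  \<comment> \<open>Almost sure convergence of \<open>L (x n)\<close> to 0 does not by itself
    control means. Truncation at 1 makes dominated convergence applicable, and by the variance
    formula \<open>L (x n)\<close> differs from its mean by at most \<open>sqrt (x n)\<close> in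
    first moment.\<close>
  have key: "(\<lambda>n. min 1 \<bar>m (x n)\<bar>) \<longlonglongrightarrow> 0"
    if x: "\<And>n. 0 < x n" "x \<longlonglongrightarrow> 0" for x :: "nat \<Rightarrow> real"
  proof -
    have ae: "AE \<omega> in M. (\<lambda>n. min 1 \<bar>L (x n) \<omega>\<bar>) \<longlonglongrightarrow> 0"
    proof -
      have "AE \<omega> in M. \<forall>t. continuous (at_right t) (\<lambda>s. L s \<omega>)"
        using levy unfolding levy_process_def by (auto elim: eventually_mono)
      with L_zero show ?thesis
      proof eventually_elim
        case (elim \<omega>)
        have "((\<lambda>s. L s \<omega>) \<longlongrightarrow> 0) (at_right 0)"
          using elim by (auto simp: continuous_within dest!: spec[of _ 0])
        moreover have "filterlim x (at_right 0) sequentially"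
          using x(2) x(1) by (auto simp: filterlim_at less_le intro!: always_eventually)
        ultimately have "(\<lambda>n. L (x n) \<omega>) \<longlonglongrightarrow> 0" by (rule filterlim_compose)
        hence "(\<lambda>n. min 1 \<bar>L (x n) \<omega>\<bar>) \<longlonglongrightarrow> min 1 \<bar>0\<bar>" by (intro tendsto_intros)
        thus ?case by simp
      qed
    qed
    have lim1: "(\<lambda>n. \<integral>\<omega>. min 1 \<bar>L (x n) \<omega>\<bar> \<partial>M) \<longlonglongrightarrow> (\<integral>\<omega>. 0 \<partial>M)"
      by (rule integral_dominated_convergence[where w = "\<lambda>_. 1"]) (use ae in auto)
    have bound: "min 1 \<bar>m (x n)\<bar> \<le> (\<integral>\<omega>. min 1 \<bar>L (x n) \<omega>\<bar> \<partial>M) + sqrt (x n)" for n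
    proof -
      let ?t = "x n"
      have iL: "integrable M (L ?t)" using x(1)[of n] by (intro L_integrable) simp
      have imin: "integrable M (\<lambda>\<omega>. min 1 \<bar>L ?t \<omega>\<bar>)"
        by (rule Bochner_Integration.integrable_bound[OF iL]) auto
      have iabs: "integrable M (\<lambda>\<omega>. \<bar>L ?t \<omega> - m ?t\<bar>)"
        by (intro integrable_abs Bochner_Integration.integrable_diff iL) simp
      have sD: "square_integrable M (\<lambda>\<omega>. \<bar>L ?t \<omega> - m ?t\<bar>)"
        using square_integrable_diff[OF L_square_integrable[of ?t], of "\<lambda>_. m ?t"] x(1)[of n]
        by (simp add: square_integrable_def)
      have "min 1 \<bar>m ?t\<bar> = (\<integral>\<omega>. min 1 \<bar>m ?t\<bar> \<partial>M)" by (simp add: prob_space)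
      also have "\<dots> \<le> (\<integral>\<omega>. min 1 \<bar>L ?t \<omega>\<bar> + \<bar>L ?t \<omega> - m ?t\<bar> \<partial>M)"
        by (intro integral_mono Bochner_Integration.integrable_add imin iabs) auto
      also have "\<dots> = (\<integral>\<omega>. min 1 \<bar>L ?t \<omega>\<bar> \<partial>M) + (\<integral>\<omega>. \<bar>L ?t \<omega> - m ?t\<bar> \<partial>M)"
        by (intro Bochner_Integration.integral_add imin iabs)
      also have "(\<integral>\<omega>. \<bar>L ?t \<omega> - m ?t\<bar> \<partial>M) \<le> sqrt ?t"
      proof -
        have "(\<integral>\<omega>. \<bar>L ?t \<omega> - m ?t\<bar> \<partial>M)^2 \<le> (\<integral>\<omega>. (L ?t \<omega> - m ?t)^2 \<partial>M)"
          using integral_cauchy_schwarz[OF sD, of "\<lambda>_. 1"] by (simp add: square_integrable_def prob_space)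
        also have "\<dots> = (\<integral>\<omega>. (L ?t \<omega>)^2 \<partial>M) - 2 * (\<integral>\<omega>. L ?t \<omega> * m ?t \<partial>M) + (m ?t)^2"
          using integral_square_diff[OF L_square_integrable[of ?t], of "\<lambda>_. m ?t"] x(1)[of n]
          by (simp add: square_integrable_def prob_space)
        also have "\<dots> = ?t"
          using L_variance[OF x(1)[of n]] by (simp add: m_def power2_eq_square)
        finally show ?thesis by (rule real_le_rsqrt)
      qed
      finally show ?thesis by simp
    qed
    have "(\<lambda>n. (\<integral>\<omega>. min 1 \<bar>L (x n) \<omega>\<bar> \<partial>M) + sqrt (x n)) \<longlonglongrightarrow> 0 + sqrt 0"
      using lim1 by (intro tendsto_intros x) simp
    hence "(\<lambda>n. (\<integral>\<omega>. min 1 \<bar>L (x n) \<omega>\<bar> \<partial>M) + sqrt (x n)) \<longlonglongrightarrow> 0" by simp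
    thus "(\<lambda>n. min 1 \<bar>m (x n)\<bar>) \<longlonglongrightarrow> 0"
      by (rule Lim_null_comparison[rotated]) (use bound in \<open>auto intro!: always_eventually\<close>)
  qed
  have "m t = 0"
  proof (rule additive_eq_zero[where f = m])
    show "m (s + t) = m s + m t" if "0 < s" "0 < t" for s t
      using moments_add(1)[OF that] by (simp add: m_def)
    show "m 1 = 0" using standard by (simp add: second_order_standard_def m_def)
    fix e :: real assume e: "e > 0"
    show "\<exists>d>0. \<forall>x. 0 < x \<and> x < d \<longrightarrow> \<bar>m x\<bar> < e"
    proof (rule ccontr)
      assume "\<not> ?thesis"
      hence "\<forall>n. \<exists>x. 0 < x \<and> x < 1 / real (Suc n) \<and> \<not> \<bar>m x\<bar> < e"
        by (meson divide_pos_pos of_nat_0_less_iff zero_less_Suc zero_less_one)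
      then obtain x where x: "\<And>n. 0 < x n" "\<And>n. x n < 1 / real (Suc n)" "\<And>n. \<not> \<bar>m (x n)\<bar> < e"
        by metis
      have "x \<longlonglongrightarrow> 0"
        by (rule tendsto_sandwich[OF _ _ tendsto_const LIMSEQ_inverse_real_of_nat])
           (auto intro!: always_eventually simp: less_imp_le[OF x(1)] less_imp_le[OF x(2)] inverse_eq_divide
              simp del: of_nat_Suc)
      from order_tendstoD(2)[OF key[OF x(1) this], of "min 1 e"] e
      obtain n where "min 1 \<bar>m (x n)\<bar> < min 1 e" by (auto simp: eventually_sequentially)
      with x(3)[of n] show False by (auto simp: min_def split: if_splits)
    qed
  qed (rule assms)
  thus ?thesis by (simp add: m_def)
qed

lemma incr_second_moment: "(\<integral>\<omega>. (L t \<omega> - L s \<omega>)^2 \<partial>M) = \<bar>t - s\<bar>"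
proof -
  have *: "(\<integral>\<omega>. (L t \<omega> - L s \<omega>)^2 \<partial>M) = t - s" if "s < t" for s t
    using incr_integral[of s t "\<lambda>x. x^2"] that L_variance[of "t - s"] L_mean[of "t - s"] by simp
  show ?thesis
    using *[of s t] *[of t s] by (cases s t rule: linorder_cases) (auto simp: power2_commute)
qed

text \<open>By polarisation, only the second moments of the increments enter.\<close>
lemma incr_covariance:
  assumes "a \<le> b" "c \<le> d"
  shows "(\<integral>\<omega>. (L b \<omega> - L a \<omega>) * (L d \<omega> - L c \<omega>) \<partial>M) =
         (\<integral>u. indicator {a<..b} u * indicator {c<..d} u \<partial>lborel)"
proof -
  note i = square_integrable_square[OF incr_square_integrable]
  have "(\<integral>\<omega>. (L b \<omega> - L a \<omega>) * (L d \<omega> - L c \<omega>) \<partial>M) =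
     (\<integral>\<omega>. ((L b \<omega> - L c \<omega>)^2 + (L a \<omega> - L d \<omega>)^2 - (L b \<omega> - L d \<omega>)^2 - (L a \<omega> - L c \<omega>)^2) / 2 \<partial>M)"
    by (intro Bochner_Integration.integral_cong refl) (simp add: power2_eq_square algebra_simps)
  also have "\<dots> = (\<bar>b - c\<bar> + \<bar>a - d\<bar> - \<bar>b - d\<bar> - \<bar>a - c\<bar>) / 2"
    using i by (simp add: incr_second_moment)
  also have "\<dots> = measure lborel ({a<..b} \<inter> {c<..d})"
  proof -
    have "{a<..b} \<inter> {c<..d} = {max a c<..min b d}" by auto
    moreover have "measure lborel {max a c<..min b d} = max 0 (min b d - max a c)"
    proof (cases "max a c \<le> min b d")
      case False
      hence "{max a c<..min b d} = {}" "min b d - max a c \<le> 0" by (simp_all only: greaterThanAtMost_empty_iff not_le)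
      thus ?thesis by (simp only: measure_empty max_absorb1)
    qed simp
    ultimately show ?thesis using assms by (auto simp: max_def min_def)
  qed

  also have "\<dots> = (\<integral>u. indicator {a<..b} u * indicator {c<..d} u \<partial>lborel)"
    by (simp flip: indicator_inter_arith)
  finally show ?thesis .
qed

end

section \<open>The Wiener integral\<close>

lemma step_fun_Nil: "step_fun [] u = 0" and
  step_fun_Cons: "step_fun ((c,a,b) # xs) u = c * indicator {a<..b} u + step_fun xs u"
  by (simp_all add: step_fun_def)

lemma step_int_Nil: "step_int L [] \<omega> = 0" and
  step_int_Cons: "step_int L ((c,a,b) # xs) \<omega> = c * (L b \<omega> - L a \<omega>) + step_int L xs \<omega>"
  by (simp_all add: step_int_def)

lemma square_integrable_indicator: "square_integrable lborel (indicator {a<..b::real} :: real \<Rightarrow> real)"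
proof -
  have "(\<lambda>x. (indicator {a<..b} x :: real)^2) = indicator {a<..b}"
    by (auto simp: indicator_def)
  moreover have "emeasure lborel {a<..b} < \<infinity>" by (cases "a \<le> b") auto
  ultimately show ?thesis by (simp add: square_integrable_def)
qed

lemma step_fun_square_integrable: "square_integrable lborel (step_fun xs)"
proof (induction xs)
  case (Cons x xs)
  obtain c a b where x: "x = (c, a, b)" by (cases x)
  show ?case unfolding x step_fun_Cons
    by (intro square_integrable_add square_integrable_cmult square_integrable_indicator Cons.IH)
qed (simp add: step_fun_Nil square_integrable_def)

context standard_levy begin

lemma step_int_square_integrable: "square_integrable M (step_int L xs)"
proof (induction xs)
  case (Cons x xs)
  obtain c a b where x: "x = (c, a, b)" by (cases x)
  show ?case unfolding x step_int_Cons
    by (intro square_integrable_add square_integrable_cmult incr_square_integrable Cons.IH)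
qed (simp add: step_int_Nil square_integrable_def)

text \<open>The isometry is bilinear, so both lists are reduced to single intervals by induction.
  The order of the endpoints matters: for a reversed pair the indicator is zero whereas the
  increment is not.\<close>

lemma step_isometry:
  assumes "\<forall>(c,a,b)\<in>set xs. a \<le> b" "\<forall>(c,a,b)\<in>set ys. a \<le> b"
  shows "(\<integral>\<omega>. step_int L xs \<omega> * step_int L ys \<omega> \<partial>M) = (\<integral>u. step_fun xs u * step_fun ys u \<partial>lborel)"
proof -
  have add: "(\<integral>x. (c * X x + Y x) * Z x \<partial>N) = c * (\<integral>x. X x * Z x \<partial>N) + (\<integral>x. Y x * Z x \<partial>N)"
    if "square_integrable N X" "square_integrable N Y" "square_integrable N Z"
    for N :: "'b measure" and X Y Z c
    using square_integrable_mult[OF that(1,3)] square_integrable_mult[OF that(2,3)]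
    by (simp add: distrib_right mult.assoc)
  have add': "(\<integral>x. Z x * (c * X x + Y x) \<partial>N) = c * (\<integral>x. Z x * X x \<partial>N) + (\<integral>x. Z x * Y x \<partial>N)"
    if "square_integrable N X" "square_integrable N Y" "square_integrable N Z"
    for N :: "'b measure" and X Y Z c
    using add[OF that, of c] by (simp add: mult.commute)
  have one: "(\<integral>\<omega>. (L b \<omega> - L a \<omega>) * step_int L ys \<omega> \<partial>M) = (\<integral>u. indicator {a<..b} u * step_fun ys u \<partial>lborel)"
    if "a \<le> b" for a b using assms(2)
  proof (induction ys)
    case (Cons y ys)
    obtain c r s where y: "y = (c, r, s)" by (cases y)
    show ?case unfolding y step_int_Cons step_fun_Cons
      using Cons incr_covariance[OF that, of r s]
      by (simp add: y add' incr_square_integrable step_int_square_integrable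
          step_fun_square_integrable square_integrable_indicator)
  qed (simp add: step_fun_Nil step_int_Nil)
  show ?thesis using assms(1)
  proof (induction xs)
    case (Cons x xs)
    obtain c a b where x: "x = (c, a, b)" by (cases x)
    show ?case unfolding x step_int_Cons step_fun_Cons
      using Cons one[of a b]
      by (simp add: x add incr_square_integrable step_int_square_integrable
          step_fun_square_integrable square_integrable_indicator)
  qed (simp add: step_fun_Nil step_int_Nil)
qed

lemma wiener_integral_square_integrable:
  assumes "wiener_integral M L f X"
  shows "square_integrable M X"
proof -
  from assms obtain s where "X \<in> borel_measurable M"
     "(\<lambda>n. \<integral>\<^sup>+ \<omega>. ennreal ((X \<omega> - step_int L (s n) \<omega>)^2) \<partial>M) \<longlonglongrightarrow> 0"
    unfolding wiener_integral_def by blast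
  thus ?thesis by (rule square_integrable_limit(1)[OF _ step_int_square_integrable])
qed

lemma wiener_integrand_square_integrable:
  assumes "wiener_integral M L f X" "f \<in> borel_measurable borel"
  shows "square_integrable lborel f"
proof -
  from assms obtain s where
     "(\<lambda>n. \<integral>\<^sup>+ u. ennreal ((f u - step_fun (s n) u)^2) \<partial>lborel) \<longlonglongrightarrow> 0"
    unfolding wiener_integral_def by blast
  thus ?thesis
    by (rule square_integrable_limit(1)[OF _ step_fun_square_integrable, rotated])
       (use assms in simp)
qed

text \<open>The definition leaves the approximating sequence free, and each of the two integrals
  comes with its own. Continuity of both inner products lets the isometry for steps pass to the
  limit for any such pair.\<close>

lemma wiener_isometry:
  assumes X: "wiener_integral M L f X" and Y: "wiener_integral M L g Y"
    and [measurable]: "f \<in> borel_measurable borel" "g \<in> borel_measurable borel"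
  shows "(\<integral>\<omega>. X \<omega> * Y \<omega> \<partial>M) = (\<integral>u. f u * g u \<partial>lborel)"
proof -
  from X obtain s where s: "\<And>n. \<forall>(c,a,b)\<in>set (s n). a \<le> b"
     "(\<lambda>n. \<integral>\<^sup>+ u. ennreal ((f u - step_fun (s n) u)^2) \<partial>lborel) \<longlonglongrightarrow> 0"
     "(\<lambda>n. \<integral>\<^sup>+ \<omega>. ennreal ((X \<omega> - step_int L (s n) \<omega>)^2) \<partial>M) \<longlonglongrightarrow> 0"
    and Xm: "X \<in> borel_measurable M"
    unfolding wiener_integral_def by blast
  from Y obtain r where r: "\<And>n. \<forall>(c,a,b)\<in>set (r n). a \<le> b"
     "(\<lambda>n. \<integral>\<^sup>+ u. ennreal ((g u - step_fun (r n) u)^2) \<partial>lborel) \<longlonglongrightarrow> 0"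
     "(\<lambda>n. \<integral>\<^sup>+ \<omega>. ennreal ((Y \<omega> - step_int L (r n) \<omega>)^2) \<partial>M) \<longlonglongrightarrow> 0"
    and Ym: "Y \<in> borel_measurable M"
    unfolding wiener_integral_def by blast
  have fm: "f \<in> borel_measurable lborel" and gm: "g \<in> borel_measurable lborel" by auto
  have "(\<lambda>n. \<integral>\<omega>. step_int L (s n) \<omega> * step_int L (r n) \<omega> \<partial>M) \<longlonglongrightarrow> (\<integral>\<omega>. X \<omega> * Y \<omega> \<partial>M)"
    by (intro tendsto_integral_mult step_int_square_integrable
        square_integrable_limit[OF Xm step_int_square_integrable s(3)]
        square_integrable_limit[OF Ym step_int_square_integrable r(3)])
  moreover have "(\<lambda>n. \<integral>u. step_fun (s n) u * step_fun (r n) u \<partial>lborel) \<longlonglongrightarrow> (\<integral>u. f u * g u \<partial>lborel)"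
    by (intro tendsto_integral_mult step_fun_square_integrable
        square_integrable_limit[OF fm step_fun_square_integrable s(2)]
        square_integrable_limit[OF gm step_fun_square_integrable r(2)])
  ultimately show ?thesis
    using LIMSEQ_unique by (simp add: step_isometry[OF s(1) r(1)]) blast
qed

lemma wiener_integral_incr:
  assumes "a \<le> b"
  shows "wiener_integral M L (indicator {a<..b}) (\<lambda>\<omega>. L b \<omega> - L a \<omega>)"
  unfolding wiener_integral_def
  by (intro conjI exI[of _ "\<lambda>_. [(1, a, b)]"])
     (use assms in \<open>auto simp: step_fun_def step_int_def\<close>)

text \<open>The isometry makes the step integrals Cauchy as soon as the step functions converge, and
  completeness supplies the limit.\<close>

lemma wiener_integral_exists:
  assumes f: "square_integrable lborel f"
    and s: "\<And>n. \<forall>(c,a,b)\<in>set (s n). a \<le> b"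
    and lim: "(\<lambda>n. \<integral>u. (f u - step_fun (s n) u)^2 \<partial>lborel) \<longlonglongrightarrow> 0"
  shows "\<exists>X. wiener_integral M L f X"
proof -
  have lin: "(\<integral>\<omega>. (step_int L (s m) \<omega> - step_int L (s n) \<omega>)^2 \<partial>M)
      = (\<integral>u. (step_fun (s m) u - step_fun (s n) u)^2 \<partial>lborel)" for m n
    using step_isometry[OF s s]
    by (simp add: integral_square_diff step_int_square_integrable step_fun_square_integrable
        power2_eq_square[of "step_int _ _ _"] power2_eq_square[of "step_fun _ _"])
  have le: "(\<integral>u. (step_fun (s m) u - step_fun (s n) u)^2 \<partial>lborel) \<le>
     2 * (\<integral>u. (f u - step_fun (s m) u)^2 \<partial>lborel) + 2 * (\<integral>u. (f u - step_fun (s n) u)^2 \<partial>lborel)" for m n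
    using integral_square_add_le[OF square_integrable_diff[OF step_fun_square_integrable f]
        square_integrable_diff[OF f step_fun_square_integrable], of "s m" "s n"]
    by (simp add: power2_commute)
  have "\<exists>X. X \<in> borel_measurable M \<and>
     (\<lambda>n. \<integral>\<^sup>+ x. ennreal ((X x - step_int L (s n) x)^2) \<partial>M) \<longlonglongrightarrow> 0"
  proof (rule L2_complete[OF step_int_square_integrable])
    fix e :: real assume "e > 0"
    from order_tendstoD(2)[OF lim, of "e / 4"] \<open>e > 0\<close> obtain K where
      K: "\<And>n. n \<ge> K \<Longrightarrow> (\<integral>u. (f u - step_fun (s n) u)^2 \<partial>lborel) < e / 4"
      by (auto simp: eventually_sequentially)
    have "(\<integral>\<omega>. (step_int L (s m) \<omega> - step_int L (s n) \<omega>)^2 \<partial>M) < e" if "m \<ge> K" "n \<ge> K" for m n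
      unfolding lin using le[of m n] K[OF that(1)] K[OF that(2)] by linarith
    thus "\<exists>K. \<forall>m\<ge>K. \<forall>n\<ge>K. (\<integral>\<omega>. (step_int L (s m) \<omega> - step_int L (s n) \<omega>)^2 \<partial>M) < e" by blast
  qed
  moreover have "(\<integral>\<^sup>+ u. ennreal ((f u - step_fun (s n) u)^2) \<partial>lborel)
     = ennreal (\<integral>u. (f u - step_fun (s n) u)^2 \<partial>lborel)" for n
    by (intro nn_integral_square square_integrable_diff f step_fun_square_integrable)
  hence "(\<lambda>n. \<integral>\<^sup>+ u. ennreal ((f u - step_fun (s n) u)^2) \<partial>lborel) \<longlonglongrightarrow> 0"
    using tendsto_ennrealI[OF lim] by simp
  ultimately show ?thesis using s unfolding wiener_integral_def by blast
qed

end

section \<open>The Ornstein-Uhlenbeck test variables\<close>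

definition ou_kernel :: "real \<Rightarrow> real \<Rightarrow> real" where
  "ou_kernel m u = (if u \<le> m then exp (u - m) else 0)"

lemma ou_kernel_measurable [measurable]: "ou_kernel m \<in> borel_measurable borel"
  unfolding ou_kernel_def[abs_def] by measurable

lemma has_bochner_integral_exp_atLeast:
  fixes b c :: real
  assumes "0 < c"
  shows "has_bochner_integral lborel (\<lambda>u. exp (- c * u) * indicator {b..} u) (exp (- c * b) / c)"
proof -
  have "(\<integral>\<^sup>+x. ennreal (exp (- c * x)) * indicator {b..} x \<partial>lborel) = ennreal (0 - (- exp (- c * b) / c))"
  proof (rule nn_integral_FTC_atLeast)
    show "((\<lambda>x. - exp (- c * x) / c) has_real_derivative exp (- c * x)) (at x)" for x
      using assms by (auto intro!: derivative_eq_intros)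
    have "filterlim (\<lambda>x. c * x) at_top at_top"
      using assms by (intro filterlim_tendsto_pos_mult_at_top[OF tendsto_const]) (auto simp: filterlim_ident)
    hence "((\<lambda>x. exp (- (c * x))) \<longlongrightarrow> 0) at_top"
      by (intro filterlim_compose[OF exp_at_bot]) (simp add: filterlim_uminus_at_bot)
    thus "((\<lambda>x. - exp (- c * x) / c) \<longlongrightarrow> 0) at_top"
      using tendsto_divide[OF tendsto_minus tendsto_const, of _ 0 at_top c] assms by fastforce
  qed auto
  also have "(\<integral>\<^sup>+x. ennreal (exp (- c * x)) * indicator {b..} x \<partial>lborel) =
      (\<integral>\<^sup>+x. ennreal (exp (- c * x) * indicator {b..} x) \<partial>lborel)"
    by (intro nn_integral_cong) (auto simp: indicator_def)
  finally show ?thesis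
    using assms by (intro has_bochner_integral_nn_integral) auto
qed

lemma has_bochner_integral_exp_atMost:
  fixes b c :: real
  assumes "0 < c"
  shows "has_bochner_integral lborel (\<lambda>u. exp (c * u) * indicator {..b} u) (exp (c * b) / c)"
proof -
  have "has_bochner_integral lborel (\<lambda>x. exp (- c * x) * indicator {- b..} x) (exp (c * b) / c)"
    using has_bochner_integral_exp_atLeast[OF assms, of "- b"] by simp
  from lborel_has_bochner_integral_real_affine_iff[of "-1", THEN iffD1, OF _ this, of 0]
  show ?thesis by (simp add: indicator_def)
qed

lemma ou_kernel_square_integrable: "square_integrable lborel (ou_kernel m)"
  and ou_kernel_norm: "(\<integral>u. (ou_kernel m u)^2 \<partial>lborel) = 1 / 2"
proof -
  have eq: "(ou_kernel m u)^2 = exp (- 2 * m) * (exp (2 * u) * indicator {..m} u)" for u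
    by (auto simp: ou_kernel_def indicator_def power2_eq_square simp flip: exp_add)
  have "has_bochner_integral lborel (\<lambda>u. (ou_kernel m u)^2) (exp (- 2 * m) * (exp (2 * m) / 2))"
    unfolding eq by (intro has_bochner_integral_mult_right has_bochner_integral_exp_atMost) auto
  hence *: "has_bochner_integral lborel (\<lambda>u. (ou_kernel m u)^2) (1 / 2)"
    by (simp flip: exp_add add: mult_ac)
  show "square_integrable lborel (ou_kernel m)"
    using * by (auto simp: square_integrable_def has_bochner_integral_iff)
  show "(\<integral>u. (ou_kernel m u)^2 \<partial>lborel) = 1 / 2"
    using * by (simp add: has_bochner_integral_iff)
qed

text \<open>Cells of length 1 / N, counted from \<open>m\<close> to the left, each carrying the
  value of the kernel at its right endpoint. Taking N^2 of them covers a stretch of length N, so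
  that refinement and exhaustion happen together.\<close>

definition ou_steps :: "real \<Rightarrow> nat \<Rightarrow> (real \<times> real \<times> real) list" where
  "ou_steps m N = map (\<lambda>k. (exp (- real k / real N), m - (real k + 1) / real N, m - real k / real N)) [0..<N*N]"

lemma step_fun_ou_steps:
  assumes N: "0 < N"
  shows "step_fun (ou_steps m N) u =
     (if u \<le> m \<and> nat \<lfloor>(m - u) * N\<rfloor> < N * N then exp (- real (nat \<lfloor>(m - u) * N\<rfloor>) / N) else 0)"
proof -
  define K where "K = nat \<lfloor>(m - u) * N\<rfloor>"
  have mem: "u \<in> {m - (real k + 1) / real N<..m - real k / real N} \<longleftrightarrow> u \<le> m \<and> k = K" for k
  proof -
    have "u \<in> {m - (real k + 1) / real N<..m - real k / real N} \<longleftrightarrow>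
          real k \<le> (m - u) * N \<and> (m - u) * N < real k + 1"
      using N by (auto simp: field_simps)
    also have "\<dots> \<longleftrightarrow> \<lfloor>(m - u) * N\<rfloor> = int k"
      by (auto simp: floor_eq_iff)
    also have "\<dots> \<longleftrightarrow> u \<le> m \<and> k = K"
    proof (cases "u \<le> m")
      case True
      hence "0 \<le> (m - u) * N" by simp
      thus ?thesis using True by (auto simp: K_def)
    next
      case False
      hence "(m - u) * N < 0" using N by (simp add: mult_neg_pos)
      hence "\<lfloor>(m - u) * N\<rfloor> < 0" by linarith
      thus ?thesis using False by (simp, linarith)
    qed
    finally show ?thesis .
  qed
  have "step_fun (ou_steps m N) u =
     (\<Sum>k<N*N. exp (- real k / real N) * indicator {m - (real k + 1) / real N<..m - real k / real N} u)"
    unfolding step_fun_def ou_steps_def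
    by (simp add: comp_def interv_sum_list_conv_sum_set_nat lessThan_atLeast0)
  also have "\<dots> = (\<Sum>k<N*N. if k = K then (if u \<le> m then exp (- real K / real N) else 0) else 0)"
    by (intro sum.cong refl) (auto simp: indicator_def mem simp del: greaterThanAtMost_iff)
  also have "\<dots> = (if u \<le> m \<and> K < N * N then exp (- real K / N) else 0)"
    by (subst sum.delta) auto
  finally show ?thesis by (simp add: K_def)
qed

text \<open>The kernel increases by at most the factor exp (1 / N) across a cell, which is at most
  exp 1 for every \<open>N\<close>. This gives the majorant for dominated convergence.\<close>

lemma ou_steps_bound:
  assumes N: "0 < N"
  shows "\<bar>step_fun (ou_steps m N) u\<bar> \<le> exp 1 * ou_kernel m u"
proof (cases "u \<le> m \<and> nat \<lfloor>(m - u) * N\<rfloor> < N * N")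
  case True
  have "(m - u) * N \<le> real (nat \<lfloor>(m - u) * N\<rfloor>) + 1" using True by linarith
  hence "u - m + 1 / N \<ge> - real (nat \<lfloor>(m - u) * N\<rfloor>) / N" using N by (simp add: field_simps)
  moreover have "1 / real N \<le> 1" using N by simp
  ultimately have "- real (nat \<lfloor>(m - u) * N\<rfloor>) / N \<le> 1 + (u - m)" by linarith
  thus ?thesis using True by (simp add: step_fun_ou_steps[OF N] ou_kernel_def flip: exp_add)
qed (auto simp: step_fun_ou_steps[OF N] ou_kernel_def)

lemma ou_steps_tendsto: "(\<lambda>n. step_fun (ou_steps m (Suc n)) u) \<longlonglongrightarrow> ou_kernel m u"
proof (cases "u \<le> m")
  case True
  define K where "K n = nat \<lfloor>(m - u) * real (Suc n)\<rfloor>" for n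
  have Kb: "real (K n) \<le> (m - u) * real (Suc n)" "(m - u) * real (Suc n) < real (K n) + 1" for n
  proof -
    have "0 \<le> (m - u) * real (Suc n)" using True by simp
    thus "real (K n) \<le> (m - u) * real (Suc n)" "(m - u) * real (Suc n) < real (K n) + 1"
      unfolding K_def by linarith+
  qed
  have "(\<lambda>n. real (K n) / real (Suc n)) \<longlonglongrightarrow> m - u"
  proof (rule tendsto_sandwich)
    show "eventually (\<lambda>n. (m - u) - inverse (real (Suc n)) \<le> real (K n) / real (Suc n)) sequentially"
    proof (intro always_eventually allI)
      fix n show "(m - u) - inverse (real (Suc n)) \<le> real (K n) / real (Suc n)"
      proof -
        have "((m - u) * real (Suc n) - 1) / real (Suc n) \<le> real (K n) / real (Suc n)"
          using Kb(2)[of n] by (intro divide_right_mono) auto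
        thus ?thesis by (simp add: diff_divide_distrib inverse_eq_divide del: of_nat_Suc)
      qed
    qed
    show "eventually (\<lambda>n. real (K n) / real (Suc n) \<le> m - u) sequentially"
      using Kb by (auto simp: field_simps intro!: always_eventually)
    show "(\<lambda>n. (m - u) - inverse (real (Suc n))) \<longlonglongrightarrow> m - u"
      using tendsto_diff[OF tendsto_const LIMSEQ_inverse_real_of_nat, of "m - u"] by simp
  qed simp
  hence "(\<lambda>n. exp (- (real (K n) / real (Suc n)))) \<longlonglongrightarrow> exp (- (m - u))"
    by (intro tendsto_intros)
  moreover have "eventually (\<lambda>n. exp (- (real (K n) / real (Suc n))) = step_fun (ou_steps m (Suc n)) u) sequentially"
  proof -
    obtain n0 :: nat where n0: "m - u < real n0" using reals_Archimedean2 by blast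
    show ?thesis
    proof (rule eventually_sequentiallyI[of n0])
      fix n assume "n0 \<le> n"
      hence "m - u < real (Suc n)" using n0 by linarith
      hence "(m - u) * real (Suc n) < real (Suc n) * real (Suc n)" by (intro mult_strict_right_mono) auto
      hence "real (K n) < real (Suc n * Suc n)" using Kb(1)[of n] by (simp only: of_nat_mult)
      hence "K n < Suc n * Suc n" by (simp only: of_nat_less_iff)
      thus "exp (- (real (K n) / real (Suc n))) = step_fun (ou_steps m (Suc n)) u"
        using True by (simp add: step_fun_ou_steps K_def)
    qed
  qed
  ultimately show ?thesis
    using True by (simp add: ou_kernel_def Lim_transform_eventually)
qed (simp add: step_fun_ou_steps ou_kernel_def)

context standard_levy begin

lemma ou_exists: "\<exists>X. wiener_integral M L (ou_kernel m) X"
proof (rule wiener_integral_exists[OF ou_kernel_square_integrable, where s = "\<lambda>n. ou_steps m (Suc n)"])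
  show "\<forall>(c,a,b)\<in>set (ou_steps m (Suc n)). a \<le> b" for n
    by (auto simp: ou_steps_def divide_right_mono)
  have [measurable]: "step_fun xs \<in> borel_measurable lborel" for xs
    using step_fun_square_integrable square_integrable_measurable by blast
  have "(\<lambda>n. \<integral>u. (ou_kernel m u - step_fun (ou_steps m (Suc n)) u)^2 \<partial>lborel) \<longlonglongrightarrow> (\<integral>u. 0 \<partial>(lborel :: real measure))"
  proof (rule integral_dominated_convergence)
    show "integrable lborel (\<lambda>u. (1 + exp 1)^2 * (ou_kernel m u)^2)"
      using ou_kernel_square_integrable[of m] by (simp add: square_integrable_def)
    have "(\<lambda>n. (ou_kernel m u - step_fun (ou_steps m (Suc n)) u)^2) \<longlonglongrightarrow> (ou_kernel m u - ou_kernel m u)^2" for u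
      by (intro tendsto_intros ou_steps_tendsto)
    thus "AE u in lborel. (\<lambda>n. (ou_kernel m u - step_fun (ou_steps m (Suc n)) u)^2) \<longlonglongrightarrow> 0"
      by simp
    have "norm ((ou_kernel m u - step_fun (ou_steps m (Suc n)) u)^2) \<le> (1 + exp 1)^2 * (ou_kernel m u)^2" for n u
    proof -
      have "\<bar>ou_kernel m u - step_fun (ou_steps m (Suc n)) u\<bar> \<le> (1 + exp 1) * ou_kernel m u"
      proof -
        have "0 \<le> ou_kernel m u" by (simp add: ou_kernel_def)
        moreover have "\<bar>step_fun (ou_steps m (Suc n)) u\<bar> \<le> exp 1 * ou_kernel m u"
          by (rule ou_steps_bound) simp
        ultimately show ?thesis by (simp only: distrib_right)
      qed
      from power_mono[OF this, of 2] show ?thesis by (simp add: power_mult_distrib)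
    qed
    thus "AE u in lborel. norm ((ou_kernel m u - step_fun (ou_steps m (Suc n)) u)^2) \<le> (1 + exp 1)^2 * (ou_kernel m u)^2" for n
      by simp
  qed auto
  thus "(\<lambda>n. \<integral>u. (ou_kernel m u - step_fun (ou_steps m (Suc n)) u)^2 \<partial>lborel) \<longlonglongrightarrow> 0" by simp
qed

definition ou :: "real \<Rightarrow> 'a \<Rightarrow> real" where
  "ou m = (SOME X. wiener_integral M L (ou_kernel m) X)"

lemma ou: "wiener_integral M L (ou_kernel m) (ou m)"
  unfolding ou_def by (rule someI_ex[OF ou_exists])

lemma ou_square_integrable: "square_integrable M (ou m)"
  by (rule wiener_integral_square_integrable[OF ou])

lemma ou_norm: "(\<integral>\<omega>. (ou m \<omega>)^2 \<partial>M) = 1 / 2"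
  using wiener_isometry[OF ou ou, of m m] ou_kernel_norm[of m] by (simp add: power2_eq_square)

text \<open>Finite linear combinations enter below only through inner products, so bilinearity of
  the isometry is used in place of a linearity theorem for the Wiener integral.\<close>

lemma wiener_isometry_sum:
  assumes X: "\<And>i. i \<in> I \<Longrightarrow> wiener_integral M L (f i) (X i)" and Y: "\<And>j. j \<in> J \<Longrightarrow> wiener_integral M L (g j) (Y j)"
    and f: "\<And>i. i \<in> I \<Longrightarrow> f i \<in> borel_measurable borel" and g: "\<And>j. j \<in> J \<Longrightarrow> g j \<in> borel_measurable borel"
  shows "(\<integral>\<omega>. (\<Sum>i\<in>I. c i * X i \<omega>) * (\<Sum>j\<in>J. d j * Y j \<omega>) \<partial>M) =
         (\<integral>u. (\<Sum>i\<in>I. c i * f i u) * (\<Sum>j\<in>J. d j * g j u) \<partial>lborel)"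
proof -
  have "(\<integral>\<omega>. (\<Sum>i\<in>I. c i * X i \<omega>) * (\<Sum>j\<in>J. d j * Y j \<omega>) \<partial>M) =
        (\<Sum>i\<in>I. \<Sum>j\<in>J. c i * d j * (\<integral>\<omega>. X i \<omega> * Y j \<omega> \<partial>M))"
    using wiener_integral_square_integrable[OF X] wiener_integral_square_integrable[OF Y]
    by (rule integral_mult_sum_sum)
  also have "\<dots> = (\<Sum>i\<in>I. \<Sum>j\<in>J. c i * d j * (\<integral>u. f i u * g j u \<partial>lborel))"
    by (intro sum.cong refl) (simp add: wiener_isometry[OF X Y f g])
  also have "\<dots> = (\<integral>u. (\<Sum>i\<in>I. c i * f i u) * (\<Sum>j\<in>J. d j * g j u) \<partial>lborel)"
  proof (rule integral_mult_sum_sum[symmetric])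
    show "square_integrable lborel (f i)" if "i \<in> I" for i
      by (rule wiener_integrand_square_integrable[OF X[OF that] f[OF that]])
    show "square_integrable lborel (g j)" if "j \<in> J" for j
      by (rule wiener_integrand_square_integrable[OF Y[OF that] g[OF that]])
  qed
  finally show ?thesis .
qed

text \<open>The combined kernel vanishes outside the last interval of length \<Delta>, since beyond
  it the two exponentials cancel. On that interval it equals 1 - exp (u - t), which is at most
  \<Delta>, so its square integrates to at most \<Delta> cubed.\<close>

lemma incr_approx_ou:
  assumes "0 < \<Delta>"
  shows "(\<integral>\<omega>. (L t \<omega> - L (t - \<Delta>) \<omega> - (ou t \<omega> - exp (- \<Delta>) * ou (t - \<Delta>) \<omega>))^2 \<partial>M) \<le> \<Delta>^3"
proof -
  define X where "X i = (if i = (0::nat) then (\<lambda>\<omega>. L t \<omega> - L (t - \<Delta>) \<omega>) else if i = 1 then ou t else ou (t - \<Delta>))" for i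
  define f where "f i = (if i = (0::nat) then indicator {t-\<Delta><..t} else if i = 1 then ou_kernel t else ou_kernel (t - \<Delta>))" for i
  define c where "c i = (if i = (0::nat) then 1 else if i = 1 then - 1 else exp (- \<Delta>))" for i
  have "(\<integral>\<omega>. (\<Sum>i<3. c i * X i \<omega>) * (\<Sum>i<3. c i * X i \<omega>) \<partial>M) = (\<integral>u. (\<Sum>i<3. c i * f i u) * (\<Sum>i<3. c i * f i u) \<partial>lborel)"
    using assms by (intro wiener_isometry_sum) (auto simp: X_def f_def intro: ou wiener_integral_incr)
  also have "\<dots> \<le> (\<integral>u. \<Delta>^2 * indicator {t-\<Delta><..t} u \<partial>lborel)"
  proof (rule integral_mono')
    show "integrable lborel (\<lambda>u. \<Delta>^2 * indicator {t-\<Delta><..t} u)"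
      using assms by auto
    fix u
    have "\<bar>\<Sum>i<3. c i * f i u\<bar> \<le> \<Delta> * indicator {t-\<Delta><..t} u"
    proof -
      consider "u > t" | "t - \<Delta> < u" "u \<le> t" | "u \<le> t - \<Delta>" by linarith
      thus ?thesis
      proof cases
        case 2
        have "1 + (u - t) \<le> exp (u - t)" by (rule exp_ge_add_one_self)
        moreover have "exp (u - t) \<le> 1" using 2 by simp
        ultimately have "\<bar>1 - exp (u - t)\<bar> \<le> \<Delta>" using 2 by linarith
        thus ?thesis using 2 by (simp add: eval_nat_numeral c_def f_def ou_kernel_def)
      qed (use assms in \<open>auto simp: eval_nat_numeral c_def f_def ou_kernel_def simp flip: exp_add\<close>)
    qed
    from power_mono[OF this, of 2]
    show "(\<Sum>i<3. c i * f i u) * (\<Sum>i<3. c i * f i u) \<le> \<Delta>^2 * indicator {t-\<Delta><..t} u"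
      by (auto simp: power2_eq_square indicator_def split: if_splits)
  qed auto
  also have "\<dots> = \<Delta>^3" using assms by (simp add: power2_eq_square power3_eq_cube)
  finally show ?thesis
    by (simp add: eval_nat_numeral c_def X_def algebra_simps)
qed

end

section \<open>The impulse response of the state-space form\<close>

text \<open>\<open>mpow\<close> is defined by multiplication on the right, whereas the shift
  structure of the companion matrix is visible when it acts from the left.\<close>

lemma mpow_Suc_left:
  assumes "i < p" "j < p"
  shows "mpow p A (Suc k) i j = (\<Sum>l<p. A i l * mpow p A k l j)"
  using assms
proof (induction k arbitrary: j)
  case 0
  have "(\<Sum>l<p. (if i = l then 1 else 0) * A l j) = A i j"
    using 0 by (simp add: if_distrib[of "\<lambda>x. x * _"] cong: if_cong)
  moreover have "(\<Sum>l<p. A i l * (if l = j then 1 else 0)) = A i j"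
    using 0 by (simp add: if_distrib[of "\<lambda>x. _ * x"] cong: if_cong)
  ultimately show ?case by simp
next
  case (Suc k)
  have "mpow p A (Suc (Suc k)) i j = (\<Sum>l<p. (\<Sum>m<p. A i m * mpow p A k m l) * A l j)"
    by (subst mpow.simps) (intro sum.cong refl, use Suc in auto)
  also have "\<dots> = (\<Sum>m<p. A i m * (\<Sum>l<p. mpow p A k m l * A l j))"
    unfolding sum_distrib_left sum_distrib_right mult.assoc by (rule sum.swap)
  finally show ?case by simp
qed

text \<open>The top right entries of the powers of the companion matrix. They solve the linear
  recurrence with characteristic polynomial \<open>a\<close>, started from 0, ..., 0, 1, and are the
  Taylor data of the impulse response.\<close>

definition fund_seq :: "real poly \<Rightarrow> nat \<Rightarrow> real" where
  "fund_seq a k = mpow (degree a) (carma_A a) k 0 (degree a - 1)"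

text \<open>All rows of the companion matrix but the last are shifts, so moving down one row amounts
  to taking one more power.\<close>

lemma mpow_fund_seq:
  assumes "i < degree a"
  shows "mpow (degree a) (carma_A a) k i (degree a - 1) = fund_seq a (k + i)"
  using assms
proof (induction i arbitrary: k)
  case (Suc i)
  have "mpow (degree a) (carma_A a) (Suc k) i (degree a - 1) = mpow (degree a) (carma_A a) k (Suc i) (degree a - 1)"
    using Suc.prems
    by (simp add: mpow_Suc_left carma_A_def if_distrib[of "\<lambda>x. x * _"] cong: if_cong
        del: One_nat_def mpow.simps) simp
  thus ?case using Suc.IH[of "Suc k"] Suc.prems by simp
qed (simp add: fund_seq_def)

lemma fund_seq_rec:
  assumes "0 < degree a"
  shows "fund_seq a (k + degree a) = - (\<Sum>j<degree a. coeff a j * fund_seq a (k + j))"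
proof -
  have "fund_seq a (k + degree a) = mpow (degree a) (carma_A a) (Suc k) (degree a - 1) (degree a - 1)"
    using mpow_fund_seq[of "degree a - 1" a "Suc k"] assms by simp
  also have "\<dots> = (\<Sum>l<degree a. - coeff a l * fund_seq a (k + l))"
    using assms by (subst mpow_Suc_left) (auto simp: carma_A_def mpow_fund_seq simp del: One_nat_def intro!: sum.cong)
  finally show ?thesis by (simp add: sum_negf)
qed

lemma fund_seq_init: "k < degree a \<Longrightarrow> fund_seq a k = (if k = degree a - 1 then 1 else 0)"
  using mpow_fund_seq[of k a 0] by simp

text \<open>Geometric growth is all that is needed for the exponential series built from this
  sequence to converge everywhere.\<close>

lemma fund_seq_bound:
  assumes "0 < degree a"
  shows "\<bar>fund_seq a k\<bar> \<le> (1 + (\<Sum>j<degree a. \<bar>coeff a j\<bar>))^k"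
proof (induction k rule: less_induct)
  case (less k)
  define R where "R = 1 + (\<Sum>j<degree a. \<bar>coeff a j\<bar>)"
  have R: "1 \<le> R" by (simp add: R_def sum_nonneg)
  show ?case
  proof (cases "k < degree a")
    case True
    thus ?thesis using one_le_power[OF R, of k] by (simp add: fund_seq_init R_def)
  next
    case False
    define n where "n = k - degree a"
    have k: "k = n + degree a" using False by (simp add: n_def)
    have "\<bar>fund_seq a k\<bar> = \<bar>\<Sum>j<degree a. coeff a j * fund_seq a (n + j)\<bar>"
      by (simp add: k fund_seq_rec[OF assms])
    also have "\<dots> \<le> (\<Sum>j<degree a. \<bar>coeff a j\<bar> * R^(k - 1))"
    proof (rule order_trans[OF sum_abs sum_mono])
      fix j assume j: "j \<in> {..<degree a}"
      have "\<bar>fund_seq a (n + j)\<bar> \<le> R^(n + j)" using less[of "n + j"] j by (simp add: R_def k)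
      also have "\<dots> \<le> R^(k - 1)" using R j by (intro power_increasing) (auto simp: k)
      finally show "\<bar>coeff a j * fund_seq a (n + j)\<bar> \<le> \<bar>coeff a j\<bar> * R^(k - 1)"
        by (simp add: abs_mult mult_left_mono)
    qed
    also have "\<dots> = (R - 1) * R^(k - 1)" by (simp add: R_def sum_distrib_right)
    also have "\<dots> \<le> R * R^(k - 1)" using R by (intro mult_right_mono) auto
    also have "\<dots> = R^k" using k assms by (simp add: power_eq_if)
    finally show ?thesis by (simp add: R_def)
  qed
qed

text \<open>The k-th derivative of the fundamental solution of a(D) f = 0.\<close>
definition fund_sol :: "real poly \<Rightarrow> nat \<Rightarrow> real \<Rightarrow> real" where
  "fund_sol a k t = (\<Sum>n. fund_seq a (n + k) / fact n * t^n)"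

lemma fund_sol_summable:
  assumes "0 < degree a"
  shows "summable (\<lambda>n. fund_seq a (n + k) / fact n * t^n)"
proof (rule summable_comparison_test)
  define R where "R = 1 + (\<Sum>j<degree a. \<bar>coeff a j\<bar>)"
  show "summable (\<lambda>n. R^k * (inverse (fact n) * (R * \<bar>t\<bar>)^n))"
    by (intro summable_mult summable_exp)
  show "\<exists>N. \<forall>n\<ge>N. norm (fund_seq a (n + k) / fact n * t^n) \<le> R^k * (inverse (fact n) * (R * \<bar>t\<bar>)^n)"
  proof (intro exI allI impI)
    fix n :: nat
    have "\<bar>fund_seq a (n + k)\<bar> * (inverse (fact n) * \<bar>t\<bar>^n) \<le> R^(n + k) * (inverse (fact n) * \<bar>t\<bar>^n)"
      using fund_seq_bound[OF assms, of "n + k"] by (intro mult_right_mono) (auto simp: R_def)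
    thus "norm (fund_seq a (n + k) / fact n * t^n) \<le> R^k * (inverse (fact n) * (R * \<bar>t\<bar>)^n)"
      by (simp add: abs_mult power_abs power_add power_mult_distrib field_simps)
  qed
qed

lemma fund_sol_deriv:
  assumes "0 < degree a"
  shows "(fund_sol a k has_real_derivative fund_sol a (Suc k) t) (at t)"
proof -
  have "diffs (\<lambda>n. fund_seq a (n + k) / fact n) = (\<lambda>n. fund_seq a (n + Suc k) / fact n)"
    by (simp add: diffs_def fun_eq_iff del: of_nat_Suc)
  thus ?thesis
    using termdiffs_strong_converges_everywhere[of "\<lambda>n. fund_seq a (n + k) / fact n" t]
      fund_sol_summable[OF assms] unfolding fund_sol_def[abs_def] by simp
qed

lemma fund_sol_0: "fund_sol a k 0 = fund_seq a k"
  unfolding fund_sol_def by (subst powser_zero) simp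

lemma fund_sol_ode:
  assumes "0 < degree a"
  shows "fund_sol a (k + degree a) t = - (\<Sum>j<degree a. coeff a j * fund_sol a (k + j) t)"
proof -
  have "(\<Sum>j<degree a. coeff a j * fund_sol a (k + j) t)
      = (\<Sum>n. \<Sum>j<degree a. coeff a j * (fund_seq a (n + (k + j)) / fact n * t^n))"
    unfolding fund_sol_def
    by (simp only: suminf_sum[OF summable_mult[OF fund_sol_summable[OF assms]]]
        suminf_mult[OF fund_sol_summable[OF assms]])
  also have "\<dots> = (\<Sum>n. - (fund_seq a (n + (k + degree a)) / fact n * t^n))"
    using fund_seq_rec[OF assms]
    by (simp add: sum_distrib_right sum_distrib_left sum_divide_distrib add.assoc[symmetric] mult.assoc)
  also have "\<dots> = - fund_sol a (k + degree a) t"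
    unfolding fund_sol_def by (rule suminf_minus[OF fund_sol_summable[OF assms]])
  finally show ?thesis by simp
qed

text \<open>The k-th derivative of the smooth function on the whole line that agrees with the kernel
  on the positive half line. Separating it from the cut-off at 0 makes differential equations and
  shifts available without case distinctions.\<close>

definition carma_response :: "real \<Rightarrow> real poly \<Rightarrow> real poly \<Rightarrow> nat \<Rightarrow> real \<Rightarrow> real" where
  "carma_response \<sigma> a b k t = \<sigma> * (\<Sum>j<degree a. coeff b j * fund_sol a (k + j) t)"

lemma carma_kernel_eq:
  assumes "0 < degree a"
  shows "carma_kernel \<sigma> a b t = (if 0 < t then carma_response \<sigma> a b 0 t else 0)"
proof -
  have "(\<Sum>j<degree a. coeff b j * fund_sol a j t) =
     (\<Sum>n. \<Sum>j<degree a. coeff b j * (fund_seq a (n + j) / fact n * t^n))"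
    unfolding fund_sol_def
    by (simp only: suminf_sum[OF summable_mult[OF fund_sol_summable[OF assms]]]
        suminf_mult[OF fund_sol_summable[OF assms]])
  also have "\<dots> = (\<Sum>k. t^k / fact k * (\<Sum>j<degree a. coeff b j * mpow (degree a) (carma_A a) k j (degree a - 1)))"
    by (intro suminf_cong) (auto simp: sum_distrib_left mpow_fund_seq simp del: One_nat_def intro!: sum.cong)
  finally show ?thesis by (simp add: carma_kernel_def carma_response_def)
qed

lemma carma_response_deriv:
  assumes "0 < degree a"
  shows "(carma_response \<sigma> a b k has_real_derivative carma_response \<sigma> a b (Suc k) t) (at t)"
  unfolding carma_response_def[abs_def]
  by (intro derivative_intros DERIV_sum DERIV_cmult) (use fund_sol_deriv[OF assms] in simp)

section \<open>Factorised linear differential and difference operators\<close>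

text \<open>The product of the operators D - l over the list. \<open>F k\<close> stands for the k-th
  derivative of one function, so the product acts on the family without a derivative
  operator.\<close>

primrec diff_op :: "complex list \<Rightarrow> (nat \<Rightarrow> real \<Rightarrow> complex) \<Rightarrow> nat \<Rightarrow> real \<Rightarrow> complex" where
  "diff_op [] F = F"
| "diff_op (l # ls) F = diff_op ls (\<lambda>k t. F (Suc k) t - l * F k t)"

text \<open>The product of the difference operators f(t) - exp (\<Delta> l) f(t - \<Delta>), which
  is the sampled autoregressive filter, applied at every level of the family.\<close>

primrec shift_op :: "real \<Rightarrow> complex list \<Rightarrow> (nat \<Rightarrow> real \<Rightarrow> complex) \<Rightarrow> nat \<Rightarrow> real \<Rightarrow> complex" where
  "shift_op \<Delta> [] F = F"
| "shift_op \<Delta> (l # ls) F = shift_op \<Delta> ls (\<lambda>k t. F k t - exp (\<Delta> * l) * F k (t - \<Delta>))"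

lemma degree_prod_list_linear: "degree (\<Prod>l\<leftarrow>ls. [:c l, 1:] :: 'a :: idom poly) = length ls"
  and prod_list_linear_nonzero: "(\<Prod>l\<leftarrow>ls. [:c l, 1:] :: 'a :: idom poly) \<noteq> 0"
proof (induction ls)
  case (Cons l ls)
  {
    case 1 show ?case using Cons by (simp add: degree_mult_eq del: mult_pCons_left)
  next
    case 2 show ?case using Cons by (simp del: mult_pCons_left)
  }
qed auto

lemma degree_sampled_ar_poly: "degree (sampled_ar_poly \<Delta> ls) \<le> length ls"
proof (induction ls)
  case (Cons l ls)
  show ?case unfolding sampled_ar_poly_def list.map prod_list.Cons
    using Cons by (intro order_trans[OF degree_mult_le]) (simp add: sampled_ar_poly_def)
qed (simp add: sampled_ar_poly_def)

lemma sum_coeff_linear_mult: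
  fixes Q :: "complex poly"
  assumes "degree Q \<le> n"
  shows "(\<Sum>j\<le>Suc n. coeff ([:c, d:] * Q) j * f j) = (\<Sum>j\<le>n. coeff Q j * (c * f j + d * f (Suc j)))"
proof -
  have "coeff ([:c, d:] * Q) j = c * coeff Q j + (case j of 0 \<Rightarrow> 0 | Suc i \<Rightarrow> d * coeff Q i)" for j
    by (auto simp: coeff_pCons split: nat.splits)
  hence "(\<Sum>j\<le>Suc n. coeff ([:c, d:] * Q) j * f j) =
    (\<Sum>j\<le>Suc n. c * coeff Q j * f j) + (\<Sum>j\<le>Suc n. (case j of 0 \<Rightarrow> 0 | Suc i \<Rightarrow> d * coeff Q i) * f j)"
    by (simp only: distrib_right sum.distrib)
  also have "(\<Sum>j\<le>Suc n. c * coeff Q j * f j) = (\<Sum>j\<le>n. c * coeff Q j * f j)"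
    using assms by (simp add: coeff_eq_0)
  also have "(\<Sum>j\<le>Suc n. (case j of 0 \<Rightarrow> 0 | Suc i \<Rightarrow> d * coeff Q i) * f j) = (\<Sum>j\<le>n. d * coeff Q j * f (Suc j))"
    by (subst sum.atMost_Suc_shift) simp
  finally show ?thesis by (simp add: sum.distrib algebra_simps)
qed

lemma diff_op_eq: "diff_op ls F k t = (\<Sum>j\<le>length ls. coeff (\<Prod>l\<leftarrow>ls. [:- l, 1:]) j * F (k + j) t)"
proof (induction ls arbitrary: F)
  case (Cons l ls)
  show ?case
    using Cons sum_coeff_linear_mult[of "\<Prod>l\<leftarrow>ls. [:- l, 1:]" "length ls" "- l" 1 "\<lambda>j. F (k + j) t"]
    by (simp add: degree_prod_list_linear algebra_simps del: mult_pCons_left)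
qed simp

lemma shift_op_eq:
  "shift_op \<Delta> ls F k t = (\<Sum>j\<le>length ls. coeff (sampled_ar_poly \<Delta> ls) j * F k (t - real j * \<Delta>))"
proof (induction ls arbitrary: F)
  case (Cons l ls)
  show ?case
    using Cons sum_coeff_linear_mult[OF degree_sampled_ar_poly, of 1 "- exp (\<Delta> * l)" \<Delta> ls "\<lambda>j. F k (t - real j * \<Delta>)"]
    by (simp add: sampled_ar_poly_def algebra_simps del: mult_pCons_left)
qed (simp add: sampled_ar_poly_def)

definition deriv_family :: "(nat \<Rightarrow> real \<Rightarrow> complex) \<Rightarrow> bool" where
  "deriv_family F \<longleftrightarrow> (\<forall>k t. (F k has_vector_derivative F (Suc k) t) (at t))"

lemma deriv_family_step:
  assumes "deriv_family F"
  shows "deriv_family (\<lambda>k t. F (Suc k) t - l * F k t)"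
  unfolding deriv_family_def
  using assms by (auto simp: deriv_family_def intro!: derivative_eq_intros)

lemma deriv_family_diff_op: "deriv_family F \<Longrightarrow> deriv_family (diff_op ls F)"
  by (induction ls arbitrary: F) (auto intro: deriv_family_step)

text \<open>The recursion applies the head factor innermost. Since the factors commute it may also
  be applied last, which exhibits \<open>diff_op ls F\<close> as a solution of a first-order
  equation whenever the full product vanishes.\<close>

lemma diff_op_Cons_outer:
  "diff_op (l # ls) F k t = diff_op ls F (Suc k) t - l * diff_op ls F k t"
  by (simp add: diff_op_eq sum_subtractf sum_distrib_left algebra_simps)

text \<open>Variation of constants: f(t) exp (- l t) has derivative (f' - l f) exp (- l t), hence
  grows at most like exp (r t) with r = - Re l - e. Multiplying back by exp (Re l t) turns this
  growth into the decay exp (- e t).\<close>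

lemma first_order_bound:
  fixes f f' :: "real \<Rightarrow> complex"
  assumes f: "\<And>t. (f has_vector_derivative f' t) (at t)"
    and bd: "\<And>t. 0 \<le> t \<Longrightarrow> norm (f' t - l * f t) \<le> C * exp (- e * t)"
    and e: "Re l < - e" and t: "0 \<le> t"
  shows "norm (f t) \<le> (norm (f 0) + C / (- Re l - e)) * exp (- e * t)"
proof -
  define r where "r = - Re l - e"
  have r: "0 < r" using e by (simp add: r_def)
  have C: "0 \<le> C" using order_trans[OF norm_ge_zero bd[of 0]] by simp
  define g where "g t = exp (- l * t) * f t" for t :: real
  have g: "(g has_vector_derivative exp (- l * t) * (f' t - l * f t)) (at t)" for t
    unfolding g_def[abs_def]
    by (rule derivative_eq_intros f refl has_vector_derivative_real_field)+ (simp add: algebra_simps)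
  have "norm (g t - g 0) \<le> C / r * exp (r * t) - C / r * exp (r * 0)"
  proof (cases "t = 0")
    case False
    with t have "0 < t" by simp
    thus ?thesis
    proof (rule differentiable_bound_general)
      show "continuous_on {0..t} g"
        using g by (intro continuous_at_imp_continuous_on ballI has_vector_derivative_continuous) auto
      show "continuous_on {0..t} (\<lambda>t. C / r * exp (r * t))" by (intro continuous_intros)
      show "(g has_vector_derivative exp (- l * x) * (f' x - l * f x)) (at x)" for x by (rule g)
      show "((\<lambda>t. C / r * exp (r * t)) has_vector_derivative C * exp (r * x)) (at x)" for x
        using r by (auto intro!: derivative_eq_intros simp flip: has_real_derivative_iff_has_vector_derivative)
      fix x assume "0 < x" "x < t"
      have "norm (exp (- l * x) * (f' x - l * f x)) \<le> exp (- Re l * x) * (C * exp (- e * x))"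
        unfolding norm_mult norm_exp_eq_Re using bd[of x] \<open>0 < x\<close> by (intro mult_mono) auto
      also have "\<dots> = C * exp (r * x)"
        by (simp add: r_def algebra_simps flip: exp_add)
      finally show "norm (exp (- l * x) * (f' x - l * f x)) \<le> C * exp (r * x)" .
    qed
  qed simp
  also have "\<dots> \<le> C / r * exp (r * t)" using C r by simp
  finally have "norm (g t) \<le> norm (f 0) + C / r * exp (r * t)"
    using norm_triangle_ineq2[of "g t" "g 0"] by (simp add: g_def)
  moreover have "norm (g t) = exp (- Re l * t) * norm (f t)" by (simp add: g_def norm_mult norm_exp_eq_Re)
  ultimately have "exp (- Re l * t) * norm (f t) \<le> norm (f 0) + C / r * exp (r * t)" by simp
  also have "\<dots> \<le> (norm (f 0) + C / r) * exp (r * t)"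
    using r t by (simp add: distrib_right mult_le_cancel_left1)
  finally have "exp (Re l * t) * (exp (- Re l * t) * norm (f t)) \<le> exp (Re l * t) * ((norm (f 0) + C / r) * exp (r * t))"
    by (intro mult_left_mono) auto
  also have "\<dots> = (norm (f 0) + C / r) * exp (- e * t)"
    by (simp add: r_def algebra_simps flip: exp_add)
  also have "exp (Re l * t) * (exp (- Re l * t) * norm (f t)) = norm (f t)"
    by (simp add: mult.assoc[symmetric] flip: exp_add)
  finally show ?thesis by (simp add: r_def)
qed

text \<open>Peeling off one factor at a time treats multiple roots like simple ones. The strict gap
  between the real parts and - e absorbs the powers of t that multiple roots produce.\<close>

lemma diff_op_zero_decay:
  assumes "deriv_family F" "\<And>k t. diff_op ls F k t = 0" "\<forall>l\<in>set ls. Re l < - e"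
  shows "\<exists>C. \<forall>t\<ge>0. norm (F k t) \<le> C * exp (- e * t)"
  using assms
proof (induction ls arbitrary: F k)
  case Nil
  thus ?case by (auto intro!: exI[of _ 0])
next
  case (Cons l ls)
  from Cons.IH[OF deriv_family_step[OF Cons.prems(1), of l], of k] Cons.prems
  obtain C where C: "\<And>t. 0 \<le> t \<Longrightarrow> norm (F (Suc k) t - l * F k t) \<le> C * exp (- e * t)"
    by auto
  have "norm (F k t) \<le> (norm (F k 0) + C / (- Re l - e)) * exp (- e * t)" if "0 \<le> t" for t
    by (rule first_order_bound[where f' = "F (Suc k)", OF _ C _ that])
       (use Cons.prems in \<open>auto simp: deriv_family_def\<close>)
  thus ?case by blast
qed

text \<open>Every solution of the differential equation is annihilated by the sampled filter.
  \<open>E\<close> solves E' = l E, so E(t) = exp (\<Delta> l) E(t - \<Delta>), which says that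
  differencing \<open>F\<close> with the head factor leaves a family killed by the remaining
  differential factors.\<close>

lemma diff_op_zero_shift_op:
  assumes "deriv_family F" "\<And>k t. diff_op ls F k t = 0"
  shows "shift_op \<Delta> ls F k t = 0"
  using assms
proof (induction ls arbitrary: F)
  case (Cons l ls)
  define E where "E = diff_op ls F"
  have E: "(E k has_vector_derivative l * E k t) (at t)" for k t
  proof -
    have "(E k has_vector_derivative E (Suc k) t) (at t)"
      using deriv_family_diff_op[OF Cons.prems(1), of ls] by (simp add: E_def deriv_family_def)
    moreover have "E (Suc k) t = l * E k t"
      using Cons.prems(2)[of k t] unfolding diff_op_Cons_outer by (simp add: E_def)
    ultimately show ?thesis by simp
  qed
  have Ezero: "E k t = exp (\<Delta> * l) * E k (t - \<Delta>)" for k t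
  proof -
    have der: "((\<lambda>t. exp (- l * t) * E k t) has_vector_derivative 0) (at x within UNIV)" for x
      by (rule derivative_eq_intros E refl has_vector_derivative_real_field)+ (simp add: algebra_simps)
    have "exp (- l * t) * E k t = exp (- l * (t - \<Delta>)) * E k (t - \<Delta>)"
    proof (rule has_vector_derivative_zero_constant[OF convex_UNIV der])
      fix c assume c: "\<And>x::real. x \<in> UNIV \<Longrightarrow> exp (- l * x) * E k x = c"
      show "exp (- l * t) * E k t = exp (- l * (t - \<Delta>)) * E k (t - \<Delta>)"
        using c[of t] c[of "t - \<Delta>"] by simp
    qed
    hence "exp (l * t) * (exp (- l * t) * E k t) = exp (l * t) * (exp (- l * (t - \<Delta>)) * E k (t - \<Delta>))"
      by simp
    moreover have "exp (l * t) * exp (- l * t) = 1" "exp (l * t) * exp (- l * (t - \<Delta>)) = exp (\<Delta> * l)"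
      by (simp_all add: algebra_simps flip: exp_add)
    ultimately show ?thesis by (simp only: mult.assoc[symmetric] mult_1)
  qed
  have "diff_op ls (\<lambda>k t. F k t - exp (\<Delta> * l) * F k (t - \<Delta>)) k t = E k t - exp (\<Delta> * l) * E k (t - \<Delta>)" for k t
    by (simp add: E_def diff_op_eq sum_subtractf sum_distrib_left algebra_simps)
  hence "diff_op ls (\<lambda>k t. F k t - exp (\<Delta> * l) * F k (t - \<Delta>)) k t = 0" for k t
    using Ezero[of k t] by simp
  moreover have "deriv_family (\<lambda>k t. F k t - exp (\<Delta> * l) * F k (t - \<Delta>))"
    unfolding deriv_family_def
  proof (intro allI)
    fix k t
    have "(F k has_vector_derivative F (Suc k) (t - \<Delta>)) (at (t - \<Delta>))"
      using Cons.prems(1) by (simp add: deriv_family_def)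
    moreover have "((\<lambda>t. t - \<Delta>) has_vector_derivative 1) (at t)"
      by (auto intro!: derivative_eq_intros)
    ultimately
    have "((\<lambda>t. F k (t - \<Delta>)) has_vector_derivative F (Suc k) (t - \<Delta>)) (at t)"
      using vector_diff_chain_at[of "\<lambda>t. t - \<Delta>" 1 t "F k"] by (auto simp: comp_def)
    thus "((\<lambda>t. F k t - exp (\<Delta> * l) * F k (t - \<Delta>)) has_vector_derivative
        F (Suc k) t - exp (\<Delta> * l) * F (Suc k) (t - \<Delta>)) (at t)"
      using Cons.prems(1) by (auto simp: deriv_family_def intro!: derivative_eq_intros)
  qed
  ultimately show ?case using Cons.IH[of "\<lambda>k t. F k t - exp (\<Delta> * l) * F k (t - \<Delta>)"] by simp
qed simp

section \<open>Laplace transform of the kernel\<close>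

lemma set_integrable_exp_bound:
  fixes f :: "real \<Rightarrow> complex"
  assumes "0 < e" "continuous_on UNIV f" "\<And>t. 0 \<le> t \<Longrightarrow> norm (f t) \<le> C * exp (- e * t)"
  shows "set_integrable lborel {0<..} f"
  unfolding set_integrable_def
proof (rule Bochner_Integration.integrable_bound)
  show "integrable lborel (\<lambda>u. C * (exp (- e * u) * indicator {0..} u))"
    using has_bochner_integral_exp_atLeast[OF assms(1), of 0]
    by (intro integrable_mult_right) (auto simp: has_bochner_integral_iff)
  have "f \<in> borel_measurable borel"
    using assms(2) by (rule borel_measurable_continuous_onI)
  thus "(\<lambda>x. indicator {0<..} x *\<^sub>R f x) \<in> borel_measurable lborel" by simp
  show "AE x in lborel. norm (indicator {0<..} x *\<^sub>R f x) \<le> norm (C * (exp (- e * x) * indicator {0..} x))"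
    using assms(3) by (intro always_eventually) (auto simp: indicator_def intro: order_trans[OF _ abs_ge_self])
qed

definition laplace :: "(real \<Rightarrow> complex) \<Rightarrow> complex \<Rightarrow> complex" where
  "laplace f s = (LINT t:{0<..}|lborel. f t * exp (- s * t))"

lemma laplace_integrable:
  fixes f :: "real \<Rightarrow> complex"
  assumes "0 < e" "continuous_on UNIV f" "\<And>t. 0 \<le> t \<Longrightarrow> norm (f t) \<le> C * exp (- e * t)" "0 \<le> Re s"
  shows "set_integrable lborel {0<..} (\<lambda>t. f t * exp (- s * t))"
proof (rule set_integrable_exp_bound[OF assms(1)])
  show "continuous_on UNIV (\<lambda>t::real. f t * exp (- s * t))"
    by (intro continuous_intros assms(2))
  fix t :: real assume t: "0 \<le> t"
  have "norm (f t * exp (- s * t)) \<le> norm (f t) * 1"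
    unfolding norm_mult norm_exp_eq_Re using t assms(4) by (intro mult_left_mono) auto
  thus "norm (f t * exp (- s * t)) \<le> C * exp (- e * t)" using assms(3)[OF t] by simp
qed

text \<open>Integration by parts, written as the fundamental theorem of calculus for f(t) exp (- s
  t). The decay of \<open>f\<close> removes the boundary term at infinity also when \<open>s\<close>
  lies on the imaginary axis.\<close>

lemma laplace_deriv:
  fixes f f' :: "real \<Rightarrow> complex"
  assumes e: "0 < e" and f: "\<And>t. (f has_vector_derivative f' t) (at t)"
    and cont: "continuous_on UNIV f'"
    and b: "\<And>t. 0 \<le> t \<Longrightarrow> norm (f t) \<le> C * exp (- e * t)"
    and b': "\<And>t. 0 \<le> t \<Longrightarrow> norm (f' t) \<le> C' * exp (- e * t)" and s: "0 \<le> Re s"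
  shows "laplace f' s = s * laplace f s - f 0"
proof -
  have contf: "continuous_on UNIV f"
    using f by (intro continuous_at_imp_continuous_on ballI has_vector_derivative_continuous) auto
  define F where "F t = f t * exp (- s * t)" for t :: real
  define G where "G t = f' t * exp (- s * t) - s * (f t * exp (- s * t))" for t :: real
  have i1: "set_integrable lborel {0<..} (\<lambda>t. f' t * exp (- s * t))"
    by (rule laplace_integrable[OF e cont b' s])
  have i2: "set_integrable lborel {0<..} (\<lambda>t. f t * exp (- s * t))"
    by (rule laplace_integrable[OF e contf b s])
  have FG: "(F has_vector_derivative G t) (at t)" for t
    unfolding F_def[abs_def] G_def
    by (rule derivative_eq_intros f refl has_vector_derivative_real_field)+ (simp add: algebra_simps)
  have contG: "isCont G t" for t
  proof -
    have "continuous_on UNIV G" unfolding G_def[abs_def] by (intro continuous_intros cont contf)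
    thus ?thesis by (simp add: continuous_on_eq_continuous_at)
  qed
  have iG: "set_integrable lborel {0<..} G"
    unfolding G_def by (intro set_integral_diff i1 set_integrable_mult_right i2)
  have ev: "einterval (ereal 0) \<infinity> = {0<..}" by (auto simp: einterval_def)
  have lim: "(F \<longlongrightarrow> 0) at_top"
  proof (rule Lim_null_comparison)
    show "eventually (\<lambda>t. norm (F t) \<le> C * exp (- e * t)) at_top"
      using eventually_ge_at_top[of 0]
    proof eventually_elim
      case (elim t)
      have "norm (F t) \<le> norm (f t) * 1"
        unfolding F_def norm_mult norm_exp_eq_Re using elim s by (intro mult_left_mono) auto
      thus ?case using b[OF elim] by simp
    qed
    have "filterlim (\<lambda>x. e * x) at_top at_top"
      using e by (intro filterlim_tendsto_pos_mult_at_top[OF tendsto_const]) (auto simp: filterlim_ident)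
    hence "((\<lambda>x. exp (- (e * x))) \<longlongrightarrow> 0) at_top"
      by (intro filterlim_compose[OF exp_at_bot]) (simp add: filterlim_uminus_at_bot)
    thus "((\<lambda>t. C * exp (- e * t)) \<longlongrightarrow> 0) at_top"
      by (auto intro!: tendsto_mult_right_zero)
  qed
  have "(LBINT t=ereal 0..\<infinity>. G t) = 0 - F 0"
  proof (rule interval_integral_FTC_integrable)
    show "((F \<circ> real_of_ereal) \<longlongrightarrow> F 0) (at_right (ereal 0))"
      unfolding ereal_tendsto_simps1
      using has_vector_derivative_continuous[OF FG[of 0]]
      by (simp add: continuous_at tendsto_within_subset[where S = UNIV])
    show "((F \<circ> real_of_ereal) \<longlongrightarrow> 0) (at_left \<infinity>)"
      unfolding ereal_tendsto_simps1 by (rule lim)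
  qed (use FG contG iG ev in auto)
  hence "(LINT t:{0<..}|lborel. G t) = - F 0"
    by (simp add: interval_integral_to_infinity_eq)
  moreover have "(LINT t:{0<..}|lborel. G t) = laplace f' s - s * laplace f s"
    unfolding G_def laplace_def
    by (subst set_integral_diff(2)[OF i1 set_integrable_mult_right[OF i2]]) simp
  ultimately show ?thesis by (simp add: F_def algebra_simps)
qed

section \<open>Products of linear factors and translation\<close>

lemma map_poly_cnj_mult: "map_poly cnj (p * q) = map_poly cnj p * map_poly cnj q"
  by (simp add: poly_eq_iff coeff_map_poly coeff_mult)

lemma map_poly_cnj_prod_list: "map_poly cnj (\<Prod>l\<leftarrow>ls. P l) = (\<Prod>l\<leftarrow>ls. map_poly cnj (P l))"
  by (induction ls) (simp_all add: map_poly_cnj_mult)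

lemma proots_prod_linear: "proots (\<Prod>l\<leftarrow>ls. [:- l, 1:]) = mset (ls :: complex list)"
  by (induction ls) (simp_all add: proots_mult prod_list_linear_nonzero del: mult_pCons_left)

lemma poly_prod_list: "poly (\<Prod>l\<leftarrow>ls. P l) z = (\<Prod>l\<leftarrow>ls. poly (P l) z)"
  by (induction ls) auto

lemma lead_coeff_prod_linear: "coeff (\<Prod>l\<leftarrow>ls. [:c l, 1:] :: complex poly) (length ls) = 1"
proof -
  have "lead_coeff (\<Prod>l\<leftarrow>ls. [:c l, 1:] :: complex poly) = 1"
    by (induction ls) (simp_all add: lead_coeff_mult del: mult_pCons_left)
  thus ?thesis by (simp add: degree_prod_list_linear)
qed

lemma deriv_family_continuous: "deriv_family F \<Longrightarrow> continuous_on UNIV (F k)"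
  by (intro continuous_at_imp_continuous_on ballI has_vector_derivative_continuous)
     (auto simp: deriv_family_def)

lemma square_integrable_translate:
  assumes "square_integrable lborel (f :: real \<Rightarrow> real)"
  shows "square_integrable lborel (\<lambda>x. f (x + c))"
proof -
  have "f \<in> borel_measurable borel" "integrable lborel (\<lambda>x. (f x)^2)"
    using assms by (auto simp: square_integrable_def)
  thus ?thesis
    using lborel_integrable_real_affine[of "\<lambda>x. (f x)^2" 1 c]
    by (auto simp: square_integrable_def add.commute)
qed

section \<open>Transfer function and impulse response of the CARMA model\<close>

locale carma =
  fixes a b :: "real poly" and lam mu :: "complex list" and \<sigma> :: real
  assumes sigma_pos: "0 < \<sigma>"
    and pq: "length mu < length lam"
    and a_roots: "map_poly complex_of_real a = (\<Prod>l\<leftarrow>lam. [:- l, 1:])"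
    and b_roots: "map_poly complex_of_real b = (\<Prod>m\<leftarrow>mu. [:m, 1:])"
    and causal: "\<forall>l\<in>set lam. Re l < 0"
begin

abbreviation "p \<equiv> length lam"

lemma p_pos: "0 < p" using pq by linarith

lemma degree_a: "degree a = p"
proof -
  have "degree (map_poly complex_of_real a) = degree a" by (rule degree_map_poly) simp
  thus ?thesis by (simp add: a_roots degree_prod_list_linear)
qed

lemma degree_b: "degree b = length mu"
proof -
  have "degree (map_poly complex_of_real b) = degree b" by (rule degree_map_poly) simp
  thus ?thesis by (simp add: b_roots degree_prod_list_linear)
qed

lemma coeff_a_p: "coeff a p = 1"
proof -
  have "complex_of_real (coeff a p) = coeff (map_poly complex_of_real a) p" by (simp add: coeff_map_poly)
  also have "\<dots> = 1" by (simp add: a_roots lead_coeff_prod_linear)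
  finally show ?thesis by (simp only: of_real_eq_1_iff)
qed

definition A :: "complex \<Rightarrow> complex" where "A s = (\<Prod>l\<leftarrow>lam. s - l)"

definition B :: "complex \<Rightarrow> complex" where "B s = (\<Prod>m\<leftarrow>mu. s + m)"

lemma A_sum: "A s = (\<Sum>j\<le>p. of_real (coeff a j) * s^j)"
proof -
  have "A s = poly (map_poly complex_of_real a) s"
    unfolding a_roots poly_prod_list A_def by (intro arg_cong[where f = prod_list] map_cong) auto
  also have "\<dots> = (\<Sum>j\<le>p. of_real (coeff a j) * s^j)"
    by (simp add: poly_altdef coeff_map_poly degree_map_poly degree_a)
  finally show ?thesis .
qed

lemma B_poly: "B s = poly (map_poly complex_of_real b) s"
  unfolding b_roots poly_prod_list B_def by (intro arg_cong[where f = prod_list] map_cong) auto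

lemma B_sum: "B s = (\<Sum>j<p. of_real (coeff b j) * s^j)"
proof -
  have "B s = (\<Sum>j\<le>length mu. of_real (coeff b j) * s^j)"
    unfolding B_poly by (simp add: poly_altdef coeff_map_poly degree_map_poly degree_b)
  also have "\<dots> = (\<Sum>j<p. of_real (coeff b j) * s^j)"
    using pq by (intro sum.mono_neutral_left) (auto simp: coeff_eq_0 degree_b)
  finally show ?thesis .
qed

lemma A_nonzero: "0 \<le> Re s \<Longrightarrow> A s \<noteq> 0"
  using causal by (auto simp: A_def prod_list_zero_iff)

definition R :: "nat \<Rightarrow> real \<Rightarrow> real" where "R = carma_response \<sigma> a b"

lemma fund_sol_ode': "(\<Sum>j\<le>p. coeff a j * fund_sol a (k + j) t) = 0"
  using fund_sol_ode[of a k t] p_pos by (simp add: degree_a coeff_a_p flip: lessThan_Suc_atMost)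

lemma deriv_family_fund_sol: "deriv_family (\<lambda>k t. of_real (fund_sol a k t))"
  using fund_sol_deriv[of a] p_pos
  by (auto simp: deriv_family_def degree_a has_real_derivative_iff_has_vector_derivative
      intro!: has_vector_derivative_of_real)

lemma deriv_family_R: "deriv_family (\<lambda>k t. of_real (R k t))"
  using carma_response_deriv[of a] p_pos
  by (auto simp: deriv_family_def degree_a R_def has_real_derivative_iff_has_vector_derivative
      intro!: has_vector_derivative_of_real)

lemma diff_op_fund_sol: "diff_op lam (\<lambda>k t. of_real (fund_sol a k t)) k t = 0"
proof -
  have "diff_op lam (\<lambda>k t. of_real (fund_sol a k t)) k t =
      of_real (\<Sum>j\<le>p. coeff a j * fund_sol a (k + j) t)"
    by (simp add: diff_op_eq coeff_map_poly flip: a_roots)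
  thus ?thesis by (simp only: fund_sol_ode' of_real_0)
qed

lemma diff_op_R: "diff_op lam (\<lambda>k t. of_real (R k t)) k t = 0"
proof -
  have "diff_op lam (\<lambda>k t. of_real (R k t)) k t = of_real (\<Sum>j\<le>p. coeff a j * R (k + j) t)"
    by (simp add: diff_op_eq coeff_map_poly flip: a_roots)
  also have "(\<Sum>j\<le>p. coeff a j * R (k + j) t) =
      (\<Sum>j\<le>p. \<Sum>i<p. \<sigma> * coeff b i * (coeff a j * fund_sol a (k + i + j) t))"
    unfolding R_def carma_response_def degree_a sum_distrib_left
    by (intro sum.cong refl) (simp add: algebra_simps)
  also have "\<dots> = (\<Sum>i<p. \<sigma> * coeff b i * (\<Sum>j\<le>p. coeff a j * fund_sol a (k + i + j) t))"
    unfolding sum_distrib_left by (rule sum.swap)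
  also have "\<dots> = 0" by (simp add: fund_sol_ode')
  finally show ?thesis by simp
qed

text \<open>Half the distance of the zeroes from the imaginary axis. The other half provides the
  strict inequality that the decay lemma asks for.\<close>

definition rate :: real where "rate = Min ((\<lambda>l. - Re l) ` set lam) / 2"

lemma rate: "0 < rate" "l \<in> set lam \<Longrightarrow> Re l < - rate"
proof -
  have *: "finite ((\<lambda>l. - Re l) ` set lam)" "(\<lambda>l. - Re l) ` set lam \<noteq> {}" using p_pos by auto
  have pos: "0 < Min ((\<lambda>l. - Re l) ` set lam)"
    using causal by (subst Min_gr_iff[OF *]) auto
  thus "0 < rate" by (simp add: rate_def)
  assume "l \<in> set lam"
  hence "Min ((\<lambda>l. - Re l) ` set lam) \<le> - Re l" by (intro Min_le) auto
  with pos show "Re l < - rate" by (simp add: rate_def)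
qed

lemma fund_sol_decay: "\<exists>C. \<forall>t\<ge>0. norm (complex_of_real (fund_sol a k t)) \<le> C * exp (- rate * t)"
  by (rule diff_op_zero_decay[OF deriv_family_fund_sol diff_op_fund_sol]) (use rate in auto)

lemma R_decay: "\<exists>C. \<forall>t\<ge>0. \<bar>R k t\<bar> \<le> C * exp (- rate * t)"
  using diff_op_zero_decay[OF deriv_family_R diff_op_R, of rate k] rate by auto

lemma laplace_fund_sol_Suc:
  assumes "0 \<le> Re s"
  shows "laplace (\<lambda>t. of_real (fund_sol a (Suc k) t)) s = s * laplace (\<lambda>t. of_real (fund_sol a k t)) s - fund_seq a k"
proof -
  obtain C C' where "\<forall>t\<ge>0. norm (complex_of_real (fund_sol a k t)) \<le> C * exp (- rate * t)"
    "\<forall>t\<ge>0. norm (complex_of_real (fund_sol a (Suc k) t)) \<le> C' * exp (- rate * t)"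
    using fund_sol_decay by meson
  thus ?thesis
    using laplace_deriv[OF rate(1), of "\<lambda>t. of_real (fund_sol a k t)" "\<lambda>t. of_real (fund_sol a (Suc k) t)" C C' s]
      deriv_family_fund_sol deriv_family_continuous[OF deriv_family_fund_sol, of "Suc k"] assms
    by (auto simp: deriv_family_def fund_sol_0)
qed

lemma laplace_fund_sol_less:
  assumes "0 \<le> Re s" "k < p"
  shows "laplace (\<lambda>t. of_real (fund_sol a k t)) s = s^k * laplace (\<lambda>t. of_real (fund_sol a 0 t)) s"
  using assms(2)
proof (induction k)
  case (Suc k)
  thus ?case using laplace_fund_sol_Suc[OF assms(1), of k] by (simp add: fund_seq_init degree_a)
qed simp

lemma fund_sol_laplace_integrable:
  assumes "0 \<le> Re s"
  shows "set_integrable lborel {0<..} (\<lambda>t. of_real (fund_sol a k t) * exp (- s * t))"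
proof -
  obtain C where "\<forall>t\<ge>0. norm (complex_of_real (fund_sol a k t)) \<le> C * exp (- rate * t)"
    using fund_sol_decay by meson
  thus ?thesis
    by (intro laplace_integrable[OF rate(1) _ _ assms] deriv_family_continuous[OF deriv_family_fund_sol]) auto
qed

lemma laplace_fund_sol_sum:
  assumes "0 \<le> Re s" "finite J"
  shows "laplace (\<lambda>t. of_real (\<Sum>j\<in>J. c j * fund_sol a (f j) t)) s =
         (\<Sum>j\<in>J. of_real (c j) * laplace (\<lambda>t. of_real (fund_sol a (f j) t)) s)"
proof -
  have "laplace (\<lambda>t. of_real (\<Sum>j\<in>J. c j * fund_sol a (f j) t)) s =
     (LINT t:{0<..}|lborel. \<Sum>j\<in>J. of_real (c j) * (of_real (fund_sol a (f j) t) * exp (- s * t)))"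
    unfolding laplace_def by (simp add: sum_distrib_right mult.assoc)
  also have "\<dots> = (\<Sum>j\<in>J. LINT t:{0<..}|lborel. of_real (c j) * (of_real (fund_sol a (f j) t) * exp (- s * t)))"
    unfolding set_lebesgue_integral_def scaleR_sum_right
    using set_integrable_mult_right[OF fund_sol_laplace_integrable[OF assms(1)]]
    by (intro Bochner_Integration.integral_sum) (simp add: set_integrable_def)
  finally show ?thesis by (simp add: laplace_def)
qed

text \<open>Transforming a(D) f = 0 leaves a single boundary term: the derivatives of f at 0 of
  order below p - 1 vanish, and the one of order p - 1 equals 1.\<close>

lemma laplace_fund_sol:
  assumes s: "0 \<le> Re s"
  shows "laplace (\<lambda>t. of_real (fund_sol a 0 t)) s = 1 / A s"
proof -
  let ?L = "\<lambda>k. laplace (\<lambda>t. of_real (fund_sol a k t)) s"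
  obtain n where n: "p = Suc n" using p_pos by (cases p) auto
  have Lp: "?L p = s^p * ?L 0 - 1"
    using laplace_fund_sol_Suc[OF s, of n] laplace_fund_sol_less[OF s, of n]
    by (simp add: n fund_seq_init degree_a algebra_simps)
  have "0 = (\<Sum>j\<le>p. of_real (coeff a j) * ?L j)"
  proof -
    have "(\<Sum>j\<le>p. coeff a j * fund_sol a j t) = 0" for t using fund_sol_ode'[of 0] by simp
    thus ?thesis using laplace_fund_sol_sum[OF s, of "{..p}" "coeff a" "\<lambda>j. j"]
      by (simp only: of_real_0) (simp add: laplace_def)
  qed
  also have "\<dots> = (\<Sum>j<p. of_real (coeff a j) * ?L j) + ?L p"
    by (simp add: coeff_a_p flip: lessThan_Suc_atMost)
  also have "(\<Sum>j<p. of_real (coeff a j) * ?L j) = (\<Sum>j<p. of_real (coeff a j) * s^j * ?L 0)"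
    by (intro sum.cong refl) (use laplace_fund_sol_less[OF s] in simp)
  also have "\<dots> + ?L p = A s * ?L 0 - 1"
    by (simp add: A_sum Lp coeff_a_p sum_distrib_left algebra_simps flip: lessThan_Suc_atMost)
  finally show ?thesis using A_nonzero[OF s] by (simp add: field_simps)
qed

lemma laplace_R:
  assumes s: "0 \<le> Re s"
  shows "laplace (\<lambda>t. of_real (R 0 t)) s = \<sigma> * B s / A s"
proof -
  have "R 0 t = (\<Sum>j<p. \<sigma> * coeff b j * fund_sol a j t)" for t
    by (simp add: R_def carma_response_def degree_a sum_distrib_left mult.assoc)
  hence "laplace (\<lambda>t. of_real (R 0 t)) s =
     (\<Sum>j<p. of_real (\<sigma> * coeff b j) * laplace (\<lambda>t. of_real (fund_sol a j t)) s)"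
    using laplace_fund_sol_sum[OF s, of "{..<p}" "\<lambda>j. \<sigma> * coeff b j" "\<lambda>j. j"] by simp
  also have "\<dots> = (\<Sum>j<p. of_real \<sigma> * (of_real (coeff b j) * s^j) / A s)"
    by (intro sum.cong refl) (use laplace_fund_sol_less[OF s] laplace_fund_sol[OF s] in simp)
  finally show ?thesis by (simp add: B_sum sum_distrib_left sum_divide_distrib)
qed

section \<open>The sampled autoregressive filter\<close>

text \<open>The coefficients of \<open>a\<close> are real, so its multiset of roots is closed under
  conjugation, multiplicities included. This is what makes the sampled autoregressive coefficients
  real.\<close>

lemma mset_cnj_lam: "mset (map cnj lam) = mset lam"
proof -
  have "map_poly cnj (map_poly complex_of_real a) = map_poly complex_of_real a"
    by (simp add: poly_eq_iff coeff_map_poly)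
  hence "(\<Prod>l\<leftarrow>lam. [:- cnj l, 1:]) = (\<Prod>l\<leftarrow>lam. [:- l, 1:])"
    by (simp add: a_roots map_poly_cnj_prod_list map_poly_pCons)
  hence "(\<Prod>l\<leftarrow>map cnj lam. [:- l, 1:]) = (\<Prod>l\<leftarrow>lam. [:- l, 1:])" by (simp add: comp_def)
  thus ?thesis by (metis proots_prod_linear)
qed

lemma sampled_ar_poly_real: "coeff (sampled_ar_poly \<Delta> lam) k \<in> \<real>"
proof -
  have "map_poly cnj (sampled_ar_poly \<Delta> lam) = (\<Prod>l\<leftarrow>lam. [:1, - exp (\<Delta> * cnj l):])"
    by (simp add: sampled_ar_poly_def map_poly_cnj_prod_list map_poly_pCons exp_cnj)
  also have "\<dots> = prod_mset (image_mset (\<lambda>l. [:1, - exp (\<Delta> * l):]) (mset (map cnj lam)))"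
    by (simp add: image_mset.compositionality comp_def flip: prod_mset_prod_list)
  also have "\<dots> = sampled_ar_poly \<Delta> lam"
    by (simp only: mset_cnj_lam) (simp add: sampled_ar_poly_def flip: prod_mset_prod_list)
  finally have "cnj (coeff (sampled_ar_poly \<Delta> lam) k) = coeff (sampled_ar_poly \<Delta> lam) k"
    by (metis coeff_map_poly complex_cnj_zero)
  thus ?thesis by (simp add: Reals_cnj_iff)
qed

definition phi :: "real \<Rightarrow> nat \<Rightarrow> real" where
  "phi \<Delta> k = Re (coeff (sampled_ar_poly \<Delta> lam) k)"

lemma phi: "coeff (sampled_ar_poly \<Delta> lam) k = of_real (phi \<Delta> k)"
  using sampled_ar_poly_real[of \<Delta> k] by (auto simp: phi_def Reals_def)

definition \<Phi> :: "real \<Rightarrow> complex \<Rightarrow> complex" where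
  "\<Phi> \<Delta> z = (\<Sum>k\<le>p. of_real (phi \<Delta> k) * z^k)"

lemma Phi_prod: "\<Phi> \<Delta> z = (\<Prod>l\<leftarrow>lam. 1 - exp (\<Delta> * l) * z)"
proof -
  have "\<Phi> \<Delta> z = (\<Sum>k\<le>p. coeff (sampled_ar_poly \<Delta> lam) k * z^k)" by (simp add: \<Phi>_def phi)
  also have "\<dots> = poly (sampled_ar_poly \<Delta> lam) z"
    unfolding poly_altdef
    by (intro sum.mono_neutral_right) (auto simp: coeff_eq_0 intro: order_trans[OF _ degree_sampled_ar_poly])
  also have "\<dots> = (\<Prod>l\<leftarrow>lam. 1 - exp (\<Delta> * l) * z)"
    unfolding sampled_ar_poly_def poly_prod_list
    by (intro arg_cong[where f = prod_list] map_cong) auto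
  finally show ?thesis .
qed

text \<open>Each of the p factors is 1 - exp (\<Delta> (l - s)), which to first order is \<Delta> (s
  - l).\<close>

lemma tendsto_Phi: "((\<lambda>\<Delta>. \<Phi> \<Delta> (exp (- s * of_real \<Delta>)) / of_real \<Delta>^p) \<longlongrightarrow> A s) (at_right 0)"
proof -
  have one: "((\<lambda>\<Delta>::real. (1 - exp (\<Delta> * l) * exp (- s * of_real \<Delta>)) / of_real \<Delta>) \<longlongrightarrow> s - l) (at_right 0)" for l :: complex
  proof -
    have "((\<lambda>z. exp (z * (l - s))) has_field_derivative (l - s)) (at 0)"
      by (auto intro!: derivative_eq_intros)
    hence "((\<lambda>z. (exp (z * (l - s)) - 1) / z) \<longlongrightarrow> l - s) (at 0)"
      by (simp add: has_field_derivative_iff)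
    moreover have "filterlim complex_of_real (at 0) (at_right 0)"
      by (auto simp: filterlim_at eventually_at_right_less intro!: tendsto_eq_intros eventually_at_rightI[of 0 1])
    ultimately have "((\<lambda>\<Delta>. (exp (complex_of_real \<Delta> * (l - s)) - 1) / complex_of_real \<Delta>) \<longlongrightarrow> l - s) (at_right 0)"
      by (rule filterlim_compose)
    from tendsto_minus[OF this] show ?thesis
      by (simp add: minus_divide_left algebra_simps flip: exp_add)
  qed
  have "((\<lambda>\<Delta>::real. (\<Prod>l\<leftarrow>ls. 1 - exp (\<Delta> * l) * exp (- s * of_real \<Delta>)) / of_real \<Delta>^length ls) \<longlongrightarrow> (\<Prod>l\<leftarrow>ls. s - l)) (at_right 0)" for ls :: "complex list"
  proof (induction ls)
    case (Cons l ls)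
    from tendsto_mult[OF one[of l] Cons.IH] show ?case by simp
  qed simp
  thus ?thesis by (simp add: Phi_prod A_def)
qed

definition g :: "real \<Rightarrow> real" where "g = carma_kernel \<sigma> a b"

lemma g_eq: "g t = (if 0 < t then R 0 t else 0)"
  using p_pos by (simp add: g_def carma_kernel_eq degree_a R_def)

text \<open>The autoregressive filter applied to the kernel. The filtered process at time n \<Delta>
  has the integrand h(n \<Delta> - u), and the support of \<open>h\<close> in an interval of length
  p \<Delta> is the continuous-time origin of the moving average order p - 1.\<close>

definition h :: "real \<Rightarrow> real \<Rightarrow> real" where
  "h \<Delta> v = (\<Sum>k\<le>p. phi \<Delta> k * g (v - real k * \<Delta>))"

lemma R_continuous: "continuous_on UNIV (R k)"
  using carma_response_deriv[of a] p_pos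
  by (auto simp: degree_a R_def intro!: DERIV_continuous_on)

lemma R_measurable [measurable]: "R k \<in> borel_measurable borel"
  using R_continuous by (rule borel_measurable_continuous_onI)

lemma g_measurable [measurable]: "g \<in> borel_measurable borel"
  unfolding g_eq[abs_def] by measurable

lemma h_measurable [measurable]: "h \<Delta> \<in> borel_measurable borel"
  unfolding h_def[abs_def] by measurable

lemma g_square_integrable: "square_integrable lborel g"
proof -
  obtain C where C: "\<And>t. 0 \<le> t \<Longrightarrow> \<bar>R 0 t\<bar> \<le> C * exp (- rate * t)" using R_decay by meson
  have "integrable lborel (\<lambda>t. (g t)^2)"
  proof (rule Bochner_Integration.integrable_bound)
    show "integrable lborel (\<lambda>u. C^2 * (exp (- (2 * rate) * u) * indicator {0..} u))"
      using has_bochner_integral_exp_atLeast[of "2 * rate" 0] rate(1)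
      by (intro integrable_mult_right) (auto simp: has_bochner_integral_iff)
    show "AE x in lborel. norm ((g x)^2) \<le> norm (C^2 * (exp (- (2 * rate) * x) * indicator {0..} x))"
    proof (intro always_eventually allI)
      fix x
      show "norm ((g x)^2) \<le> norm (C^2 * (exp (- (2 * rate) * x) * indicator {0..} x))"
      proof (cases "0 < x")
        case True
        have "\<bar>R 0 x\<bar>^2 \<le> (C * exp (- rate * x))^2" using C[of x] True by (intro power_mono) auto
        also have "\<dots> = C^2 * exp (- (2 * rate) * x)"
          by (simp add: power_mult_distrib power2_eq_square flip: exp_add)
        finally show ?thesis using True by (simp add: g_eq)
      qed (simp add: g_eq)
    qed
  qed simp
  thus ?thesis by (simp add: square_integrable_def)
qed

lemma h_nonpos: "0 < \<Delta> \<Longrightarrow> v \<le> 0 \<Longrightarrow> h \<Delta> v = 0"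
  unfolding h_def
proof (intro sum.neutral ballI)
  fix k assume "0 < \<Delta>" "v \<le> 0"
  hence "v - real k * \<Delta> \<le> 0" by (smt (verit) mult_nonneg_nonneg of_nat_0_le_iff)
  thus "phi \<Delta> k * g (v - real k * \<Delta>) = 0" by (simp add: g_eq)
qed

text \<open>Past p \<Delta> every shifted argument is positive, so no cut-off is active and the
  filter annihilates the smooth response.\<close>

lemma h_large:
  assumes "0 < \<Delta>" "real p * \<Delta> < v"
  shows "h \<Delta> v = 0"
proof -
  have "0 < v - real k * \<Delta>" if "k \<le> p" for k
  proof -
    have "real k * \<Delta> \<le> real p * \<Delta>" using that assms by (intro mult_right_mono) auto
    with assms show ?thesis by linarith
  qed
  hence "complex_of_real (h \<Delta> v) = shift_op \<Delta> lam (\<lambda>k t. of_real (R k t)) 0 v"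
    by (simp add: h_def shift_op_eq phi g_eq)
  also have "\<dots> = 0" by (rule diff_op_zero_shift_op[OF deriv_family_R diff_op_R])
  finally show ?thesis by simp
qed

lemma h_square_integrable: "square_integrable lborel (h \<Delta>)"
  unfolding h_def[abs_def]
  by (intro square_integrable_sum square_integrable_cmult
      square_integrable_translate[OF g_square_integrable, of "- _", simplified])

end

section \<open>Riemann sums\<close>

lemma lipschitz_vector_derivative:
  fixes f f' :: "real \<Rightarrow> complex"
  assumes f: "\<And>t. (f has_vector_derivative f' t) (at t)"
    and b: "\<And>t. a \<le> t \<Longrightarrow> norm (f' t) \<le> K"
    and xy: "a \<le> x" "a \<le> y" "\<bar>x - y\<bar> \<le> d"
  shows "norm (f x - f y) \<le> K * d"
proof -
  have K: "0 \<le> K" using order_trans[OF norm_ge_zero b[of a]] by simp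
  have *: "norm (f y - f x) \<le> K * y - K * x" if "a \<le> x" "x < y" for x y
  proof (rule differentiable_bound_general[OF that(2)])
    show "continuous_on {x..y} f"
      using f by (intro continuous_at_imp_continuous_on ballI has_vector_derivative_continuous) auto
    show "((\<lambda>t. K * t) has_vector_derivative K) (at t)" for t
      by (auto intro!: derivative_eq_intros)
  qed (use f b that in \<open>auto intro!: continuous_intros\<close>)
  have "norm (f x - f y) \<le> K * \<bar>x - y\<bar>"
    using *[of x y] *[of y x] xy(1,2)
    by (cases x y rule: linorder_cases) (auto simp: norm_minus_commute algebra_simps)
  also have "\<dots> \<le> K * d" using K xy(3) by (intro mult_left_mono)
  finally show ?thesis .
qed

lemma exp_vector_derivative:
  "((\<lambda>t::real. exp (- c * of_real t)) has_vector_derivative - c * exp (- c * of_real t)) (at t)" for c :: complex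
  by (rule derivative_eq_intros refl has_vector_derivative_real_field)+ simp

text \<open>Each cell contributes an error of order \<Delta>^2 q^j, and summing the geometric series
  costs \<Delta> / (1 - q), bounded by (1 + e) / e for \<Delta> up to 1. The bound does not depend
  on the offset \<open>v\<close>, which is integrated out when the estimate is applied.\<close>

lemma riemann_sum_half_line:
  fixes f f' :: "real \<Rightarrow> complex"
  assumes e: "0 < e" and f: "\<And>t. (f has_vector_derivative f' t) (at t)"
    and b: "\<And>t. 0 \<le> t \<Longrightarrow> norm (f t) \<le> C * exp (- e * t)"
    and b': "\<And>t. 0 \<le> t \<Longrightarrow> norm (f' t) \<le> C' * exp (- e * t)"
    and D: "0 < \<Delta>" "\<Delta> \<le> 1" and v: "0 < v" "v \<le> \<Delta>"
  shows "summable (\<lambda>j. f (v + real j * \<Delta>))"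
    and "norm (of_real \<Delta> * (\<Sum>j. f (v + real j * \<Delta>)) - (LINT t:{0<..}|lborel. f t)) \<le> C' * (1 + e) / e * \<Delta>"
proof -
  define q where "q = exp (- e * \<Delta>)"
  have q: "0 < q" "q < 1" using e D by (auto simp: q_def)
  have qj: "exp (- e * (real j * \<Delta>)) = q^j" for j
    by (simp add: q_def mult_ac flip: exp_of_nat_mult)
  have C': "0 \<le> C'" using order_trans[OF norm_ge_zero b'[of 0]] by simp
  have C: "0 \<le> C" using order_trans[OF norm_ge_zero b[of 0]] by simp
  have decr: "exp (- e * t) \<le> q^j" if "real j * \<Delta> \<le> t" for t j
    using that e unfolding qj[symmetric] by simp
  have sf: "norm (f (v + real j * \<Delta>)) \<le> C * q^j" for j
  proof -
    have "norm (f (v + real j * \<Delta>)) \<le> C * exp (- e * (v + real j * \<Delta>))" using v D by (intro b) auto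
    also have "\<dots> \<le> C * q^j" using v C by (intro mult_left_mono decr) auto
    finally show ?thesis .
  qed
  have sq: "summable (\<lambda>j. K * q^j)" for K using q by (intro summable_mult summable_geometric) auto
  show sumf: "summable (\<lambda>j. f (v + real j * \<Delta>))"
    by (rule summable_comparison_test[OF _ sq[of C]]) (use sf in auto)
  define I where "I j = {real j * \<Delta><..real (Suc j) * \<Delta>}" for j
  have contf: "continuous_on UNIV f"
    using f by (intro continuous_at_imp_continuous_on ballI has_vector_derivative_continuous) auto
  have int: "set_integrable lborel {0<..} f" by (rule set_integrable_exp_bound[OF e contf b])
  have Isub: "I j \<subseteq> {0<..}" for j using D by (auto simp: I_def intro: le_less_trans[rotated])
  have intI: "set_integrable lborel (I j) f" for j
    by (rule set_integrable_subset[OF int _ Isub]) (auto simp: I_def)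
  have mI: "measure lborel (I j) = \<Delta>" "emeasure lborel (I j) < \<infinity>" for j
    using D by (auto simp: I_def distrib_right)
  have bnd: "norm (LINT t:I j|lborel. F t) \<le> K * \<Delta>"
    if "set_integrable lborel (I j) F" "\<And>t. t \<in> I j \<Longrightarrow> norm (F t) \<le> K" for F :: "real \<Rightarrow> complex" and j K
  proof -
    have "norm (LINT t:I j|lborel. F t) \<le> (LINT t:I j|lborel. norm (F t))"
      using that(1) by (rule set_integral_norm_bound)
    also have "\<dots> \<le> (LINT t:I j|lborel. K)"
      using that mI[of j]
      by (intro set_integral_mono set_integrable_norm) (auto simp: set_integrable_def I_def)
    also have "\<dots> = K * \<Delta>" using mI[of j] by (simp add: I_def set_lebesgue_integral_def)
    finally show ?thesis .
  qed
  have Un: "(\<Union>j. I j) = {0<..}"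
  proof
    show "{0<..} \<subseteq> (\<Union>j. I j)"
    proof
      fix x :: real assume "x \<in> {0<..}"
      hence x: "0 < x" by simp
      define n where "n = nat \<lceil>x / \<Delta>\<rceil>"
      have "0 < x / \<Delta>" using x D by simp
      hence n: "real n - 1 < x / \<Delta>" "x / \<Delta> \<le> real n" "0 < n" unfolding n_def by linarith+
      then obtain j where j: "n = Suc j" by (cases n) auto
      have "x \<in> I j" using n D by (auto simp: I_def j field_simps)
      thus "x \<in> (\<Union>j. I j)" by blast
    qed
  qed (use Isub in blast)
  have disj: "I i \<inter> I j = {}" if "i \<noteq> j" for i j
  proof -
    have "I i \<inter> I j = {}" if "i < j" for i j
    proof -
      have "real (Suc i) * \<Delta> \<le> real j * \<Delta>" using that D by (intro mult_right_mono) auto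
      thus ?thesis by (auto simp: I_def)
    qed
    from this[of i j] this[of j i] \<open>i \<noteq> j\<close> show ?thesis by (cases i j rule: linorder_cases) auto
  qed
  have split: "(LINT t:{0<..}|lborel. f t) = (\<Sum>j. LINT t:I j|lborel. f t)"
    unfolding Un[symmetric]
    by (rule lebesgue_integral_countable_add) (use disj int Un in \<open>auto simp: I_def\<close>)
  have "norm (LINT t:I j|lborel. f t) \<le> C * q^j * \<Delta>" for j
  proof (rule bnd[OF intI])
    fix t assume t: "t \<in> I j"
    hence "norm (f t) \<le> C * exp (- e * t)" using Isub[of j] by (intro b) auto
    also have "\<dots> \<le> C * q^j" using t C by (intro mult_left_mono decr) (auto simp: I_def)
    finally show "norm (f t) \<le> C * q^j" .
  qed
  hence sumI: "summable (\<lambda>j. LINT t:I j|lborel. f t)"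
    by (intro summable_comparison_test[OF _ sq[of "C * \<Delta>"]]) (auto simp: mult_ac)
  have diff: "norm (of_real \<Delta> * f (v + real j * \<Delta>) - (LINT t:I j|lborel. f t)) \<le> C' * \<Delta> * \<Delta> * q^j" for j
  proof -
    have ic: "set_integrable lborel (I j) (\<lambda>t. f (v + real j * \<Delta>))"
      using mI[of j] by (auto simp: set_integrable_def I_def)
    have "of_real \<Delta> * f (v + real j * \<Delta>) - (LINT t:I j|lborel. f t) = (LINT t:I j|lborel. f (v + real j * \<Delta>) - f t)"
      using mI[of j] by (subst set_integral_diff(2)[OF ic intI])
        (simp add: set_lebesgue_integral_def I_def scaleR_conv_of_real)
    also have "norm \<dots> \<le> C' * q^j * \<Delta> * \<Delta>"
    proof (rule bnd)
      show "set_integrable lborel (I j) (\<lambda>t. f (v + real j * \<Delta>) - f t)"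
        by (rule set_integral_diff(1)[OF ic intI])
      fix t assume t: "t \<in> I j"
      show "norm (f (v + real j * \<Delta>) - f t) \<le> C' * q^j * \<Delta>"
      proof (rule lipschitz_vector_derivative[where a = "real j * \<Delta>", OF f])
        fix s assume s: "real j * \<Delta> \<le> s"
        have "0 \<le> real j * \<Delta>" using D by simp
        with s have "0 \<le> s" by linarith
        have "norm (f' s) \<le> C' * exp (- e * s)" by (rule b'[OF \<open>0 \<le> s\<close>])
        also have "\<dots> \<le> C' * q^j" using s C' by (intro mult_left_mono decr)
        finally show "norm (f' s) \<le> C' * q^j" .
      qed (use t v D in \<open>auto simp: I_def distrib_right\<close>)
    qed
    finally show ?thesis by (simp add: mult_ac)
  qed
  have "of_real \<Delta> * (\<Sum>j. f (v + real j * \<Delta>)) - (LINT t:{0<..}|lborel. f t) =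
      (\<Sum>j. of_real \<Delta> * f (v + real j * \<Delta>) - (LINT t:I j|lborel. f t))"
    unfolding split suminf_mult[OF sumf, symmetric]
    by (rule suminf_diff[OF summable_mult[OF sumf] sumI])
  also have "norm \<dots> \<le> (\<Sum>j. C' * \<Delta> * \<Delta> * q^j)"
    by (rule norm_suminf_le[OF diff sq])
  also have "\<dots> = C' * \<Delta> * (\<Delta> / (1 - q))"
    using q by (simp add: suminf_mult suminf_geometric summable_geometric)
  also have "\<Delta> / (1 - q) \<le> (1 + e) / e"
  proof -
    have "1 + e * \<Delta> \<le> exp (e * \<Delta>)" by (rule exp_ge_add_one_self)
    hence "q * (1 + e * \<Delta>) \<le> q * exp (e * \<Delta>)" using q by (intro mult_left_mono) auto
    also have "\<dots> = 1" by (simp add: q_def flip: exp_add)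
    finally have "q * e * \<Delta> \<le> 1 - q" by (simp add: algebra_simps)
    hence "\<Delta> * e \<le> (1 - q) * (1 + e * \<Delta>)" using \<open>q * (1 + e * \<Delta>) \<le> q * exp (e * \<Delta>)\<close> \<open>q * exp (e * \<Delta>) = 1\<close>
      by (simp add: algebra_simps)
    also have "\<dots> \<le> (1 - q) * (1 + e)" using q e D by (intro mult_left_mono) (auto simp: mult_le_cancel_left1)
    finally show ?thesis using q e by (simp add: field_simps)
  qed
  hence "C' * \<Delta> * (\<Delta> / (1 - q)) \<le> C' * \<Delta> * ((1 + e) / e)"
    using C' D by (intro mult_left_mono) auto
  finally show "norm (of_real \<Delta> * (\<Sum>j. f (v + real j * \<Delta>)) - (LINT t:{0<..}|lborel. f t)) \<le> C' * (1 + e) / e * \<Delta>"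
    by (simp add: mult_ac)
qed

lemma norm_exp_imag: "norm (exp (- (\<i> * of_real \<omega>) * of_real t)) = 1"
  by (simp add: norm_exp_eq_Re)

context carma begin

section \<open>The spectrum of the filtered process\<close>

definition modulated :: "real \<Rightarrow> real \<Rightarrow> complex" where
  "modulated \<omega> t = of_real (R 0 t) * exp (- (\<i> * \<omega>) * t)"

lemma modulated_riemann:
  "\<exists>K\<ge>0. \<forall>\<Delta> v. 0 < \<Delta> \<longrightarrow> \<Delta> \<le> 1 \<longrightarrow> 0 < v \<longrightarrow> v \<le> \<Delta> \<longrightarrow>
     summable (\<lambda>j. modulated \<omega> (v + real j * \<Delta>)) \<and>
     norm (of_real \<Delta> * (\<Sum>j. modulated \<omega> (v + real j * \<Delta>)) - \<sigma> * B (\<i> * \<omega>) / A (\<i> * \<omega>)) \<le> K * \<Delta>"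
proof -
  obtain C0 C1 where C0: "\<And>t. 0 \<le> t \<Longrightarrow> \<bar>R 0 t\<bar> \<le> C0 * exp (- rate * t)"
    and C1: "\<And>t. 0 \<le> t \<Longrightarrow> \<bar>R 1 t\<bar> \<le> C1 * exp (- rate * t)"
    using R_decay by meson
  define f' where "f' t = (of_real (R 1 t) - \<i> * \<omega> * of_real (R 0 t)) * exp (- (\<i> * \<omega>) * t)" for t :: real
  have d: "(modulated \<omega> has_vector_derivative f' t) (at t)" for t
  proof -
    have "((\<lambda>t. of_real (R 0 t)) has_vector_derivative complex_of_real (R 1 t)) (at t)"
      using deriv_family_R by (simp add: deriv_family_def)
    from has_vector_derivative_mult[OF this exp_vector_derivative[of "\<i> * \<omega>" t]]
    show ?thesis unfolding modulated_def[abs_def] f'_def by (simp add: algebra_simps)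
  qed
  have b: "norm (modulated \<omega> t) \<le> C0 * exp (- rate * t)" if "0 \<le> t" for t
    using C0[OF that] unfolding modulated_def norm_mult norm_exp_imag by simp
  have b': "norm (f' t) \<le> (C1 + \<bar>\<omega>\<bar> * C0) * exp (- rate * t)" if "0 \<le> t" for t
  proof -
    have "norm (f' t) = norm (complex_of_real (R 1 t) - \<i> * \<omega> * of_real (R 0 t))"
      unfolding f'_def norm_mult[of _ "exp _"] norm_exp_imag by simp
    also have "\<dots> \<le> norm (complex_of_real (R 1 t)) + norm (\<i> * \<omega> * of_real (R 0 t))"
      by (rule norm_triangle_ineq4)
    also have "\<dots> = \<bar>R 1 t\<bar> + \<bar>\<omega>\<bar> * \<bar>R 0 t\<bar>" by (simp add: norm_mult)
    also have "\<dots> \<le> C1 * exp (- rate * t) + \<bar>\<omega>\<bar> * (C0 * exp (- rate * t))"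
      using C0[OF that] C1[OF that] by (intro add_mono mult_left_mono) auto
    finally show ?thesis by (simp add: algebra_simps)
  qed
  have L: "(LINT t:{0<..}|lborel. modulated \<omega> t) = \<sigma> * B (\<i> * \<omega>) / A (\<i> * \<omega>)"
    using laplace_R[of "\<i> * \<omega>"] by (simp add: laplace_def modulated_def)
  define K where "K = (C1 + \<bar>\<omega>\<bar> * C0) * (1 + rate) / rate"
  have "0 \<le> C1 + \<bar>\<omega>\<bar> * C0" using order_trans[OF norm_ge_zero b'[of 0]] by simp
  hence "0 \<le> K" using rate(1) by (simp add: K_def)
  thus ?thesis
    using riemann_sum_half_line[OF rate(1) d b b'] unfolding L K_def by blast
qed

text \<open>The discrete Fourier transform of \<open>h\<close> along the grid with offset
  \<open>v\<close>. The p terms exhaust the support of \<open>h\<close>.\<close>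

definition S :: "real \<Rightarrow> real \<Rightarrow> real \<Rightarrow> complex" where
  "S \<omega> \<Delta> v = (\<Sum>m<p. of_real (h \<Delta> (v + real m * \<Delta>)) * exp (- (\<i> * \<omega>) * (real m * \<Delta>)))"

text \<open>On the grid \<open>h\<close> is the convolution of the filter coefficients with
  \<open>g\<close>, and the Fourier transform turns this into a product. Taking norms discards the
  phase due to the offset.\<close>

lemma norm_S:
  assumes D: "0 < \<Delta>" and v: "0 < v" "v \<le> \<Delta>" and sm: "summable (\<lambda>j. modulated \<omega> (v + real j * \<Delta>))"
  shows "norm (S \<omega> \<Delta> v) = norm (\<Phi> \<Delta> (exp (- (\<i> * \<omega>) * \<Delta>))) * norm (\<Sum>j. modulated \<omega> (v + real j * \<Delta>))"
proof -
  let ?P = "\<Sum>j. modulated \<omega> (v + real j * \<Delta>)" and ?h = "\<lambda>m. of_real (h \<Delta> (v + real m * \<Delta>)) * exp (- (\<i> * \<omega>) * (v + real m * \<Delta>))"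
  define z where "z = exp (- (\<i> * \<omega>) * \<Delta>)"
  define gt where "gt x = of_real (g x) * exp (- (\<i> * \<omega>) * x)" for x :: real
  have gt: "gt x = (if 0 < x then modulated \<omega> x else 0)" for x
    by (simp add: gt_def g_eq modulated_def)
  have pos: "0 < v + real m * \<Delta>" for m using D v by (simp add: add_pos_nonneg)
  have ht: "of_real (h \<Delta> x) * exp (- (\<i> * \<omega>) * x) = (\<Sum>k\<le>p. of_real (phi \<Delta> k) * z^k * gt (x - real k * \<Delta>))" for x :: real
  proof -
    have "exp (- (\<i> * \<omega>) * x) = z^k * exp (- (\<i> * \<omega>) * (x - real k * \<Delta>))" for k
      by (simp add: z_def algebra_simps flip: exp_of_nat_mult exp_add)
    hence "of_real (g (x - real k * \<Delta>)) * exp (- (\<i> * \<omega>) * x) = z^k * gt (x - real k * \<Delta>)" for k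
      by (simp add: gt_def mult_ac)
    thus ?thesis by (simp add: h_def sum_distrib_right mult.assoc)
  qed
  \<comment> \<open>Delaying by k grid steps only prepends k zero terms, so all delayed series have
    the same sum.\<close>
  have shift: "(\<lambda>m. gt (v + real m * \<Delta> - real k * \<Delta>)) sums ?P" for k
  proof -
    have eq: "gt (v + real (m + k) * \<Delta> - real k * \<Delta>) = modulated \<omega> (v + real m * \<Delta>)" for m
      using pos[of m] by (simp add: gt distrib_right)
    have zero: "gt (v + real i * \<Delta> - real k * \<Delta>) = 0" if "i < k" for i
    proof -
      have "(real i + 1) * \<Delta> \<le> real k * \<Delta>" using that D by (intro mult_right_mono) auto
      hence "v + real i * \<Delta> - real k * \<Delta> \<le> 0" using v by (simp add: distrib_right)
      thus ?thesis by (simp add: gt)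
    qed
    have "(\<lambda>m. gt (v + real (m + k) * \<Delta> - real k * \<Delta>)) sums ?P"
      unfolding eq using sm by (rule summable_sums)
    hence "(\<lambda>m. gt (v + real m * \<Delta> - real k * \<Delta>)) sums
        (?P + (\<Sum>i<k. gt (v + real i * \<Delta> - real k * \<Delta>)))"
      by (subst (asm) sums_iff_shift) simp
    thus ?thesis using zero by simp
  qed
  have "(\<lambda>m. ?h m) sums
      (\<Sum>k\<le>p. of_real (phi \<Delta> k) * z^k * ?P)"
    unfolding of_real_add[symmetric] ht using shift by (intro sums_sum sums_mult) (simp add: algebra_simps)
  moreover have "(\<lambda>m. ?h m) sums
      (\<Sum>m<p. ?h m)"
  proof (rule sums_finite)
    fix m assume "m \<notin> {..<p}"
    hence "real p * \<Delta> \<le> real m * \<Delta>" using D by (intro mult_right_mono) auto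
    hence "real p * \<Delta> < v + real m * \<Delta>" using v by linarith
    thus "?h m = 0"
      using h_large[OF D] by simp
  qed simp
  ultimately have "(\<Sum>m<p. ?h m) =
      \<Phi> \<Delta> z * ?P"
    by (simp add: sums_iff \<Phi>_def sum_distrib_right)
  moreover have "(\<Sum>m<p. ?h m) =
      S \<omega> \<Delta> v * exp (- (\<i> * \<omega>) * v)"
    unfolding S_def sum_distrib_right
    by (intro sum.cong refl) (simp add: algebra_simps flip: exp_add)
  ultimately have "norm (S \<omega> \<Delta> v * exp (- (\<i> * \<omega>) * v)) = norm (\<Phi> \<Delta> z * ?P)"
    by simp
  thus ?thesis by (simp only: norm_mult norm_exp_imag z_def mult_1_right)
qed

text \<open>Up to normalisation, the spectral density of the filtered sequence at angular frequency
  \<omega> \<Delta>, folded onto one sampling interval.\<close>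

definition energy :: "real \<Rightarrow> real \<Rightarrow> real" where
  "energy \<omega> \<Delta> = (LINT v:{0<..\<Delta>}|lborel. (norm (S \<omega> \<Delta> v))^2)"

lemma S_measurable [measurable]: "S \<omega> \<Delta> \<in> borel_measurable borel"
  unfolding S_def[abs_def] by measurable

text \<open>The modulus of \<open>S\<close> is close to |\<Phi>| / \<Delta> times \<sigma> |B / A|,
  and |\<Phi>| is close to \<Delta>^p |A|, so the autoregressive part cancels. Integration over an
  interval of length \<Delta> accounts for the remaining power of \<Delta>.\<close>

lemma tendsto_energy:
  "((\<lambda>\<Delta>. \<Delta> * energy \<omega> \<Delta> / (\<Delta>^p)^2) \<longlongrightarrow> (\<sigma> * norm (B (\<i> * \<omega>)))^2) (at_right 0)"
proof -
  let ?q = "\<sigma> * B (\<i> * \<omega>) / A (\<i> * \<omega>)"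
  define G where "G = norm (?q)"
  from modulated_riemann[of \<omega>] obtain K where K0: "0 \<le> K" and K1: "\<forall>\<Delta> v. 0 < \<Delta> \<longrightarrow> \<Delta> \<le> 1 \<longrightarrow> 0 < v \<longrightarrow> v \<le> \<Delta> \<longrightarrow>
     summable (\<lambda>j. modulated \<omega> (v + real j * \<Delta>)) \<and>
     norm (of_real \<Delta> * (\<Sum>j. modulated \<omega> (v + real j * \<Delta>)) - ?q) \<le> K * \<Delta>"
    by (elim exE conjE)
  have K: "0 \<le> K" "\<And>\<Delta> v. 0 < \<Delta> \<Longrightarrow> \<Delta> \<le> 1 \<Longrightarrow> 0 < v \<Longrightarrow> v \<le> \<Delta> \<Longrightarrow>
     summable (\<lambda>j. modulated \<omega> (v + real j * \<Delta>))"
     "\<And>\<Delta> v. 0 < \<Delta> \<Longrightarrow> \<Delta> \<le> 1 \<Longrightarrow> 0 < v \<Longrightarrow> v \<le> \<Delta> \<Longrightarrow>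
     norm (of_real \<Delta> * (\<Sum>j. modulated \<omega> (v + real j * \<Delta>)) - ?q) \<le> K * \<Delta>"
    using K0 K1 by simp_all
  define N where "N \<Delta> = norm (\<Phi> \<Delta> (exp (- (\<i> * \<omega>) * of_real \<Delta>)))" for \<Delta>
  \<comment> \<open>The maximum with 0 keeps the lower bound nonnegative, so that it survives
    squaring.\<close>
  have SN: "norm (S \<omega> \<Delta> v) \<le> N \<Delta> / \<Delta> * (G + K * \<Delta>)"
       "N \<Delta> / \<Delta> * max 0 (G - K * \<Delta>) \<le> norm (S \<omega> \<Delta> v)" if D: "0 < \<Delta>" "\<Delta> \<le> 1" and v: "0 < v" "v \<le> \<Delta>" for \<Delta> v
  proof -
    define P where "P = (\<Sum>j. modulated \<omega> (v + real j * \<Delta>))"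
    have n: "norm (S \<omega> \<Delta> v) = N \<Delta> / \<Delta> * norm (of_real \<Delta> * P)"
      using norm_S[OF D(1) v K(2)[OF D v]] D by (simp add: N_def P_def norm_mult)
    have "norm (of_real \<Delta> * P) \<le> G + K * \<Delta>" "G - K * \<Delta> \<le> norm (of_real \<Delta> * P)"
      using K(3)[OF D v] norm_triangle_ineq2[of "of_real \<Delta> * P" ?q]
        norm_triangle_ineq2[of ?q "of_real \<Delta> * P"]
      unfolding G_def P_def by (simp_all only: norm_minus_commute)
    thus "norm (S \<omega> \<Delta> v) \<le> N \<Delta> / \<Delta> * (G + K * \<Delta>)" "N \<Delta> / \<Delta> * max 0 (G - K * \<Delta>) \<le> norm (S \<omega> \<Delta> v)"
      unfolding n using D
      by (auto intro!: mult_left_mono simp only: max.bounded_iff norm_ge_zero simp_thms) (simp_all add: N_def)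
  qed
  have bounds: "\<Delta> * energy \<omega> \<Delta> / (\<Delta>^p)^2 \<le> (N \<Delta> / \<Delta>^p)^2 * (G + K * \<Delta>)^2"
     "(N \<Delta> / \<Delta>^p)^2 * (max 0 (G - K * \<Delta>))^2 \<le> \<Delta> * energy \<omega> \<Delta> / (\<Delta>^p)^2" if D: "0 < \<Delta>" "\<Delta> \<le> 1" for \<Delta>
  proof -
    have c: "set_integrable lborel {0<..\<Delta>} (\<lambda>v. c :: real)" for c
      using D by (auto simp: set_integrable_def)
    have sq: "(norm (S \<omega> \<Delta> v))^2 \<le> (N \<Delta> / \<Delta> * (G + K * \<Delta>))^2"
      "(N \<Delta> / \<Delta> * max 0 (G - K * \<Delta>))^2 \<le> (norm (S \<omega> \<Delta> v))^2" if "v \<in> {0<..\<Delta>}" for v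
      using SN[OF D, of v] that D by (auto intro!: power_mono simp: N_def)
    have iS: "set_integrable lborel {0<..\<Delta>} (\<lambda>v. (norm (S \<omega> \<Delta> v))^2)"
      using c[of "(N \<Delta> / \<Delta> * (G + K * \<Delta>))^2"] unfolding set_integrable_def
      by (rule Bochner_Integration.integrable_bound) (use sq in \<open>auto simp: indicator_def\<close>)
    have cI: "(LINT v:{0<..\<Delta>}|lborel. c) = c * \<Delta>" for c :: real
      using D by (simp add: set_lebesgue_integral_def)
    have u: "energy \<omega> \<Delta> \<le> (N \<Delta> / \<Delta> * (G + K * \<Delta>))^2 * \<Delta>"
      unfolding energy_def cI[of "(N \<Delta> / \<Delta> * (G + K * \<Delta>))^2", symmetric]
      by (intro set_integral_mono iS c sq)
    have l: "(N \<Delta> / \<Delta> * max 0 (G - K * \<Delta>))^2 * \<Delta> \<le> energy \<omega> \<Delta>"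
      unfolding energy_def cI[of "(N \<Delta> / \<Delta> * max 0 (G - K * \<Delta>))^2", symmetric]
      by (intro set_integral_mono iS c sq)
    have e: "\<Delta> * ((N \<Delta> / \<Delta> * x)^2 * \<Delta>) / (\<Delta>^p)^2 = (N \<Delta> / \<Delta>^p)^2 * x^2" for x
      using D by (simp add: power2_eq_square field_simps)
    show "\<Delta> * energy \<omega> \<Delta> / (\<Delta>^p)^2 \<le> (N \<Delta> / \<Delta>^p)^2 * (G + K * \<Delta>)^2"
      by (subst e[symmetric]) (use u D in \<open>auto intro!: divide_right_mono mult_left_mono\<close>)
    show "(N \<Delta> / \<Delta>^p)^2 * (max 0 (G - K * \<Delta>))^2 \<le> \<Delta> * energy \<omega> \<Delta> / (\<Delta>^p)^2"
      by (subst e[symmetric]) (use l D in \<open>auto intro!: divide_right_mono mult_left_mono\<close>)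
  qed
  have "((\<lambda>\<Delta>. norm (\<Phi> \<Delta> (exp (- (\<i> * \<omega>) * of_real \<Delta>)) / of_real \<Delta>^p)) \<longlongrightarrow> norm (A (\<i> * \<omega>))) (at_right 0)"
    by (intro tendsto_norm tendsto_Phi)
  moreover have "eventually (\<lambda>\<Delta>. norm (\<Phi> \<Delta> (exp (- (\<i> * \<omega>) * of_real \<Delta>)) / of_real \<Delta>^p) = N \<Delta> / \<Delta>^p) (at_right 0)"
    using eventually_at_right_less[of 0] by eventually_elim (simp add: N_def norm_divide norm_power)
  ultimately have N: "((\<lambda>\<Delta>. N \<Delta> / \<Delta>^p) \<longlongrightarrow> norm (A (\<i> * \<omega>))) (at_right 0)"
    by (rule Lim_transform_eventually)
  have AG: "norm (A (\<i> * \<omega>))^2 * G^2 = (\<sigma> * norm (B (\<i> * \<omega>)))^2"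
    using A_nonzero[of "\<i> * \<omega>"] sigma_pos
    by (simp add: G_def norm_mult norm_divide power_mult_distrib power_divide)
  have e1: "eventually (\<lambda>\<Delta>. 0 < \<Delta> \<and> \<Delta> \<le> 1) (at_right (0::real))"
    by (rule eventually_at_rightI[of 0 1]) auto
  show ?thesis
  proof (rule tendsto_sandwich)
    show "eventually (\<lambda>\<Delta>. (N \<Delta> / \<Delta>^p)^2 * (max 0 (G - K * \<Delta>))^2 \<le> \<Delta> * energy \<omega> \<Delta> / (\<Delta>^p)^2) (at_right 0)"
      using e1 by eventually_elim (use bounds in blast)
    show "eventually (\<lambda>\<Delta>. \<Delta> * energy \<omega> \<Delta> / (\<Delta>^p)^2 \<le> (N \<Delta> / \<Delta>^p)^2 * (G + K * \<Delta>)^2) (at_right 0)"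
      using e1 by eventually_elim (use bounds in blast)
    have "((\<lambda>\<Delta>. (N \<Delta> / \<Delta>^p)^2 * (max 0 (G - K * \<Delta>))^2) \<longlongrightarrow> (norm (A (\<i> * \<omega>)))^2 * (max 0 (G - K * 0))^2) (at_right 0)"
      by (intro tendsto_intros N)
    thus "((\<lambda>\<Delta>. (N \<Delta> / \<Delta>^p)^2 * (max 0 (G - K * \<Delta>))^2) \<longlongrightarrow> (\<sigma> * norm (B (\<i> * \<omega>)))^2) (at_right 0)"
      using AG by (simp add: G_def)
    have "((\<lambda>\<Delta>. (N \<Delta> / \<Delta>^p)^2 * (G + K * \<Delta>)^2) \<longlongrightarrow> (norm (A (\<i> * \<omega>)))^2 * (G + K * 0)^2) (at_right 0)"
      by (intro tendsto_intros N)
    thus "((\<lambda>\<Delta>. (N \<Delta> / \<Delta>^p)^2 * (G + K * \<Delta>)^2) \<longlongrightarrow> (\<sigma> * norm (B (\<i> * \<omega>)))^2) (at_right 0)"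
      using AG by simp
  qed
qed

definition filter_cov :: "real \<Rightarrow> int \<Rightarrow> real" where
  "filter_cov \<Delta> k = (\<integral>x. h \<Delta> x * h \<Delta> (x + of_int k * \<Delta>) \<partial>lborel)"

lemma h_mult_integrable: "integrable lborel (\<lambda>x. h \<Delta> (x + c) * h \<Delta> (x + d))"
  by (intro square_integrable_mult square_integrable_translate h_square_integrable)

text \<open>The support of \<open>h\<close> is cut into p cells of length \<Delta>, and each cell is
  translated to the first one.\<close>

lemma filter_cov_fold:
  assumes D: "0 < \<Delta>"
  shows "filter_cov \<Delta> k = (\<Sum>l<p. \<integral>v. indicator {0<..\<Delta>} v * (h \<Delta> (v + real l * \<Delta>) * h \<Delta> (v + of_int (int l + k) * \<Delta>)) \<partial>lborel)"
proof -
  let ?G = "\<lambda>l x. indicator {0<..\<Delta>} (x - real l * \<Delta>) * (h \<Delta> x * h \<Delta> (x + of_int k * \<Delta>))" and ?H = "\<lambda>l v. indicator {0<..\<Delta>} v * (h \<Delta> (v + real l * \<Delta>) * h \<Delta> (v + of_int (int l + k) * \<Delta>))"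
  have part: "h \<Delta> x = (\<Sum>l<p. indicator {0<..\<Delta>} (x - real l * \<Delta>) * h \<Delta> x)" for x
  proof (cases "0 < x \<and> x \<le> real p * \<Delta>")
    case True
    define n where "n = nat \<lceil>x / \<Delta>\<rceil>"
    have "0 < x / \<Delta>" "x / \<Delta> \<le> real p" using True D by (auto simp: field_simps)
    hence n: "real n - 1 < x / \<Delta>" "x / \<Delta> \<le> real n" "0 < n" "n \<le> p" unfolding n_def by linarith+
    then obtain j where j: "n = Suc j" by (cases n) auto
    have ind: "indicator {0<..\<Delta>} (x - real l * \<Delta>) = (if l = j then 1 else 0 :: real)" for l
    proof -
      have "x - real l * \<Delta> \<in> {0<..\<Delta>} \<longleftrightarrow> real l < x / \<Delta> \<and> x / \<Delta> \<le> real l + 1"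
        using D by (auto simp: field_simps)
      also have "\<dots> \<longleftrightarrow> l = j" using n by (auto simp: j)
      finally show ?thesis by (simp add: indicator_def)
    qed
    have "j < p" using n j by simp
    thus ?thesis by (simp add: ind if_distrib[of "\<lambda>c. c * _"] cong: if_cong)
  next
    case False
    hence "h \<Delta> x = 0" using h_nonpos[OF D, of x] h_large[OF D, of x] by (cases "x \<le> 0") auto
    thus ?thesis by simp
  qed
  have int: "integrable lborel (\<lambda>x. ?G l x)" for l
    by (rule Bochner_Integration.integrable_bound[OF h_mult_integrable[of \<Delta> 0 "of_int k * \<Delta>"]])
       (auto simp: indicator_def)
  have "filter_cov \<Delta> k = (\<integral>x. (\<Sum>l<p. ?G l x) \<partial>lborel)"
    unfolding filter_cov_def
    by (rule Bochner_Integration.integral_cong[OF refl], subst part)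
       (simp only: sum_distrib_right mult.assoc)
  also have "\<dots> = (\<Sum>l<p. \<integral>x. ?G l x \<partial>lborel)"
    by (rule Bochner_Integration.integral_sum) (rule int)
  also have "\<dots> = (\<Sum>l<p. \<integral>v. ?H l v \<partial>lborel)"
  proof (rule sum.cong[OF refl])
    fix l
    show "(\<integral>x. ?G l x \<partial>lborel) =
       (\<integral>v. ?H l v \<partial>lborel)"
      using lborel_integral_real_affine[of 1 "\<lambda>x. ?G l x" "real l * \<Delta>"]
      by (simp add: algebra_simps)
  qed
  finally show ?thesis .
qed

text \<open>Parseval's identity for the folded kernel: expanding |S|^2 gives a double sum over grid
  points l and m, and collecting the pairs with m - l = k produces the autocovariance at lag k. Lags
  up to p in modulus include all such differences.\<close>

lemma energy_eq:
  assumes D: "0 < \<Delta>"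
  shows "(\<Sum>k\<in>{- int p..int p}. exp (- (\<i> * \<omega>) * (of_int k * \<Delta>)) * of_real (filter_cov \<Delta> k)) = of_real (energy \<omega> \<Delta>)"
proof -
  let ?K = "{- int p..int p}"
  define E where "E k = exp (- (\<i> * of_real \<omega>) * (of_int k * of_real \<Delta>))" for k :: int
  let ?F = "\<lambda>k l v. E k * of_real (indicator {0<..\<Delta>} v * (h \<Delta> (v + real l * \<Delta>) * h \<Delta> (v + of_int (int l + k) * \<Delta>)))"
  have E_add: "E (k + l) = E k * E l" for k l
    by (simp add: E_def algebra_simps flip: exp_add)
  have E_cnj: "E (- k) = cnj (E k)" for k by (simp add: E_def exp_cnj)
  \<comment> \<open>For fixed \<open>l\<close> only the lags with l + k between 0 and p - 1 survive,
    because \<open>h\<close> vanishes off its support. They are renamed m - l.\<close>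
  have inner: "(\<Sum>k\<in>?K. E k * of_real (h \<Delta> (v + of_int (int l + k) * \<Delta>))) = cnj (E (int l)) * S \<omega> \<Delta> v"
    if l: "l < p" and v: "v \<in> {0<..\<Delta>}" for l v
  proof -
    have "(\<Sum>k\<in>?K. E k * of_real (h \<Delta> (v + of_int (int l + k) * \<Delta>))) =
       (\<Sum>k\<in>(\<lambda>m. int m - int l) ` {..<p}. E k * of_real (h \<Delta> (v + of_int (int l + k) * \<Delta>)))"
    proof (rule sum.mono_neutral_right)
      show "(\<lambda>m. int m - int l) ` {..<p} \<subseteq> ?K" using l by auto
      show "\<forall>k\<in>?K - (\<lambda>m. int m - int l) ` {..<p}. E k * of_real (h \<Delta> (v + of_int (int l + k) * \<Delta>)) = 0"
      proof
        fix k assume k: "k \<in> ?K - (\<lambda>m. int m - int l) ` {..<p}"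
        have "int l + k < 0 \<or> int p \<le> int l + k"
        proof (rule ccontr)
          assume "\<not> ?thesis"
          hence "k = int (nat (int l + k)) - int l" "nat (int l + k) \<in> {..<p}" by auto
          thus False using k by blast
        qed
        thus "E k * of_real (h \<Delta> (v + of_int (int l + k) * \<Delta>)) = 0"
        proof
          assume "int l + k < 0"
          hence "of_int (int l + k) * \<Delta> \<le> (- 1) * \<Delta>" using D by (intro mult_right_mono) auto
          hence "v + of_int (int l + k) * \<Delta> \<le> 0" using v by simp
          thus ?thesis using h_nonpos[OF D] by simp
        next
          assume "int p \<le> int l + k"
          hence "real p * \<Delta> \<le> of_int (int l + k) * \<Delta>" using D by (intro mult_right_mono) linarith+
          hence "real p * \<Delta> < v + of_int (int l + k) * \<Delta>" using v unfolding greaterThanAtMost_iff by linarith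
          thus ?thesis using h_large[OF D] by simp
        qed
      qed
    qed simp
    also have "\<dots> = (\<Sum>m<p. E (int m - int l) * of_real (h \<Delta> (v + real m * \<Delta>)))"
      by (subst sum.reindex) (auto simp: inj_on_def)
    also have "\<dots> = cnj (E (int l)) * S \<omega> \<Delta> v"
      unfolding S_def sum_distrib_left diff_conv_add_uminus E_add E_cnj
      by (intro sum.cong refl) (simp add: E_def mult_ac)
    finally show ?thesis .
  qed
  have int: "integrable lborel (\<lambda>v. indicator {0<..\<Delta>} v * (h \<Delta> (v + c) * h \<Delta> (v + d)))" for c d
    by (rule Bochner_Integration.integrable_bound[OF h_mult_integrable[of \<Delta> c d]]) (auto simp: indicator_def)
  have intE: "integrable lborel (\<lambda>v. E k * of_real (indicator {0<..\<Delta>} v * (h \<Delta> (v + c) * h \<Delta> (v + d))))" for k c d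
    by (intro Bochner_Integration.integrable_mult_right integrable_of_real int)
  have "(\<Sum>k\<in>?K. E k * of_real (filter_cov \<Delta> k)) =
    (\<Sum>k\<in>?K. \<Sum>l<p. \<integral>v. ?F k l v \<partial>lborel)"
    unfolding filter_cov_fold[OF D] of_real_sum sum_distrib_left
    by (simp only: integral_complex_of_real Bochner_Integration.integral_mult_right_zero)
  also have "\<dots> = (\<integral>v. (\<Sum>k\<in>?K. \<Sum>l<p. ?F k l v) \<partial>lborel)"
    by (simp only: Bochner_Integration.integral_sum[OF Bochner_Integration.integrable_sum[OF intE]]
        Bochner_Integration.integral_sum[OF intE])
  also have "\<dots> = (\<integral>v. of_real (indicator {0<..\<Delta>} v * (norm (S \<omega> \<Delta> v))^2) \<partial>lborel)"
  proof (rule Bochner_Integration.integral_cong[OF refl])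
    fix v
    show "(\<Sum>k\<in>?K. \<Sum>l<p. ?F k l v) =
      of_real (indicator {0<..\<Delta>} v * (norm (S \<omega> \<Delta> v))^2)"
    proof (cases "v \<in> {0<..\<Delta>}")
      case True
      have "(\<Sum>k\<in>?K. \<Sum>l<p. ?F k l v) =
        (\<Sum>l<p. of_real (h \<Delta> (v + real l * \<Delta>)) * (\<Sum>k\<in>?K. E k * of_real (h \<Delta> (v + of_int (int l + k) * \<Delta>))))"
        using True by (subst sum.swap) (simp add: sum_distrib_left mult_ac)
      also have "\<dots> = (\<Sum>l<p. of_real (h \<Delta> (v + real l * \<Delta>)) * (cnj (E (int l)) * S \<omega> \<Delta> v))"
        using inner[OF _ True] by simp
      also have "\<dots> = cnj (S \<omega> \<Delta> v) * S \<omega> \<Delta> v"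
      proof -
        have "cnj (S \<omega> \<Delta> v) = (\<Sum>l<p. of_real (h \<Delta> (v + real l * \<Delta>)) * cnj (E (int l)))"
          by (simp add: S_def E_def)
        thus ?thesis by (simp only: sum_distrib_right mult.assoc)
      qed
      also have "\<dots> = of_real ((norm (S \<omega> \<Delta> v))^2)"
        by (simp add: complex_norm_square mult.commute del: of_real_power)
      finally show ?thesis using True by simp
    qed simp
  qed
  also have "\<dots> = of_real (energy \<omega> \<Delta>)"
    by (simp only: integral_complex_of_real energy_def set_lebesgue_integral_def real_scaleR_def)
  finally show ?thesis by (simp add: E_def)
qed

end

section \<open>Limits of minimum-phase polynomials\<close>

lemma finite_family_convergent_subseq:
  fixes x :: "nat \<Rightarrow> nat \<Rightarrow> real"
  assumes "\<And>j n. j < d \<Longrightarrow> \<bar>x j n\<bar> \<le> K"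
  shows "\<exists>r. strict_mono r \<and> (\<forall>j<d. convergent (\<lambda>n. x j (r n)))"
  using assms
proof (induction d)
  case 0
  show ?case by (rule exI[of _ id]) (simp add: strict_mono_id)
next
  case (Suc d)
  then obtain r where r: "strict_mono r" "\<And>j. j < d \<Longrightarrow> convergent (\<lambda>n. x j (r n))" by auto
  have "bounded (range (\<lambda>n. x d (r n)))"
    using Suc.prems[of d] by (auto simp: bounded_iff)
  from bounded_imp_convergent_subsequence[OF this] obtain l u
    where u: "strict_mono u" "((\<lambda>n. x d (r n)) \<circ> u) \<longlonglongrightarrow> l" by blast
  show ?case
  proof (intro exI[of _ "r \<circ> u"] conjI allI impI)
    show "strict_mono (r \<circ> u)" using r(1) u(1) by (rule strict_mono_o)
    fix j assume j: "j < Suc d"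
    show "convergent (\<lambda>n. x j ((r \<circ> u) n))"
    proof (cases "j = d")
      case True
      thus ?thesis using u(2) by (auto simp: convergent_def comp_def)
    next
      case False
      with j r(2)[of j] have "convergent ((\<lambda>n. x j (r n)) \<circ> u)"
        by (intro convergent_subseq_convergent u(1)) auto
      thus ?thesis by (simp add: comp_def)
    qed
  qed
qed

lemma LIMSEQ_subsubseq:
  fixes f :: "nat \<Rightarrow> 'a :: metric_space"
  assumes "\<And>u :: nat \<Rightarrow> nat. strict_mono u \<Longrightarrow> \<exists>r. strict_mono r \<and> (\<lambda>n. f (u (r n))) \<longlonglongrightarrow> l"
  shows "f \<longlonglongrightarrow> l"
proof (rule tendstoI, rule ccontr)
  fix e :: real assume e: "e > 0" and "\<not> eventually (\<lambda>n. dist (f n) l < e) sequentially"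
  then obtain u where u: "strict_mono (u :: nat \<Rightarrow> nat)" "\<And>n. \<not> dist (f (u n)) l < e"
    by (meson not_eventually_sequentiallyD)
  from assms[OF u(1)] obtain r where "(\<lambda>n. f (u (r n))) \<longlonglongrightarrow> l" by blast
  hence "eventually (\<lambda>n. dist (f (u (r n))) l < e) sequentially" using e by (rule tendstoD)
  then obtain n where "dist (f (u (r n))) l < e" by (auto simp: eventually_sequentially)
  with u(2) show False by blast
qed

text \<open>This replaces Hurwitz' theorem: a zero of the limit inside the zero-free region would force the
  limit to vanish identically.\<close>
lemma poly_growth_nonvanishing:
  fixes P :: "complex poly"
  assumes "0 < r" "\<And>z. z \<in> ball s r \<Longrightarrow> poly P z \<noteq> 0"
  shows "norm (poly P x) \<le> (1 + norm (x - s) / r)^degree P * norm (poly P s)"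
  using assms(2)
proof (induction "degree P" arbitrary: P)
  case 0
  then obtain c where "P = [:c:]" by (metis degree_eq_zeroE)
  thus ?case by simp
next
  case (Suc n)
  hence "\<not> constant (poly P)" by (simp add: constant_degree)
  then obtain z where z: "poly P z = 0" using fundamental_theorem_of_algebra by blast
  then obtain Q where Q: "P = [:- z, 1:] * Q" by (auto simp: poly_eq_0_iff_dvd elim: dvdE)
  have "Q \<noteq> 0" using Suc.hyps(2) Q by auto
  hence dQ: "degree P = Suc (degree Q)" unfolding Q by (subst degree_mult_eq) auto
  have IH: "norm (poly Q x) \<le> (1 + norm (x - s) / r)^degree Q * norm (poly Q s)"
    using Suc.prems Suc.hyps(2) dQ by (intro Suc.hyps(1)) (auto simp: Q)
  \<comment> \<open>The zero lies outside the ball, so moving from \<open>s\<close> to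
    \<open>x\<close> enlarges the factor |x - z| at most by 1 + |x - s| / r.\<close>
  have "r \<le> norm (s - z)"
    using Suc.prems[of z] z by (auto simp: dist_norm not_less[symmetric])
  hence "norm (x - s) \<le> norm (x - s) / r * norm (s - z)"
    using assms(1) by (simp add: field_simps mult_right_mono)
  hence "norm (x - z) \<le> (1 + norm (x - s) / r) * norm (s - z)"
    using norm_triangle_ineq[of "x - s" "s - z"] by (simp add: distrib_right)
  hence "norm (x - z) * norm (poly Q x) \<le>
     ((1 + norm (x - s) / r) * norm (s - z)) * ((1 + norm (x - s) / r)^degree Q * norm (poly Q s))"
    using IH assms(1) by (intro mult_mono) auto
  moreover have "poly P y = (y - z) * poly Q y" for y by (simp add: Q algebra_simps)
  ultimately show ?case unfolding dQ by (simp add: norm_mult mult_ac)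
qed

text \<open>Composition with \<open>[:0, -1:]\<close> is P(- s), so the identity lists the zeroes of
  \<open>P\<close> together with their mirror images. From each pair m, - m the nonvanishing
  assumption selects - m, and dividing by that factor before continuing keeps track of
  multiplicities.\<close>

lemma symmetric_factorisation:
  fixes P :: "complex poly"
  assumes "\<kappa> \<noteq> 0" and "\<And>m. m \<in> set ms \<Longrightarrow> poly P m \<noteq> 0"
    and "P * pcompose P [:0, -1:] = smult \<kappa> (\<Prod>m\<leftarrow>ms. [:m, 1:] * [:m, -1:])"
  shows "\<exists>c. c^2 = \<kappa> \<and> P = smult c (\<Prod>m\<leftarrow>ms. [:m, 1:])"
  using assms(2,3)
proof (induction ms arbitrary: P)
  case Nil
  hence eq: "P * pcompose P [:0, -1:] = [:\<kappa>:]" by (simp add: one_pCons)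
  have "P \<noteq> 0" "pcompose P [:0, -1:] \<noteq> 0" using eq assms(1) by auto
  moreover have "degree (P * pcompose P [:0, -1:]) = 0" using eq by simp
  ultimately have "degree P = 0" by (simp add: degree_mult_eq)
  then obtain c where c: "P = [:c:]" by (metis degree_eq_zeroE)
  with eq show ?case by (intro exI[of _ c]) (simp add: power2_eq_square one_pCons)
next
  case (Cons m ms)
  have "poly P (- m) * poly P m = 0"
    using arg_cong[OF Cons.prems(2), of "\<lambda>p. poly p (- m)"] by (simp add: poly_pcompose)
  hence "poly P (- m) = 0" using Cons.prems(1)[of m] by simp
  then obtain Q where Q: "P = [:m, 1:] * Q" by (auto simp: poly_eq_0_iff_dvd elim: dvdE)
  have "([:m, 1:] * [:m, -1:]) * (Q * pcompose Q [:0, -1:]) = P * pcompose P [:0, -1:]"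
  proof -
    have "pcompose [:m, 1:] [:0, -1:] = [:m, -1:]" by (simp add: pcompose_pCons)
    thus ?thesis by (simp only: Q pcompose_mult mult_ac)
  qed
  also have "\<dots> = ([:m, 1:] * [:m, -1:]) * smult \<kappa> (\<Prod>m\<leftarrow>ms. [:m, 1:] * [:m, -1:])"
    unfolding Cons.prems(2) list.map prod_list.Cons by (simp only: mult_smult_right)
  finally have "Q * pcompose Q [:0, -1:] = smult \<kappa> (\<Prod>m\<leftarrow>ms. [:m, 1:] * [:m, -1:])"
    by (subst (asm) mult_cancel_left) auto
  moreover have "poly Q z \<noteq> 0" if "z \<in> set ms" for z
    using Cons.prems(1)[of z] that by (auto simp: Q)
  ultimately obtain c where "c^2 = \<kappa>" "Q = smult c (\<Prod>m\<leftarrow>ms. [:m, 1:])"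
    using Cons.IH by blast
  thus ?case by (intro exI[of _ c]) (simp only: Q list.map prod_list.Cons mult_smult_right simp_thms)
qed

lemma tendsto_poly_coeffs:
  fixes P :: "nat \<Rightarrow> 'a :: real_normed_field poly"
  assumes "\<And>n. degree (P n) \<le> d" "\<And>j. j \<le> d \<Longrightarrow> (\<lambda>n. coeff (P n) j) \<longlonglongrightarrow> t j" "z \<longlonglongrightarrow> y"
  shows "(\<lambda>n. poly (P n) (z n)) \<longlonglongrightarrow> (\<Sum>j\<le>d. t j * y^j)"
proof -
  have "poly (P n) (z n) = (\<Sum>j\<le>d. coeff (P n) j * z n^j)" for n
    unfolding poly_altdef using assms(1)[of n]
    by (intro sum.mono_neutral_left) (auto simp: coeff_eq_0)
  moreover have "(\<lambda>n. \<Sum>j\<le>d. coeff (P n) j * z n^j) \<longlonglongrightarrow> (\<Sum>j\<le>d. t j * y^j)"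
    using assms by (intro tendsto_intros) auto
  ultimately show ?thesis by simp
qed

abbreviation cpoly :: "real poly \<Rightarrow> complex poly" where "cpoly \<equiv> map_poly complex_of_real"

lemma coeff_cpoly [simp]: "coeff (cpoly P) j = of_real (coeff P j)"
  by (simp add: coeff_map_poly)

lemma degree_cpoly [simp]: "degree (cpoly P) = degree P"
  by (rule degree_map_poly) simp

lemma poly_cpoly_of_real: "poly (cpoly P) (of_real x) = of_real (poly P x)"
  by (simp add: poly_altdef)

lemma poly_cpoly_cnj: "poly (cpoly P) (cnj z) = cnj (poly (cpoly P) z)"
  by (simp add: poly_altdef)

context carma begin

text \<open>The entries of \<open>mu\<close> are the negatives of the zeroes of \<open>b\<close>, so
  an entry with positive real part is a zero in the left half plane and stays as it is.\<close>

definition reflected :: "complex list" where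
  "reflected = map (\<lambda>m. if 0 < Re m then m else - m) mu"

definition min_phase_value :: real where
  "min_phase_value = \<sigma> * norm (\<Prod>m\<leftarrow>reflected. 1 + m)"

text \<open>Each entry contributes m^2 - s^2, which does not see the sign of m. On the imaginary
  axis this is why the modulus cannot distinguish \<open>b\<close> from its reflection.\<close>

lemma B_reflected: "B s * B (- s) = (\<Prod>m\<leftarrow>reflected. (m + s) * (m - s))"
proof -
  have "(\<Prod>m\<leftarrow>ms. s + m) * (\<Prod>m\<leftarrow>ms. - s + m) = (\<Prod>m\<leftarrow>map (\<lambda>m. if 0 < Re m then m else - m) ms. (m + s) * (m - s))" for ms
    by (induction ms) (auto simp: algebra_simps)
  thus ?thesis by (simp add: B_def reflected_def)
qed

text \<open>The moduli on the imaginary axis determine the limit polynomial up to the choice of one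
  zero from each mirror pair and a constant factor. Absence of zeroes in the right half plane
  settles the choice, and nonnegativity at the points \<open>x n\<close> settles the sign. The
  points \<open>w n \<omega>\<close> merely approach the axis because the unit circle is
  curved.\<close>

lemma min_phase_limit_subseq:
  fixes T :: "nat \<Rightarrow> real poly" and w :: "nat \<Rightarrow> real \<Rightarrow> complex" and x :: "nat \<Rightarrow> real"
  assumes mu_nonzero: "\<forall>m\<in>set mu. Re m \<noteq> 0"
    and deg: "\<And>n. degree (T n) \<le> d"
    and w: "\<And>\<omega>. (\<lambda>n. w n \<omega>) \<longlonglongrightarrow> \<i> * \<omega>"
    and modulus: "\<And>\<omega>. (\<lambda>n. norm (poly (cpoly (T n)) (w n \<omega>))) \<longlonglongrightarrow> \<sigma> * norm (B (\<i> * \<omega>))"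
    and nz: "\<And>s. 0 < Re s \<Longrightarrow> \<exists>r>0. eventually (\<lambda>n. \<forall>z\<in>ball s r. poly (cpoly (T n)) z \<noteq> 0) sequentially"
    and x: "x \<longlonglongrightarrow> 1" "\<And>n. 0 \<le> poly (T n) (x n)"
  shows "\<exists>r. strict_mono r \<and> (\<lambda>n. poly (T (r n)) (x (r n))) \<longlonglongrightarrow> min_phase_value"
proof -
  define M where "M n = 1 + (\<Sum>j\<le>d. \<bar>coeff (T n) j\<bar>)" for n
  have M: "1 \<le> M n" for n by (simp add: M_def sum_nonneg)
  have cM: "\<bar>coeff (T n) j\<bar> \<le> M n" if "j \<le> d" for n j
  proof -
    have "\<bar>coeff (T n) j\<bar> \<le> (\<Sum>j\<le>d. \<bar>coeff (T n) j\<bar>)" using that by (intro member_le_sum) auto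
    thus ?thesis by (simp add: M_def)
  qed
  \<comment> \<open>The indices up to \<open>d\<close> are the normalised coefficients. Index
    \<open>d + 1\<close> is the reciprocal of the normalisation, so that its limit is obtained along
    the same subsequence.\<close>
  define y where "y j n = (if j \<le> d then coeff (T n) j / M n else 1 / M n)" for j n
  have "\<bar>y j n\<bar> \<le> 1" for j n using cM[of j n] M[of n] by (auto simp: y_def)
  from finite_family_convergent_subseq[of "d + 2" y 1, OF this] obtain r
    where r: "strict_mono r" and "\<forall>j<d+2. convergent (\<lambda>n. y j (r n))" by blast
  then obtain \<xi> where \<xi>: "\<And>j. j < d + 2 \<Longrightarrow> (\<lambda>n. y j (r n)) \<longlonglongrightarrow> \<xi> j"
    unfolding convergent_def by metis
  define \<nu> where "\<nu> = \<xi> (d + 1)"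
  have lim\<nu>: "(\<lambda>n. 1 / M (r n)) \<longlonglongrightarrow> \<nu>" using \<xi>[of "d + 1"] by (simp add: y_def \<nu>_def)
  have lim\<xi>: "(\<lambda>n. coeff (T (r n)) j / M (r n)) \<longlonglongrightarrow> \<xi> j" if "j \<le> d" for j
    using \<xi>[of j] that by (simp add: y_def)
  have rinf: "filterlim r sequentially sequentially" using r by (rule filterlim_subseq)
  have "B (\<i> * \<omega>) \<noteq> 0" for \<omega> :: real
  proof
    assume "B (\<i> * \<omega>) = 0"
    then obtain m where "m \<in> set mu" "\<i> * \<omega> + m = 0" by (auto simp: B_def prod_list_zero_iff)
    moreover from this(2) have "Re (\<i> * \<omega> + m) = 0" by (simp only: complex.sel zero_complex.sel)
    hence "Re m = 0" by simp
    ultimately show False using mu_nonzero by auto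
  qed
  hence Bnz: "norm (B (\<i> * \<omega>)) \<noteq> 0" for \<omega> :: real by simp
  have infin: "infinite (range (\<lambda>\<omega>. \<i> * complex_of_real \<omega>))"
  proof
    have "inj (\<lambda>\<omega>. \<i> * complex_of_real \<omega>)" by (auto simp: inj_def)
    moreover assume "finite (range (\<lambda>\<omega>. \<i> * complex_of_real \<omega>))"
    ultimately have "finite (UNIV :: real set)" by (rule finite_imageD[rotated])
    thus False by (simp add: infinite_UNIV_char_0)
  qed
  have wr: "(\<lambda>n. w (r n) \<omega>) \<longlonglongrightarrow> \<i> * \<omega>" for \<omega>
    using filterlim_compose[OF w rinf] .
  have mr: "(\<lambda>n. norm (poly (cpoly (T (r n))) (w (r n) \<omega>))) \<longlonglongrightarrow> \<sigma> * norm (B (\<i> * \<omega>))" for \<omega>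
    using filterlim_compose[OF modulus rinf] .
  \<comment> \<open>If the coefficients blew up, the normalised limit would vanish on the whole
    imaginary axis and hence be the zero polynomial. But the normalised quantities always add up to
    1 in absolute value.\<close>
  have "\<nu> \<noteq> 0"
  proof
    assume "\<nu> = 0"
    define Q where "Q = (\<Sum>j\<le>d. monom (complex_of_real (\<xi> j)) j)"
    have pQ: "poly Q s = (\<Sum>j\<le>d. of_real (\<xi> j) * s^j)" for s
      by (simp add: Q_def poly_sum poly_monom)
    have cQ: "coeff Q j = of_real (\<xi> j)" if "j \<le> d" for j
      using that by (simp add: Q_def coeff_sum)
    have "poly Q (\<i> * \<omega>) = 0" for \<omega> :: real
    proof -
      have "(\<lambda>n. poly (smult (of_real (1 / M (r n))) (cpoly (T (r n)))) (w (r n) \<omega>)) \<longlonglongrightarrow>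
         (\<Sum>j\<le>d. of_real (\<xi> j) * (\<i> * \<omega>)^j)"
      proof (rule tendsto_poly_coeffs[OF _ _ wr])
        show "degree (smult (of_real (1 / M (r n))) (cpoly (T (r n)))) \<le> d" for n
          using deg[of "r n"] by simp
        show "(\<lambda>n. coeff (smult (of_real (1 / M (r n))) (cpoly (T (r n)))) j) \<longlonglongrightarrow> complex_of_real (\<xi> j)" if "j \<le> d" for j
          using tendsto_of_real[OF lim\<xi>[OF that], where 'a = complex] by simp
      qed
      hence "(\<lambda>n. norm (poly (smult (of_real (1 / M (r n))) (cpoly (T (r n)))) (w (r n) \<omega>))) \<longlonglongrightarrow> norm (poly Q (\<i> * \<omega>))"
        unfolding pQ by (rule tendsto_norm)
      moreover have "norm (poly (smult (of_real (1 / M (r n))) (cpoly (T (r n)))) (w (r n) \<omega>)) =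
          1 / M (r n) * norm (poly (cpoly (T (r n))) (w (r n) \<omega>))" for n
        using M[of "r n"] by (simp add: norm_mult norm_divide)
      moreover have "(\<lambda>n. 1 / M (r n) * norm (poly (cpoly (T (r n))) (w (r n) \<omega>))) \<longlonglongrightarrow> 0 * (\<sigma> * norm (B (\<i> * \<omega>)))"
        using lim\<nu> \<open>\<nu> = 0\<close> by (intro tendsto_mult mr) simp
      ultimately have "norm (poly Q (\<i> * \<omega>)) = 0 * (\<sigma> * norm (B (\<i> * \<omega>)))"
        by (simp only:) (rule LIMSEQ_unique)
      thus ?thesis by simp
    qed
    hence "range (\<lambda>\<omega>. \<i> * complex_of_real \<omega>) \<subseteq> {z. poly Q z = 0}" by auto
    hence "Q = 0" using infin poly_roots_finite[of Q] finite_subset by blast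
    hence \<xi>0: "\<xi> j = 0" if "j \<le> d" for j using cQ[OF that] by simp
    have "(\<lambda>n. 1 / M (r n) + (\<Sum>j\<le>d. \<bar>coeff (T (r n)) j / M (r n)\<bar>)) \<longlonglongrightarrow> 0 + (\<Sum>j\<le>d. \<bar>0\<bar>)"
      using lim\<nu> \<open>\<nu> = 0\<close> lim\<xi> \<xi>0 by (intro tendsto_intros) auto
    moreover have "1 / M (r n) + (\<Sum>j\<le>d. \<bar>coeff (T (r n)) j / M (r n)\<bar>) = 1" for n
      using M[of "r n"] by (simp add: abs_divide flip: sum_divide_distrib add_divide_distrib) (simp add: M_def)
    ultimately show False by (simp add: LIMSEQ_const_iff)
  qed
  define t where "t j = \<xi> j / \<nu>" for j
  have limt: "(\<lambda>n. coeff (T (r n)) j) \<longlonglongrightarrow> t j" if "j \<le> d" for j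
  proof -
    have "(\<lambda>n. coeff (T (r n)) j / M (r n) / (1 / M (r n))) \<longlonglongrightarrow> \<xi> j / \<nu>"
      using lim\<xi>[OF that] lim\<nu> \<open>\<nu> \<noteq> 0\<close> by (rule tendsto_divide)
    moreover have "coeff (T (r n)) j / M (r n) / (1 / M (r n)) = coeff (T (r n)) j" for n
      using M[of "r n"] by simp
    ultimately show ?thesis by (simp add: t_def)
  qed
  define P where "P = (\<Sum>j\<le>d. monom (t j) j)"
  define C where "C = cpoly P"
  have pP: "poly P s = (\<Sum>j\<le>d. t j * s^j)" for s by (simp add: P_def poly_sum poly_monom)
  have coeffP: "coeff P j = (if j \<le> d then t j else 0)" for j by (simp add: P_def coeff_sum)
  have degP: "degree P \<le> d" by (rule degree_le) (simp add: coeffP)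
  have pC: "poly C s = (\<Sum>j\<le>d. of_real (t j) * s^j)" for s
  proof -
    have "poly C s = (\<Sum>j\<le>d. coeff C j * s^j)"
      unfolding poly_altdef using degP by (intro sum.mono_neutral_left) (auto simp: C_def coeff_eq_0)
    thus ?thesis by (simp add: C_def coeffP)
  qed
  have limC: "(\<lambda>n. poly (cpoly (T (r n))) (z n)) \<longlonglongrightarrow> poly C s" if "z \<longlonglongrightarrow> s" for z s
    unfolding pC using deg limt that by (intro tendsto_poly_coeffs) (auto intro: tendsto_of_real)
  have modC: "norm (poly C (\<i> * \<omega>)) = \<sigma> * norm (B (\<i> * \<omega>))" for \<omega> :: real
    using LIMSEQ_unique[OF tendsto_norm[OF limC[OF wr]] mr] .
  have nzC: "poly C s \<noteq> 0" if s: "0 < Re s" for s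
  proof
    assume zero: "poly C s = 0"
    obtain e where e: "e > 0" "eventually (\<lambda>n. \<forall>z\<in>ball s e. poly (cpoly (T n)) z \<noteq> 0) sequentially"
      using nz[OF s] by blast
    \<comment> \<open>The growth bound is compared at the origin, where the modulus of the limit is
      already known to be nonzero.\<close>
    have "norm (poly C 0) \<le> (1 + norm (0 - s) / e)^d * norm (poly C s)"
    proof (rule LIMSEQ_le[OF tendsto_norm[OF limC[OF tendsto_const]]
          tendsto_mult_left[OF tendsto_norm[OF limC[OF tendsto_const]]]])
      have "eventually (\<lambda>n. \<forall>z\<in>ball s e. poly (cpoly (T (r n))) z \<noteq> 0) sequentially"
        using e(2) rinf by (rule eventually_compose_filterlim)
      hence "eventually (\<lambda>n. norm (poly (cpoly (T (r n))) 0) \<le> (1 + norm (0 - s) / e)^d * norm (poly (cpoly (T (r n))) s)) sequentially"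
      proof eventually_elim
        case (elim n)
        have "norm (poly (cpoly (T (r n))) 0) \<le> (1 + norm (0 - s) / e)^degree (cpoly (T (r n))) * norm (poly (cpoly (T (r n))) s)"
          by (rule poly_growth_nonvanishing) (use e elim in auto)
        also have "\<dots> \<le> (1 + norm (0 - s) / e)^d * norm (poly (cpoly (T (r n))) s)"
          using deg[of "r n"] e by (intro mult_right_mono power_increasing) auto
        finally show ?case .
      qed
      thus "\<exists>N. \<forall>n\<ge>N. norm (poly (cpoly (T (r n))) 0) \<le> (1 + norm (0 - s) / e)^d * norm (poly (cpoly (T (r n))) s)"
        by (simp add: eventually_sequentially)
    qed
    hence "norm (poly C (\<i> * complex_of_real 0)) \<le> 0" using zero by simp
    thus False using modC[of 0] Bnz[of 0] sigma_pos by simp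
  qed
  \<comment> \<open>On the imaginary axis - s is the conjugate of s and \<open>C\<close> has real
    coefficients, so both sides are squared moduli there. Agreement at infinitely many points gives
    the polynomial identity.\<close>
  have ident: "C * pcompose C [:0, -1:] = smult (of_real (\<sigma>^2)) (\<Prod>m\<leftarrow>reflected. [:m, 1:] * [:m, -1:])"
    (is "?l = ?r")
  proof -
    have pr: "poly ?r s = of_real (\<sigma>^2) * (B s * B (- s))" for s
    proof -
    have "poly ([:m, 1:] * [:m, -1:]) s = (m + s) * (m - s)" for m by (simp add: algebra_simps)
    thus ?thesis by (simp only: B_reflected poly_smult poly_prod_list)
  qed
    have "poly ?l (\<i> * \<omega>) = poly ?r (\<i> * \<omega>)" for \<omega> :: real
    proof -
      have "poly ?l (\<i> * \<omega>) = poly C (\<i> * \<omega>) * poly C (cnj (\<i> * \<omega>))" by (simp add: poly_pcompose)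
      also have "\<dots> = of_real ((norm (poly C (\<i> * \<omega>)))^2)"
        unfolding C_def poly_cpoly_cnj by (simp only: complex_norm_square)
      also have "\<dots> = of_real (\<sigma>^2) * of_real ((norm (B (\<i> * \<omega>)))^2)"
        by (simp add: modC power_mult_distrib)
      also have "of_real ((norm (B (\<i> * \<omega>)))^2) = B (\<i> * \<omega>) * B (cnj (\<i> * \<omega>))"
        unfolding B_poly poly_cpoly_cnj by (simp only: complex_norm_square)
      finally show ?thesis
        by (simp only: pr complex_cnj_mult complex_cnj_i complex_cnj_complex_of_real mult_minus_left)
    qed
    hence "range (\<lambda>\<omega>. \<i> * complex_of_real \<omega>) \<subseteq> {z. poly (?l - ?r) z = 0}" by auto
    hence "?l - ?r = 0" using infin poly_roots_finite[of "?l - ?r"] finite_subset by blast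
    thus ?thesis by simp
  qed
  have "\<exists>c. c^2 = complex_of_real (\<sigma>^2) \<and> C = smult c (\<Prod>m\<leftarrow>reflected. [:m, 1:])"
  proof (rule symmetric_factorisation[OF _ _ ident])
    show "poly C m \<noteq> 0" if "m \<in> set reflected" for m
    proof (rule nzC)
      show "0 < Re m" using that mu_nonzero by (auto simp: reflected_def not_less order.order_iff_strict split: if_splits)
    qed
  qed (use sigma_pos in simp)
  then obtain c where c: "c^2 = complex_of_real (\<sigma>^2)" "C = smult c (\<Prod>m\<leftarrow>reflected. [:m, 1:])" by blast
  have "norm c ^ 2 = \<sigma>^2" using arg_cong[OF c(1), of norm] by (simp add: norm_power)
  hence "norm c = \<sigma>" using sigma_pos by (simp add: power2_eq_iff_nonneg)
  hence "norm (poly C 1) = min_phase_value"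
    by (simp add: c(2) min_phase_value_def poly_prod_list norm_mult add.commute)
  moreover have "poly C 1 = of_real (poly P 1)" using poly_cpoly_of_real[of P 1] by (simp add: C_def)
  ultimately have val: "\<bar>poly P 1\<bar> = min_phase_value" by simp
  have "(\<lambda>n. x (r n)) \<longlonglongrightarrow> 1" using filterlim_compose[OF x(1) rinf] .
  hence lim: "(\<lambda>n. poly (T (r n)) (x (r n))) \<longlonglongrightarrow> poly P 1"
    unfolding pP using deg limt by (intro tendsto_poly_coeffs) auto
  have "0 \<le> poly P 1" by (rule LIMSEQ_le_const[OF lim]) (use x(2) in auto)
  with val lim r show ?thesis by auto
qed

lemma min_phase_limit:
  fixes T :: "nat \<Rightarrow> real poly" and w :: "nat \<Rightarrow> real \<Rightarrow> complex" and x :: "nat \<Rightarrow> real"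
  assumes mu_nonzero: "\<forall>m\<in>set mu. Re m \<noteq> 0"
    and deg: "\<And>n. degree (T n) \<le> d"
    and w: "\<And>\<omega>. (\<lambda>n. w n \<omega>) \<longlonglongrightarrow> \<i> * \<omega>"
    and modulus: "\<And>\<omega>. (\<lambda>n. norm (poly (cpoly (T n)) (w n \<omega>))) \<longlonglongrightarrow> \<sigma> * norm (B (\<i> * \<omega>))"
    and nz: "\<And>s. 0 < Re s \<Longrightarrow> \<exists>r>0. eventually (\<lambda>n. \<forall>z\<in>ball s r. poly (cpoly (T n)) z \<noteq> 0) sequentially"
    and x: "x \<longlonglongrightarrow> 1" "\<And>n. 0 \<le> poly (T n) (x n)"
  shows "(\<lambda>n. poly (T n) (x n)) \<longlonglongrightarrow> min_phase_value"
proof (rule LIMSEQ_subsubseq)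
  fix u :: "nat \<Rightarrow> nat" assume u: "strict_mono u"
  have uinf: "filterlim u sequentially sequentially" using u by (rule filterlim_subseq)
  show "\<exists>r. strict_mono r \<and> (\<lambda>n. poly (T (u (r n))) (x (u (r n)))) \<longlonglongrightarrow> min_phase_value"
  proof (rule min_phase_limit_subseq[where T = "\<lambda>n. T (u n)" and x = "\<lambda>n. x (u n)" and w = "\<lambda>n. w (u n)", OF mu_nonzero])
    fix s :: complex assume "0 < Re s"
    then obtain r where r: "r > 0" "eventually (\<lambda>n. \<forall>z\<in>ball s r. poly (cpoly (T n)) z \<noteq> 0) sequentially"
      using nz by blast
    have "eventually (\<lambda>n. \<forall>z\<in>ball s r. poly (cpoly (T (u n))) z \<noteq> 0) sequentially"
      using r(2) uinf by (rule eventually_compose_filterlim)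
    thus "\<exists>r>0. eventually (\<lambda>n. \<forall>z\<in>ball s r. poly (cpoly (T (u n))) z \<noteq> 0) sequentially"
      using r(1) by blast
  qed (use deg x filterlim_compose[OF w uinf] filterlim_compose[OF modulus uinf] filterlim_compose[OF x(1) uinf] in auto)
qed

end

section \<open>The innovations of the sampled process\<close>

text \<open>Removing the factor with zero z leaves a sequence satisfying E(k + 1) = z E(k). With |z|
  at least 1 such a sequence tends to 0 only if it vanishes, and zeroes on the unit circle are
  covered.\<close>

lemma tendsto_zero_recurrence_unique:
  fixes Q :: "complex poly" and d :: "nat \<Rightarrow> complex"
  assumes "Q \<noteq> 0" "\<And>z. poly Q z = 0 \<Longrightarrow> 1 \<le> norm z"
    and "\<And>k. (\<Sum>j\<le>degree Q. coeff Q j * d (k + j)) = 0" and "d \<longlonglongrightarrow> 0"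
  shows "d k = 0"
  using assms(1-3)
proof (induction "degree Q" arbitrary: Q)
  case 0
  then obtain c where "Q = [:c:]" by (metis degree_eq_zeroE)
  thus ?case using 0(2) 0(4)[of k] by simp
next
  case (Suc n)
  hence "\<not> constant (poly Q)" by (simp add: constant_degree)
  then obtain z where z: "poly Q z = 0" using fundamental_theorem_of_algebra by blast
  then obtain P where P: "Q = [:- z, 1:] * P" by (auto simp: poly_eq_0_iff_dvd elim: dvdE)
  have "P \<noteq> 0" using Suc.prems(1) P by auto
  hence dQ: "degree Q = Suc (degree P)" unfolding P by (subst degree_mult_eq) auto
  define E where "E k = (\<Sum>j\<le>degree P. coeff P j * d (k + j))" for k
  have step: "E (Suc k) = z * E k" for k
  proof -
    have "(\<Sum>j\<le>Suc (degree P). coeff ([:- z, 1:] * P) j * d (k + j)) =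
       (\<Sum>j\<le>degree P. coeff P j * (- z * d (k + j) + 1 * d (k + Suc j)))"
      by (rule sum_coeff_linear_mult) simp
    also have "\<dots> = E (Suc k) - z * E k"
      by (simp add: E_def algebra_simps sum.distrib sum_distrib_left flip: sum_subtractf)
    finally show ?thesis using Suc.prems(3)[of k] unfolding dQ P[symmetric] by simp
  qed
  have pow: "E (k + n) = z^n * E k" for k n
    by (induction n) (simp_all add: step)
  have "E \<longlonglongrightarrow> (\<Sum>j\<le>degree P. coeff P j * 0)"
    unfolding E_def[abs_def] using LIMSEQ_ignore_initial_segment[OF assms(4)] by (intro tendsto_intros)
  hence E0: "E \<longlonglongrightarrow> 0" by simp
  have "E k = 0" for k
  proof -
    have "(\<lambda>n. norm (E (n + k))) \<longlonglongrightarrow> norm (0::complex)"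
      using LIMSEQ_ignore_initial_segment[OF E0] by (rule tendsto_norm)
    moreover have "norm (E k) \<le> norm (E (n + k))" for n
    proof -
      have "1 * norm (E k) \<le> norm z ^ n * norm (E k)"
        using Suc.prems(2)[OF z] by (intro mult_right_mono one_le_power) auto
      thus ?thesis using pow[of k n] by (simp add: norm_mult norm_power add.commute)
    qed
    ultimately have "norm (E k) \<le> norm (0::complex)" by (intro LIMSEQ_le_const) auto
    thus ?thesis by simp
  qed
  thus ?case
    using Suc.hyps(2) dQ Suc.prems(2) \<open>P \<noteq> 0\<close> by (intro Suc.hyps(1)[of P]) (auto simp: E_def P)
qed

section \<open>Second-order structure at a fixed mesh\<close>

locale sampled_carma = carma a b lam mu \<sigma> + standard_levy M L
  for a b :: "real poly" and lam mu :: "complex list" and \<sigma> :: real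
    and M :: "'a measure" and L :: "real \<Rightarrow> 'a \<Rightarrow> real" +
  fixes Y :: "real \<Rightarrow> 'a \<Rightarrow> real" and \<Delta> :: real and \<Theta> :: "real poly" and Z :: "int \<Rightarrow> 'a \<Rightarrow> real"
    and \<tau> :: real
  assumes Y_def: "\<forall>t. wiener_integral M L (\<lambda>u. carma_kernel \<sigma> a b (t - u)) (Y t)"
    and Delta_pos: "0 < \<Delta>" and tau_pos: "0 < \<tau>" and noise: "white_noise M Z (\<tau>^2)"
    and min_phase: "min_phase_ma (length lam) \<Theta>" and arma: "sampled_arma M Y \<Delta> lam \<Theta> Z"
begin

definition U :: "int \<Rightarrow> 'a \<Rightarrow> real" where
  "U n \<omega> = (\<Sum>k\<le>p. phi \<Delta> k * Y ((real_of_int n - real k) * \<Delta>) \<omega>)"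

lemma Y_wiener: "wiener_integral M L (\<lambda>u. g (t - u)) (Y t)"
  using Y_def by (simp add: g_def)

lemma Z_square_integrable: "square_integrable M (Z n)"
  using noise by (simp add: white_noise_def square_integrable_def)

lemma Z_cov: "(\<integral>\<omega>. Z n \<omega> * Z m \<omega> \<partial>M) = (if n = m then \<tau>^2 else 0)"
  using noise by (auto simp: white_noise_def power2_eq_square)

lemma U_square_integrable: "square_integrable M (U n)"
  unfolding U_def[abs_def]
  by (intro square_integrable_sum square_integrable_cmult wiener_integral_square_integrable[OF Y_wiener])

lemma U_eq: "AE \<omega> in M. U n \<omega> = (\<Sum>j\<le>degree \<Theta>. coeff \<Theta> j * Z (n - int j) \<omega>)"
proof -
  have "AE \<omega> in M. (\<Sum>k\<le>length lam. coeff (sampled_ar_poly \<Delta> lam) k *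
            complex_of_real (Y ((real_of_int n - real k) * \<Delta>) \<omega>))
        = complex_of_real (\<Sum>j\<le>degree \<Theta>. coeff \<Theta> j * Z (n - int j) \<omega>)"
    using arma unfolding sampled_arma_def by blast
  thus ?thesis
  proof eventually_elim
    case (elim \<omega>)
    have "complex_of_real (U n \<omega>) = complex_of_real (\<Sum>j\<le>degree \<Theta>. coeff \<Theta> j * Z (n - int j) \<omega>)"
      unfolding elim[symmetric] by (simp add: U_def phi)
    thus ?case by (simp only: of_real_eq_iff)
  qed
qed

lemma integral_U_left:
  assumes "square_integrable M X"
  shows "(\<integral>\<omega>. U n \<omega> * X \<omega> \<partial>M) = (\<Sum>j\<le>degree \<Theta>. coeff \<Theta> j * (\<integral>\<omega>. Z (n - int j) \<omega> * X \<omega> \<partial>M))"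
proof -
  have [measurable]: "X \<in> borel_measurable M" "U n \<in> borel_measurable M" "\<And>n. Z n \<in> borel_measurable M"
    using assms U_square_integrable Z_square_integrable by (auto simp: square_integrable_def)
  have "(\<integral>\<omega>. U n \<omega> * X \<omega> \<partial>M) = (\<integral>\<omega>. (\<Sum>j\<le>degree \<Theta>. coeff \<Theta> j * Z (n - int j) \<omega>) * X \<omega> \<partial>M)"
    using U_eq[of n] by (intro integral_cong_AE) (auto elim: eventually_mono)
  also have "\<dots> = (\<Sum>j\<le>degree \<Theta>. coeff \<Theta> j * (\<integral>\<omega>. Z (n - int j) \<omega> * X \<omega> \<partial>M))"
    by (intro integral_sum_mult Z_square_integrable assms)
  finally show ?thesis .
qed

lemma U_kernel: "(\<Sum>k\<le>p. phi \<Delta> k * g ((real_of_int n - real k) * \<Delta> - u)) = h \<Delta> (real_of_int n * \<Delta> - u)"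
  unfolding h_def by (intro sum.cong refl arg_cong2[where f = "(*)"] arg_cong[where f = g]) (simp add: algebra_simps)

lemma U_cov: "(\<integral>\<omega>. U n \<omega> * U m \<omega> \<partial>M) = filter_cov \<Delta> (m - n)"
proof -
  have "(\<integral>\<omega>. U n \<omega> * U m \<omega> \<partial>M) = (\<integral>u. h \<Delta> (real_of_int n * \<Delta> - u) * h \<Delta> (real_of_int m * \<Delta> - u) \<partial>lborel)"
    unfolding U_def U_kernel[symmetric]
    by (rule wiener_isometry_sum) (auto intro: Y_wiener)
  also have "\<dots> = filter_cov \<Delta> (m - n)"
    unfolding filter_cov_def
    by (subst lborel_integral_real_affine[of "-1" _ "real_of_int n * \<Delta>"]) (simp_all add: algebra_simps)
  finally show ?thesis .
qed

text \<open>The same autocovariances seen from the noise side: the double sum collects pairs of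
  moving average coefficients whose indices differ by the lag.\<close>

lemma filter_cov_eq:
  "filter_cov \<Delta> k = (\<Sum>i\<le>degree \<Theta>. \<Sum>j\<le>degree \<Theta>. if k = int j - int i then \<tau>^2 * coeff \<Theta> i * coeff \<Theta> j else 0)"
proof -
  have *: "(\<integral>\<omega>. Z n \<omega> * U m \<omega> \<partial>M) = (\<Sum>j\<le>degree \<Theta>. coeff \<Theta> j * (if m - int j = n then \<tau>^2 else 0))" for n m
    using integral_U_left[OF Z_square_integrable[of n], of m] by (simp add: Z_cov mult.commute[of "Z n _"])
  have "filter_cov \<Delta> k = (\<integral>\<omega>. U 0 \<omega> * U k \<omega> \<partial>M)" by (simp add: U_cov)
  also have "\<dots> = (\<Sum>i\<le>degree \<Theta>. \<Sum>j\<le>degree \<Theta>. coeff \<Theta> i * (coeff \<Theta> j * (if k - int j = - int i then \<tau>^2 else 0)))"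
    by (simp add: integral_U_left[OF U_square_integrable] * sum_distrib_left)
  also have "\<dots> = (\<Sum>i\<le>degree \<Theta>. \<Sum>j\<le>degree \<Theta>. if k = int j - int i then \<tau>^2 * coeff \<Theta> i * coeff \<Theta> j else 0)"
    by (intro sum.cong refl) auto
  finally show ?thesis .
qed

lemma degree_Theta: "degree \<Theta> \<le> p - 1"
  using min_phase by (simp add: min_phase_ma_def)

lemma Theta_nonzero: "norm z < 1 \<Longrightarrow> poly (cpoly \<Theta>) z \<noteq> 0"
  using min_phase unfolding min_phase_ma_def by (meson not_le)

text \<open>The spectral factorisation: the autocovariances of the filtered sequence, computed from
  the kernel and from the white noise, have the same Fourier sum.\<close>

lemma energy_Theta:
  "energy \<omega> \<Delta> = \<tau>^2 * (norm (poly (cpoly \<Theta>) (exp (- (\<i> * \<omega>) * \<Delta>))))^2"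
proof -
  define E where "E k = exp (- (\<i> * of_real \<omega>) * (of_int k * of_real \<Delta>))" for k :: int
  have E_diff: "E (int j - int i) = E (int j) * cnj (E (int i))" for i j
    by (simp add: E_def exp_cnj algebra_simps flip: exp_add)
  have E_pow: "E (int j) = exp (- (\<i> * \<omega>) * \<Delta>)^j" for j
    by (simp add: E_def algebra_simps flip: exp_of_nat_mult)
  define t where "t = poly (cpoly \<Theta>) (exp (- (\<i> * \<omega>) * \<Delta>))"
  have t: "t = (\<Sum>j\<le>degree \<Theta>. of_real (coeff \<Theta> j) * E (int j))"
    by (simp add: t_def poly_altdef E_pow)
  have "of_real (energy \<omega> \<Delta>) = (\<Sum>k\<in>{- int p..int p}. E k * of_real (filter_cov \<Delta> k))"
    unfolding energy_eq[OF Delta_pos, symmetric] E_def ..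
  also have "\<dots> = (\<Sum>k\<in>{- int p..int p}. \<Sum>i\<le>degree \<Theta>. \<Sum>j\<le>degree \<Theta>.
      if k = int j - int i then E k * of_real (\<tau>^2 * coeff \<Theta> i * coeff \<Theta> j) else 0)"
    unfolding filter_cov_eq of_real_sum sum_distrib_left by (intro sum.cong refl) auto
  also have "\<dots> = (\<Sum>i\<le>degree \<Theta>. \<Sum>k\<in>{- int p..int p}. \<Sum>j\<le>degree \<Theta>.
      if k = int j - int i then E k * of_real (\<tau>^2 * coeff \<Theta> i * coeff \<Theta> j) else 0)"
    by (rule sum.swap)
  also have "\<dots> = (\<Sum>i\<le>degree \<Theta>. \<Sum>j\<le>degree \<Theta>. \<Sum>k\<in>{- int p..int p}.
      if k = int j - int i then E k * of_real (\<tau>^2 * coeff \<Theta> i * coeff \<Theta> j) else 0)"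
    by (intro sum.cong refl sum.swap)
  also have "\<dots> = (\<Sum>i\<le>degree \<Theta>. \<Sum>j\<le>degree \<Theta>. E (int j - int i) * of_real (\<tau>^2 * coeff \<Theta> i * coeff \<Theta> j))"
  proof (intro sum.cong refl)
    fix i j assume "i \<in> {..degree \<Theta>}" "j \<in> {..degree \<Theta>}"
    hence "int j - int i \<in> {- int p..int p}" using degree_Theta by auto
    thus "(\<Sum>k\<in>{- int p..int p}. if k = int j - int i then E k * of_real (\<tau>^2 * coeff \<Theta> i * coeff \<Theta> j) else 0)
       = E (int j - int i) * of_real (\<tau>^2 * coeff \<Theta> i * coeff \<Theta> j)"
      by (subst sum.delta) auto
  qed
  also have "\<dots> = of_real (\<tau>^2) * (t * cnj t)"
  proof -
    have tt: "t * cnj t = (\<Sum>j\<le>degree \<Theta>. \<Sum>i\<le>degree \<Theta>. of_real (coeff \<Theta> j) * E (int j) * cnj (of_real (coeff \<Theta> i) * E (int i)))"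
      unfolding t by (simp only: cnj_sum sum_product)
    show ?thesis
      unfolding tt E_diff sum_distrib_left by (subst sum.swap) (simp add: mult_ac)
  qed
  also have "\<dots> = of_real (\<tau>^2 * (norm t)^2)"
    by (simp only: complex_norm_square of_real_mult)
  finally show ?thesis by (simp only: of_real_eq_iff t_def)
qed

text \<open>The polynomial equals 1 at 0 and has no zero on the real segment from 0 up to 1, so it
  cannot change sign there.\<close>

lemma Theta_exp_pos: "0 < poly \<Theta> (exp (- \<Delta>))"
proof (rule ccontr)
  have nz: "poly \<Theta> x \<noteq> 0" if "0 \<le> x" "x < 1" for x
    using Theta_nonzero[of "of_real x"] that by (auto simp: poly_cpoly_of_real)
  have q: "0 < exp (- \<Delta>)" "exp (- \<Delta>) < 1" using Delta_pos by auto
  assume "\<not> ?thesis"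
  hence neg: "poly \<Theta> (exp (- \<Delta>)) < 0" using nz[of "exp (- \<Delta>)"] q by auto
  have "poly \<Theta> 0 = 1" using min_phase by (simp add: min_phase_ma_def poly_0_coeff_0)
  then obtain x where "0 < x" "x < exp (- \<Delta>)" "poly \<Theta> x = 0"
    using poly_IVT_neg[OF q(1) _ neg] by auto
  thus False using nz[of x] q by simp
qed

section \<open>Covariances with the Ornstein-Uhlenbeck variables\<close>

text \<open>The Laplace transform of \<open>h\<close> at 1. Taking the real part only changes the
  type, since \<open>integral_h_exp\<close> identifies the complex expression with a real
  integral.\<close>

definition H :: real where "H = Re (\<Phi> \<Delta> (exp (- complex_of_real \<Delta>)) * (\<sigma> * B 1 / A 1))"

lemma integral_h_exp:
  "(\<integral>v. h \<Delta> v * exp (- v) \<partial>lborel) = H"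
proof -
  have gi: "has_bochner_integral lborel (\<lambda>v. complex_of_real (g (v - c) * exp (- v))) (of_real (exp (- c)) * (\<sigma> * B 1 / A 1))" for c :: real
  proof -
    obtain C where C: "\<forall>t\<ge>0. \<bar>R 0 t\<bar> \<le> C * exp (- rate * t)" using R_decay by meson
    have "set_integrable lborel {0<..} (\<lambda>t. complex_of_real (R 0 t) * exp (- 1 * of_real t))"
      using C by (intro laplace_integrable[OF rate(1) deriv_family_continuous[OF deriv_family_R]]) auto
    hence "has_bochner_integral lborel (\<lambda>t. indicator {0<..} t *\<^sub>R (of_real (R 0 t) * exp (- 1 * complex_of_real t))) (\<sigma> * B 1 / A 1)"
      using laplace_R[of 1]
      by (simp add: has_bochner_integral_iff set_integrable_def laplace_def set_lebesgue_integral_def)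
    moreover have "indicator {0<..} t *\<^sub>R (of_real (R 0 t) * exp (- 1 * complex_of_real t)) = of_real (g t * exp (- t))" for t
      by (simp add: g_eq indicator_def flip: exp_of_real)
    ultimately have "has_bochner_integral lborel (\<lambda>t. complex_of_real (g t * exp (- t))) (\<sigma> * B 1 / A 1)"
      by simp
    from lborel_has_bochner_integral_real_affine_iff[of 1, THEN iffD1, OF _ this, of "- c"]
    have "has_bochner_integral lborel (\<lambda>v. complex_of_real (g (v - c) * exp (c - v))) (\<sigma> * B 1 / A 1)" by simp
    from has_bochner_integral_mult_right[OF this, of "exp (- complex_of_real c)"]
    have "has_bochner_integral lborel (\<lambda>v. exp (- complex_of_real c) * complex_of_real (g (v - c) * exp (c - v))) (exp (- c) * (\<sigma> * B 1 / A 1))"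
      by (simp flip: exp_of_real)
    moreover have "exp (- complex_of_real c) * complex_of_real (g (v - c) * exp (c - v)) = of_real (g (v - c) * exp (- v))" for v
    proof -
      have "exp (- c) * exp (c - v) = exp (- v)" by (simp flip: exp_add)
      hence "exp (- c) * (g (v - c) * exp (c - v)) = g (v - c) * exp (- v)"
        by (subst mult.left_commute) (simp only:)
      hence "of_real (exp (- c)) * complex_of_real (g (v - c) * exp (c - v)) = of_real (g (v - c) * exp (- v))"
        by (simp only: of_real_mult[symmetric])
      thus ?thesis by (simp flip: exp_of_real)
    qed
    ultimately show ?thesis by (simp only: of_real_minus[symmetric] exp_of_real)
  qed
  have "has_bochner_integral lborel (\<lambda>v. \<Sum>k\<le>p. of_real (phi \<Delta> k) * complex_of_real (g (v - real k * \<Delta>) * exp (- v)))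
      (\<Sum>k\<le>p. of_real (phi \<Delta> k) * (exp (- (real k * \<Delta>)) * (\<sigma> * B 1 / A 1)))"
    by (intro has_bochner_integral_sum has_bochner_integral_mult_right gi)
  moreover have "(\<Sum>k\<le>p. of_real (phi \<Delta> k) * complex_of_real (g (v - real k * \<Delta>) * exp (- v))) = of_real (h \<Delta> v * exp (- v))" for v
    by (simp add: h_def sum_distrib_right mult.assoc)
  moreover have "(\<Sum>k\<le>p. of_real (phi \<Delta> k) * (exp (- (real k * \<Delta>)) * (\<sigma> * B 1 / A 1))) =
      \<Phi> \<Delta> (exp (- complex_of_real \<Delta>)) * (\<sigma> * B 1 / A 1)"
    unfolding \<Phi>_def sum_distrib_right
    by (intro sum.cong refl) (simp flip: exp_of_nat_mult exp_of_real)
  ultimately have "(\<integral>v. complex_of_real (h \<Delta> v * exp (- v)) \<partial>lborel) = \<Phi> \<Delta> (exp (- complex_of_real \<Delta>)) * (\<sigma> * B 1 / A 1)"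
    by (simp add: has_bochner_integral_iff)
  hence "of_real (\<integral>v. h \<Delta> v * exp (- v) \<partial>lborel) = \<Phi> \<Delta> (exp (- complex_of_real \<Delta>)) * (\<sigma> * B 1 / A 1)"
    by (simp only: integral_complex_of_real)
  thus ?thesis unfolding H_def by (metis Re_complex_of_real)
qed

text \<open>Since \<open>h\<close> lives on positive arguments and n is at most m, the test kernel
  is always evaluated on its exponential branch. The time difference then factors out.\<close>

lemma U_ou_cov:
  assumes "n \<le> m"
  shows "(\<integral>\<omega>. U n \<omega> * ou (real_of_int m * \<Delta>) \<omega> \<partial>M) = exp (- (real_of_int (m - n) * \<Delta>)) * H"
proof -
  have "(\<integral>\<omega>. U n \<omega> * ou (real_of_int m * \<Delta>) \<omega> \<partial>M) =
      (\<integral>u. h \<Delta> (real_of_int n * \<Delta> - u) * ou_kernel (real_of_int m * \<Delta>) u \<partial>lborel)"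
    unfolding U_def U_kernel[symmetric]
    using wiener_isometry_sum[where I = "{..p}" and J = "{()}" and c = "phi \<Delta>" and d = "\<lambda>_. 1"
      and f = "\<lambda>k u. g ((real_of_int n - real k) * \<Delta> - u)" and g = "\<lambda>_. ou_kernel (real_of_int m * \<Delta>)"
      and X = "\<lambda>k. Y ((real_of_int n - real k) * \<Delta>)" and Y = "\<lambda>_. ou (real_of_int m * \<Delta>)"]
    by (simp add: Y_wiener ou)
  also have "\<dots> = (\<integral>v. h \<Delta> v * ou_kernel (real_of_int m * \<Delta>) (real_of_int n * \<Delta> - v) \<partial>lborel)"
    by (subst lborel_integral_real_affine[of "-1" _ "real_of_int n * \<Delta>"]) simp_all
  also have "\<dots> = (\<integral>v. exp (- (real_of_int (m - n) * \<Delta>)) * (h \<Delta> v * exp (- v)) \<partial>lborel)"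
  proof (rule Bochner_Integration.integral_cong[OF refl])
    fix v
    show "h \<Delta> v * ou_kernel (real_of_int m * \<Delta>) (real_of_int n * \<Delta> - v) = exp (- (real_of_int (m - n) * \<Delta>)) * (h \<Delta> v * exp (- v))"
    proof (cases "v \<le> 0")
      case True
      thus ?thesis using h_nonpos[OF Delta_pos] by simp
    next
      case False
      have "real_of_int n * \<Delta> \<le> real_of_int m * \<Delta>" using assms Delta_pos by (intro mult_right_mono) auto
      hence "real_of_int n * \<Delta> - v \<le> real_of_int m * \<Delta>" using False by simp
      moreover have "real_of_int n * \<Delta> - v - real_of_int m * \<Delta> = - (real_of_int (m - n) * \<Delta>) + - v"
        by (simp add: algebra_simps)
      ultimately show ?thesis by (simp only: ou_kernel_def if_True exp_add mult_ac)
    qed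
  qed
  finally show ?thesis by (simp add: integral_h_exp)
qed

text \<open>Bessel's inequality for orthogonal noise against a variable of second moment 1/2.
  Testing with \<open>V\<close>, whose coefficients are the covariances themselves, gives s^2 \<le>
  \<tau>^2 s / 2 for their sum of squares s.\<close>

lemma Z_ou_bessel: "(\<Sum>k<K. (\<integral>\<omega>. Z (m - int k) \<omega> * ou t \<omega> \<partial>M)^2) \<le> \<tau>^2 / 2"
proof -
  define x where "x k = (\<integral>\<omega>. Z (m - int k) \<omega> * ou t \<omega> \<partial>M)" for k
  define V where "V \<omega> = (\<Sum>k<K. x k * Z (m - int k) \<omega>)" for \<omega>
  have sV: "square_integrable M V" unfolding V_def[abs_def]
    by (intro square_integrable_sum square_integrable_cmult Z_square_integrable)
  have VV: "(\<integral>\<omega>. V \<omega> * V \<omega> \<partial>M) = \<tau>^2 * (\<Sum>k<K. (x k)^2)"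
    unfolding V_def
    by (subst integral_mult_sum_sum) (auto simp: Z_square_integrable Z_cov power2_eq_square sum_distrib_left mult_ac
        if_distrib[of "\<lambda>c. _ * c"] cong: if_cong)
  have VW: "(\<integral>\<omega>. V \<omega> * ou t \<omega> \<partial>M) = (\<Sum>k<K. (x k)^2)"
    unfolding V_def
    by (subst integral_sum_mult) (auto simp: Z_square_integrable ou_square_integrable x_def power2_eq_square)
  let ?s = "\<Sum>k<K. (x k)^2"
  have "?s^2 \<le> (\<tau>^2 * ?s) * (1 / 2)"
    using integral_cauchy_schwarz[OF sV ou_square_integrable[of t]] by (simp add: VW VV[unfolded power2_eq_square[symmetric]] ou_norm)
  moreover have "0 \<le> ?s" by (simp add: sum_nonneg)
  ultimately have "?s \<le> \<tau>^2 / 2" by (cases "?s = 0") (auto simp: power2_eq_square)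
  thus ?thesis by (simp add: x_def)
qed

text \<open>The moving average equation makes the covariances solve a linear recurrence with a
  geometric right-hand side, for which the asserted value is a particular solution. By Bessel's
  inequality the difference tends to 0, and the minimum-phase condition leaves the homogeneous
  recurrence no other solution with that property.\<close>

lemma Z_ou_cov:
  assumes "n \<le> m"
  shows "(\<integral>\<omega>. Z n \<omega> * ou (real_of_int m * \<Delta>) \<omega> \<partial>M) = exp (- (real_of_int (m - n) * \<Delta>)) * H / poly \<Theta> (exp (- \<Delta>))"
proof -
  define q where "q = exp (- \<Delta>)"
  have q: "0 < q" "q < 1" using Delta_pos by (auto simp: q_def)
  have qpow: "exp (- (real k * \<Delta>)) = q^k" for k
    by (simp add: q_def flip: exp_of_nat_mult)
  have Tq: "poly \<Theta> q \<noteq> 0" using Theta_exp_pos by (simp add: q_def)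
  define x where "x k = (\<integral>\<omega>. Z (m - int k) \<omega> * ou (real_of_int m * \<Delta>) \<omega> \<partial>M)" for k
  define d where "d k = x k - q^k * H / poly \<Theta> q" for k
  have rec: "(\<Sum>j\<le>degree \<Theta>. coeff \<Theta> j * x (k + j)) = q^k * H" for k
  proof -
    have "(\<Sum>j\<le>degree \<Theta>. coeff \<Theta> j * x (k + j)) = (\<integral>\<omega>. U (m - int k) \<omega> * ou (real_of_int m * \<Delta>) \<omega> \<partial>M)"
      by (simp add: integral_U_left[OF ou_square_integrable] x_def diff_diff_eq)
    also have "\<dots> = q^k * H" by (subst U_ou_cov) (auto simp: qpow)
    finally show ?thesis .
  qed
  have drec: "(\<Sum>j\<le>degree \<Theta>. coeff \<Theta> j * d (k + j)) = 0" for k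
  proof -
    have "(\<Sum>j\<le>degree \<Theta>. coeff \<Theta> j * d (k + j)) =
        (\<Sum>j\<le>degree \<Theta>. coeff \<Theta> j * x (k + j)) - (\<Sum>j\<le>degree \<Theta>. coeff \<Theta> j * q^j) * (q^k * H / poly \<Theta> q)"
      unfolding sum_distrib_right d_def by (simp add: power_add algebra_simps flip: sum_subtractf)
    thus ?thesis using Tq by (simp add: rec flip: poly_altdef)
  qed
  have "summable (\<lambda>k. (x k)^2)"
    by (rule summableI_nonneg_bounded[where x = "\<tau>^2 / 2"]) (use Z_ou_bessel in \<open>auto simp: x_def\<close>)
  hence "(\<lambda>k. (x k)^2) \<longlonglongrightarrow> 0" by (rule summable_LIMSEQ_zero)
  hence "x \<longlonglongrightarrow> 0" by simp
  moreover have "(\<lambda>k. q^k * H / poly \<Theta> q) \<longlonglongrightarrow> 0"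
    using q Tq by (auto intro!: tendsto_eq_intros LIMSEQ_power_zero)
  ultimately have "d \<longlonglongrightarrow> 0 - 0" unfolding d_def[abs_def] by (rule tendsto_diff)
  hence d0: "(\<lambda>k. complex_of_real (d k)) \<longlonglongrightarrow> 0" using tendsto_of_real[of d 0 sequentially] by simp
  have "complex_of_real (d k) = 0" for k
  proof (rule tendsto_zero_recurrence_unique[of "cpoly \<Theta>", OF _ _ _ d0])
    show "cpoly \<Theta> \<noteq> 0" using Theta_nonzero[of 0] by auto
    show "1 \<le> norm z" if "poly (cpoly \<Theta>) z = 0" for z using Theta_nonzero[of z] that by (meson not_le)
    fix k
    have "(\<Sum>j\<le>degree (cpoly \<Theta>). coeff (cpoly \<Theta>) j * complex_of_real (d (k + j))) = of_real (\<Sum>j\<le>degree \<Theta>. coeff \<Theta> j * d (k + j))"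
      by simp
    thus "(\<Sum>j\<le>degree (cpoly \<Theta>). coeff (cpoly \<Theta>) j * complex_of_real (d (k + j))) = 0" by (simp only: drec of_real_0)
  qed
  from this[of "nat (m - n)"] have "d (nat (m - n)) = 0" by (simp only: of_real_eq_0_iff)
  hence "x (nat (m - n)) = q^nat (m - n) * H / poly \<Theta> q" by (simp add: d_def)
  thus ?thesis using assms qpow[of "nat (m - n)"] by (simp add: x_def q_def)
qed

definition Zn :: "int \<Rightarrow> 'a \<Rightarrow> real" where "Zn i \<omega> = sqrt \<Delta> / \<tau> * Z i \<omega>"

text \<open>Normalised so that the rescaled noise and the test variable at the same time have
  covariance \<open>gain\<close> times \<Delta>. A gain of 1 is what increments of \<open>L\<close>
  would have to leading order.\<close>

definition gain :: real where "gain = H / (sqrt \<Delta> * \<tau> * poly \<Theta> (exp (- \<Delta>)))"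

lemma Zn_square_integrable: "square_integrable M (Zn i)"
  unfolding Zn_def[abs_def] by (intro square_integrable_cmult Z_square_integrable)

lemma Zn_cov: "(\<integral>\<omega>. Zn i \<omega> * Zn j \<omega> \<partial>M) = (if i = j then \<Delta> else 0)"
proof -
  have "(\<integral>\<omega>. Zn i \<omega> * Zn j \<omega> \<partial>M) = (\<integral>\<omega>. \<Delta> / \<tau>^2 * (Z i \<omega> * Z j \<omega>) \<partial>M)"
    using Delta_pos by (intro Bochner_Integration.integral_cong refl) (simp add: Zn_def power2_eq_square)
  thus ?thesis using tau_pos by (simp add: Z_cov)
qed

lemma Zn_ou_cov:
  assumes "n \<le> m"
  shows "(\<integral>\<omega>. Zn n \<omega> * ou (real_of_int m * \<Delta>) \<omega> \<partial>M) = exp (- (real_of_int (m - n) * \<Delta>)) * (gain * \<Delta>)"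
proof -
  have "(\<integral>\<omega>. Zn n \<omega> * ou (real_of_int m * \<Delta>) \<omega> \<partial>M) = sqrt \<Delta> / \<tau> * (\<integral>\<omega>. Z n \<omega> * ou (real_of_int m * \<Delta>) \<omega> \<partial>M)"
    by (simp add: Zn_def mult.assoc)
  also have "\<dots> = exp (- (real_of_int (m - n) * \<Delta>)) * (sqrt \<Delta> / \<tau> * H / poly \<Theta> (exp (- \<Delta>)))"
    by (simp add: Z_ou_cov[OF assms])
  also have "sqrt \<Delta> / \<tau> * H / poly \<Theta> (exp (- \<Delta>)) = gain * \<Delta>"
  proof -
    have "\<Delta> = sqrt \<Delta> * sqrt \<Delta>" "sqrt \<Delta> \<noteq> 0" using Delta_pos by auto
    hence "H * \<Delta> / (sqrt \<Delta> * \<tau> * poly \<Theta> (exp (- \<Delta>))) = H * sqrt \<Delta> / (\<tau> * poly \<Theta> (exp (- \<Delta>)))"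
      using tau_pos Theta_exp_pos by (metis (no_types, opaque_lifting) mult.assoc mult.commute mult_divide_mult_cancel_left)
    thus ?thesis by (simp add: gain_def mult_ac)
  qed
  finally show ?thesis .
qed

end

section \<open>Partial sums of the rescaled noise\<close>

context sampled_carma begin

text \<open>Expanding the square leaves a geometric sum with ratio exp (- 2 \<Delta>), and \<Delta>
  on the right pays for its truncation. The upper limit k + N makes every sum start at the same time
  - N, so that consecutive sums obey the autoregressive step exactly.\<close>

lemma ou_square_approx:
  "\<exists>N. \<forall>k. (\<integral>\<omega>. ((\<Sum>j\<le>k + N. exp (- \<Delta>)^j * Zn (int k - int j) \<omega>) - ou (real k * \<Delta>) \<omega>)^2 \<partial>M) \<le>
     \<Delta> / (1 - exp (- 2 * \<Delta>)) * (1 - 2 * gain) + 1 / 2 + \<Delta>"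
proof -
  define q where "q = exp (- 2 * \<Delta>)"
  have q: "0 < q" "q < 1" using Delta_pos by (auto simp: q_def)
  have qq: "exp (- \<Delta>)^j * exp (- \<Delta>)^j = q^j" for j
    by (simp add: q_def flip: exp_add power_mult_distrib)
  have ex: "exp (- (real j * \<Delta>)) = exp (- \<Delta>)^j" for j by (simp flip: exp_of_nat_mult)
  define C where "C = \<bar>1 - 2 * gain\<bar> * (\<Delta> / (1 - q))"
  have C: "0 \<le> C" using Delta_pos q by (simp add: C_def)
  \<comment> \<open>Adding 1 keeps the quotient meaningful when \<open>C\<close> is 0.\<close>
  obtain N where N: "q^N < \<Delta> / (C + 1)"
    using real_arch_pow_inv[of "\<Delta> / (C + 1)" q] Delta_pos C q by auto
  hence "(C + 1) * q^N < \<Delta>" using C by (simp add: field_simps)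
  have CN: "C * q^i \<le> \<Delta>" if "N \<le> i" for i
  proof -
    have "C * q^i \<le> (C + 1) * q^N" using C q that by (intro mult_mono power_decreasing) auto
    with \<open>(C + 1) * q^N < \<Delta>\<close> show ?thesis by simp
  qed
  show ?thesis
  proof (intro exI[of _ N] allI)
    fix k
    define V where "V \<omega> = (\<Sum>j\<le>k + N. exp (- \<Delta>)^j * Zn (int k - int j) \<omega>)" for \<omega>
    define Q where "Q = (\<Sum>j\<le>k + N. q^j)"
    have sV: "square_integrable M V" unfolding V_def[abs_def]
      by (intro square_integrable_sum square_integrable_cmult Zn_square_integrable)
    have VV: "(\<integral>\<omega>. (V \<omega>)^2 \<partial>M) = \<Delta> * Q"
    proof -
      have "(\<integral>\<omega>. (V \<omega>)^2 \<partial>M) = (\<Sum>i\<le>k+N. \<Sum>j\<le>k+N. exp (- \<Delta>)^i * exp (- \<Delta>)^j * (if i = j then \<Delta> else 0))"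
        unfolding V_def power2_eq_square
        by (subst integral_mult_sum_sum) (auto simp: Zn_square_integrable Zn_cov intro!: sum.cong)
      also have "\<dots> = (\<Sum>i\<le>k+N. exp (- \<Delta>)^i * exp (- \<Delta>)^i * \<Delta>)"
        by (intro sum.cong refl) (simp add: if_distrib[of "\<lambda>c. _ * c"] cong: if_cong)
      also have "\<dots> = \<Delta> * Q" unfolding qq by (simp add: Q_def sum_distrib_left mult.commute)
      finally show ?thesis .
    qed
    have VW: "(\<integral>\<omega>. V \<omega> * ou (real k * \<Delta>) \<omega> \<partial>M) = gain * \<Delta> * Q"
    proof -
      have "(\<integral>\<omega>. V \<omega> * ou (real k * \<Delta>) \<omega> \<partial>M) = (\<Sum>j\<le>k+N. exp (- \<Delta>)^j * (exp (- \<Delta>)^j * (gain * \<Delta>)))"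
        unfolding V_def
        by (subst integral_sum_mult)
           (use Zn_ou_cov[of "int k - int j" "int k" for j] in \<open>auto simp: Zn_square_integrable ou_square_integrable ex\<close>)
      also have "\<dots> = gain * \<Delta> * Q" 
      proof -
        have "exp (- \<Delta>)^j * (exp (- \<Delta>)^j * (gain * \<Delta>)) = q^j * (gain * \<Delta>)" for j
          by (simp only: mult.assoc[symmetric] qq)
        thus ?thesis by (simp only: sum_distrib_right[symmetric] Q_def mult.commute)
      qed
      finally show ?thesis .
    qed
    have Q: "Q = (1 - q^Suc (k + N)) / (1 - q)"
      unfolding Q_def lessThan_Suc_atMost[symmetric] using q by (subst sum_gp_strict) auto
    have "(\<integral>\<omega>. (V \<omega> - ou (real k * \<Delta>) \<omega>)^2 \<partial>M) = \<Delta> * Q * (1 - 2 * gain) + 1 / 2"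
      unfolding integral_square_diff[OF sV ou_square_integrable] VV VW ou_norm by (simp add: algebra_simps)
    also have "\<Delta> * Q * (1 - 2 * gain) = \<Delta> / (1 - q) * (1 - 2 * gain) + (2 * gain - 1) * (\<Delta> / (1 - q)) * q^Suc (k + N)"
    proof -
      define r x where "r = \<Delta> / (1 - q)" and "x = q^Suc (k + N)"
      have eq: "\<Delta> * Q = r * (1 - x)" by (simp add: Q r_def x_def)
      show ?thesis unfolding eq r_def[symmetric] x_def[symmetric] by (simp add: algebra_simps)
    qed
    also have "(2 * gain - 1) * (\<Delta> / (1 - q)) * q^Suc (k + N) \<le> C * q^Suc (k + N)"
      unfolding C_def using q Delta_pos by (intro mult_right_mono) auto
    also have "\<dots> \<le> \<Delta>" by (rule CN) simp
    finally show "(\<integral>\<omega>. (V \<omega> - ou (real k * \<Delta>) \<omega>)^2 \<partial>M) \<le>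
     \<Delta> / (1 - exp (- 2 * \<Delta>)) * (1 - 2 * gain) + 1 / 2 + \<Delta>" by (simp add: q_def)
  qed
qed

text \<open>Both the rescaled noise and, up to a negligible error, the increments of \<open>L\<close> have the form
  \<open>X(k) - exp (-D) X(k - 1)\<close> for an Ornstein--Uhlenbeck type sequence \<open>X\<close>, so closeness of these two sequences
  telescopes to closeness of the partial sums.\<close>
lemma partial_sum_estimate:
  fixes n :: nat
  defines "\<eta> \<equiv> \<Delta> / (1 - exp (- 2 * \<Delta>)) * (1 - 2 * gain) + 1 / 2 + \<Delta>"
  shows "(\<integral>\<omega>. ((\<Sum>i=1..n. Zn (int i) \<omega>) - (L (real n * \<Delta>) \<omega> - L 0 \<omega>))^2 \<partial>M) \<le>
     6 * \<eta> * (2 + (real n * \<Delta>)^2) + 2 * (real n * \<Delta>)^2 * \<Delta>"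
proof -
  define q where "q = exp (- \<Delta>)"
  have q: "0 < q" "q < 1" using Delta_pos by (auto simp: q_def)
  have q1: "1 - q \<le> \<Delta>" using exp_ge_add_one_self[of "- \<Delta>"] by (simp add: q_def)
  obtain N where N: "\<And>k. (\<integral>\<omega>. ((\<Sum>j\<le>k + N. q^j * Zn (int k - int j) \<omega>) - ou (real k * \<Delta>) \<omega>)^2 \<partial>M) \<le> \<eta>"
    using ou_square_approx unfolding q_def \<eta>_def by blast
  define V where "V k \<omega> = (\<Sum>j\<le>k + N. q^j * Zn (int k - int j) \<omega>)" for k \<omega>
  define R where "R k \<omega> = V k \<omega> - ou (real k * \<Delta>) \<omega>" for k \<omega>
  define D where "D k \<omega> = ou (real (Suc k) * \<Delta>) \<omega> - q * ou (real k * \<Delta>) \<omega>" for k \<omega>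
  have sV: "square_integrable M (V k)" for k unfolding V_def[abs_def]
    by (intro square_integrable_sum square_integrable_cmult Zn_square_integrable)
  have sR: "square_integrable M (R k)" for k unfolding R_def[abs_def]
    by (intro square_integrable_diff sV ou_square_integrable)
  have sD: "square_integrable M (D k)" for k unfolding D_def[abs_def]
    by (intro square_integrable_diff square_integrable_cmult ou_square_integrable)
  have ER: "(\<integral>\<omega>. (R k \<omega>)^2 \<partial>M) \<le> \<eta>" for k using N by (simp add: R_def V_def)
  have "0 \<le> (\<integral>\<omega>. (R 0 \<omega>)^2 \<partial>M)" by simp
  hence \<eta>: "0 \<le> \<eta>" using ER[of 0] by linarith
  have Vstep: "V (Suc k) \<omega> = Zn (int (Suc k)) \<omega> + q * V k \<omega>" for k \<omega>
    unfolding V_def add_Suc by (subst sum.atMost_Suc_shift) (simp add: sum_distrib_left mult.assoc)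
  have RD: "Zn (int (Suc k)) \<omega> - D k \<omega> = (R (Suc k) \<omega> - R k \<omega>) + (1 - q) * R k \<omega>" for k \<omega>
    by (simp add: R_def D_def Vstep algebra_simps)
  \<comment> \<open>The quasi-difference with factor q splits into a true difference, which
    telescopes, and a remainder with factor 1 - q. As 1 - q is at most \<Delta>, the n remainders
    together weigh at most n \<Delta>.\<close>
  have tele: "(\<Sum>i<n. Zn (int (Suc i)) \<omega>) - (\<Sum>i<n. D i \<omega>) = R n \<omega> + (-1) * R 0 \<omega> + (1 - q) * (\<Sum>i<n. R i \<omega>)" for \<omega>
    by (simp only: sum_subtractf[symmetric] RD sum.distrib sum_lessThan_telescope[of "\<lambda>i. R i \<omega>"] sum_distrib_left[symmetric])
  have sSR: "square_integrable M (\<lambda>\<omega>. (1 - q) * (\<Sum>i<n. R i \<omega>))"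
    by (intro square_integrable_cmult square_integrable_sum sR)
  have first: "(\<integral>\<omega>. ((\<Sum>i<n. Zn (int (Suc i)) \<omega>) - (\<Sum>i<n. D i \<omega>))^2 \<partial>M) \<le> 3 * \<eta> * (2 + (real n * \<Delta>)^2)"
  proof -
    \<comment> \<open>The factor 3 in the estimate is Cauchy-Schwarz over these three
      summands.\<close>
    define X where "X j = (if j = (0::nat) then R n else if j = 1 then (\<lambda>\<omega>. (-1) * R 0 \<omega>) else (\<lambda>\<omega>. (1 - q) * (\<Sum>i<n. R i \<omega>)))" for j
    have sX: "square_integrable M (X j)" for j
      using sR sSR square_integrable_cmult[OF sR, of "-1" 0] by (simp add: X_def)
    have "(\<integral>\<omega>. (\<Sum>j<3. X j \<omega>)^2 \<partial>M) \<le> real (card {..<3::nat}) * (\<Sum>j<3. \<integral>\<omega>. (X j \<omega>)^2 \<partial>M)"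
      by (rule integral_square_sum_le) (auto intro: sX)
    also have "(\<Sum>j<3. \<integral>\<omega>. (X j \<omega>)^2 \<partial>M) = (\<integral>\<omega>. (R n \<omega>)^2 \<partial>M) + (\<integral>\<omega>. (R 0 \<omega>)^2 \<partial>M) + (1 - q)^2 * (\<integral>\<omega>. (\<Sum>i<n. R i \<omega>)^2 \<partial>M)"
    proof -
      have "{..<3::nat} = {0, 1, 2}" by auto
      thus ?thesis by (simp add: X_def power_mult_distrib)
    qed
    also have "(\<integral>\<omega>. (\<Sum>i<n. R i \<omega>)^2 \<partial>M) \<le> real n * (real n * \<eta>)"
    proof -
      have "(\<integral>\<omega>. (\<Sum>i<n. R i \<omega>)^2 \<partial>M) \<le> real (card {..<n}) * (\<Sum>i<n. \<integral>\<omega>. (R i \<omega>)^2 \<partial>M)"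
        by (rule integral_square_sum_le) (auto intro: sR)
      also have "\<dots> \<le> real n * (\<Sum>i<n. \<eta>)" by (simp del: sum_constant) (intro mult_left_mono sum_mono ER, simp)
      finally show ?thesis by simp
    qed
    hence "(1 - q)^2 * (\<integral>\<omega>. (\<Sum>i<n. R i \<omega>)^2 \<partial>M) \<le> \<Delta>^2 * (real n * (real n * \<eta>))"
      using q q1 by (intro mult_mono power_mono) auto
    with ER[of n] ER[of 0] have "real (card {..<3::nat}) * ((\<integral>\<omega>. (R n \<omega>)^2 \<partial>M) + (\<integral>\<omega>. (R 0 \<omega>)^2 \<partial>M) + (1 - q)^2 * (\<integral>\<omega>. (\<Sum>i<n. R i \<omega>)^2 \<partial>M))
      \<le> 3 * (\<eta> + \<eta> + \<Delta>^2 * (real n * (real n * \<eta>)))" by simp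
    finally show ?thesis unfolding tele by (simp add: eval_nat_numeral X_def algebra_simps)
  qed
  have second: "(\<integral>\<omega>. ((\<Sum>i<n. D i \<omega>) - (L (real n * \<Delta>) \<omega> - L 0 \<omega>))^2 \<partial>M) \<le> (real n * \<Delta>)^2 * \<Delta>"
  proof -
    have tel: "(\<Sum>i<n. D i \<omega>) - (L (real n * \<Delta>) \<omega> - L 0 \<omega>) = (\<Sum>i<n. D i \<omega> - (L (real (Suc i) * \<Delta>) \<omega> - L (real i * \<Delta>) \<omega>))" for \<omega>
    proof -
      have "(\<Sum>i<n. L (real (Suc i) * \<Delta>) \<omega> - L (real i * \<Delta>) \<omega>) = L (real n * \<Delta>) \<omega> - L 0 \<omega>"
        using sum_lessThan_telescope[of "\<lambda>i. L (real i * \<Delta>) \<omega>" n] by simp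
      thus ?thesis by (simp only: sum_subtractf)
    qed
    have sE: "square_integrable M (\<lambda>\<omega>. D i \<omega> - (L (real (Suc i) * \<Delta>) \<omega> - L (real i * \<Delta>) \<omega>))" for i
      by (intro square_integrable_diff sD incr_square_integrable)
    have one: "(\<integral>\<omega>. (D i \<omega> - (L (real (Suc i) * \<Delta>) \<omega> - L (real i * \<Delta>) \<omega>))^2 \<partial>M) \<le> \<Delta>^3" for i
    proof -
      have "real (Suc i) * \<Delta> - \<Delta> = real i * \<Delta>" by (simp add: algebra_simps)
      with incr_approx_ou[OF Delta_pos, of "real (Suc i) * \<Delta>"] show ?thesis
        by (simp only: D_def q_def power2_commute[of "ou _ _ - _"])
    qed
    have "(\<integral>\<omega>. ((\<Sum>i<n. D i \<omega>) - (L (real n * \<Delta>) \<omega> - L 0 \<omega>))^2 \<partial>M) \<le>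
       real (card {..<n}) * (\<Sum>i<n. \<integral>\<omega>. (D i \<omega> - (L (real (Suc i) * \<Delta>) \<omega> - L (real i * \<Delta>) \<omega>))^2 \<partial>M)"
      unfolding tel by (rule integral_square_sum_le[OF sE]) simp
    also have "\<dots> \<le> real n * (\<Sum>i<n. \<Delta>^3)"
      unfolding card_lessThan by (intro mult_left_mono sum_mono one) simp
    also have "\<dots> = (real n * \<Delta>)^2 * \<Delta>" by (simp add: power2_eq_square power3_eq_cube)
    finally show ?thesis .
  qed
  have "(\<integral>\<omega>. ((\<Sum>i<n. Zn (int (Suc i)) \<omega>) - (L (real n * \<Delta>) \<omega> - L 0 \<omega>))^2 \<partial>M) =
     (\<integral>\<omega>. (((\<Sum>i<n. Zn (int (Suc i)) \<omega>) - (\<Sum>i<n. D i \<omega>)) + ((\<Sum>i<n. D i \<omega>) - (L (real n * \<Delta>) \<omega> - L 0 \<omega>)))^2 \<partial>M)"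
    by (simp only: add_diff_eq diff_add_cancel)
  also have "\<dots> \<le> 2 * (3 * \<eta> * (2 + (real n * \<Delta>)^2)) + 2 * ((real n * \<Delta>)^2 * \<Delta>)"
    by (rule order_trans[OF integral_square_add_le add_mono[OF mult_left_mono[OF first] mult_left_mono[OF second]]])
       (auto intro!: square_integrable_diff square_integrable_sum Zn_square_integrable sD incr_square_integrable)
  finally show ?thesis
    unfolding One_nat_def sum.atLeast1_atMost_eq by simp
qed

text \<open>Testing against the variable at the final time weights the summands geometrically. As
  the mesh shrinks the ratio \<Delta> / (1 - exp (- \<Delta>)) tends to 1, so this covariance
  reveals the limit of the gain.\<close>

lemma partial_sum_ou_cov:
  "(\<integral>\<omega>. (\<Sum>i=1..n. Zn (int i) \<omega>) * ou (real n * \<Delta>) \<omega> \<partial>M) = gain * (\<Delta> / (1 - exp (- \<Delta>))) * (1 - exp (- (real n * \<Delta>)))"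
proof -
  define q where "q = exp (- \<Delta>)"
  have q: "q < 1" using Delta_pos by (auto simp: q_def)
  have ex: "exp (- (real j * \<Delta>)) = q^j" for j by (simp add: q_def flip: exp_of_nat_mult)
  have "(\<integral>\<omega>. (\<Sum>i=1..n. Zn (int i) \<omega>) * ou (real n * \<Delta>) \<omega> \<partial>M) = (\<Sum>i=1..n. \<integral>\<omega>. Zn (int i) \<omega> * ou (real n * \<Delta>) \<omega> \<partial>M)"
    using integral_sum_mult[of "{1..n}" M "\<lambda>i. Zn (int i)" "ou (real n * \<Delta>)" "\<lambda>_. 1"]
    by (simp add: Zn_square_integrable ou_square_integrable)
  also have "\<dots> = (\<Sum>i=1..n. q^(n - i) * (gain * \<Delta>))"
  proof (intro sum.cong refl)
    fix i assume "i \<in> {1..n}"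
    hence i: "int i \<le> int n" "real_of_int (int n - int i) = real (n - i)" by auto
    show "(\<integral>\<omega>. Zn (int i) \<omega> * ou (real n * \<Delta>) \<omega> \<partial>M) = q^(n - i) * (gain * \<Delta>)"
      using Zn_ou_cov[OF i(1)] unfolding i(2) ex by simp
  qed
  also have "\<dots> = (\<Sum>i<n. q^i * (gain * \<Delta>))"
    by (rule sum.reindex_bij_witness[of _ "\<lambda>i. n - i" "\<lambda>i. n - i"]) auto
  also have "\<dots> = (1 - q^n) / (1 - q) * (gain * \<Delta>)"
    using q by (simp add: sum_gp_strict flip: sum_distrib_right)
  finally show ?thesis unfolding ex q_def[symmetric] by (simp add: mult_ac)
qed

end

section \<open>The small-mesh limit\<close>

lemma cpoly_mult: "cpoly (P * Q) = cpoly P * cpoly Q"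
  by (simp add: poly_eq_iff coeff_mult)

lemma cpoly_add: "cpoly (P + Q) = cpoly P + cpoly Q"
  by (simp add: poly_eq_iff)

lemma poly_cpoly_rescaled:
  "poly (cpoly (smult c (pcompose P [:1, - d:]))) z = of_real c * poly (cpoly P) (1 - of_real d * z)"
proof -
  have "poly (cpoly (pcompose P [:1, - d:])) z = poly (cpoly P) (1 - of_real d * z)"
    by (induction P)
       (simp_all add: pcompose_pCons cpoly_add cpoly_mult map_poly_pCons algebra_simps del: mult_pCons_left)
  moreover have "cpoly (smult c Q) = smult (of_real c) (cpoly Q)" for Q by (simp add: poly_eq_iff)
  ultimately show ?thesis by simp
qed

lemma tendsto_exp_quotient:
  assumes "D \<longlonglongrightarrow> 0" "\<And>n. 0 < D n"
  shows "(\<lambda>n. (1 - exp (- (s * complex_of_real (D n)))) / of_real (D n)) \<longlonglongrightarrow> s"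
proof -
  have "((\<lambda>z. exp (- (s * z))) has_field_derivative (- s)) (at 0)"
    by (auto intro!: derivative_eq_intros)
  hence "((\<lambda>z. (exp (- (s * z)) - 1) / z) \<longlongrightarrow> - s) (at 0)"
    by (simp add: has_field_derivative_iff)
  moreover have "filterlim (\<lambda>n. complex_of_real (D n)) (at 0) sequentially"
    using tendsto_of_real[OF assms(1), where 'a = complex] assms(2)
    by (auto simp: filterlim_at less_imp_neq[THEN not_sym] intro!: always_eventually)
  ultimately have "(\<lambda>n. (exp (- (s * complex_of_real (D n))) - 1) / of_real (D n)) \<longlonglongrightarrow> - s"
    by (rule filterlim_compose)
  from tendsto_minus[OF this] show ?thesis by (simp add: minus_divide_left)
qed

section \<open>The limit of the gain and the Blaschke value\<close>

locale sampled_carma_family = carma a b lam mu \<sigma> + standard_levy M L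
  for a b :: "real poly" and lam mu :: "complex list" and \<sigma> :: real
    and M :: "'a measure" and L :: "real \<Rightarrow> 'a \<Rightarrow> real" +
  fixes Y :: "real \<Rightarrow> 'a \<Rightarrow> real" and \<delta>0 :: real
    and \<Theta> :: "real \<Rightarrow> real poly" and Z :: "real \<Rightarrow> int \<Rightarrow> 'a \<Rightarrow> real" and \<sigma>Z :: "real \<Rightarrow> real"
  assumes mu_nonzero: "\<forall>m\<in>set mu. Re m \<noteq> 0"
    and delta0: "0 < \<delta>0"
    and sampled: "\<And>\<Delta>. 0 < \<Delta> \<Longrightarrow> \<Delta> < \<delta>0 \<Longrightarrow> sampled_carma a b lam mu \<sigma> M L Y \<Delta> (\<Theta> \<Delta>) (Z \<Delta>) (\<sigma>Z \<Delta>)"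
begin

definition gain_at :: "real \<Rightarrow> real" where
  "gain_at \<Delta> = sampled_carma.gain lam mu \<sigma> \<Delta> (\<Theta> \<Delta>) (\<sigma>Z \<Delta>)"

text \<open>The value at 1 of the Blaschke product that maps the minimum-phase modification of the
  moving average polynomial to the polynomial itself.\<close>
definition blaschke_value :: real where
  "blaschke_value = Re (B 1) / norm (\<Prod>m\<leftarrow>reflected. 1 + m)"

lemma reflected_pos: "m \<in> set reflected \<Longrightarrow> 0 < Re m"
  using mu_nonzero by (auto simp: reflected_def not_less order.order_iff_strict split: if_splits)

lemma reflected_norm_pos: "0 < norm (\<Prod>m\<leftarrow>reflected. 1 + m)"
proof -
  have "1 + m \<noteq> 0" if "m \<in> set reflected" for m
    using reflected_pos[OF that] by (auto simp: complex_eq_iff)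
  thus ?thesis by (auto simp: prod_list_zero_iff)
qed

text \<open>Substituting z = 1 - D w magnifies the neighbourhood of z = 1, which is where the limit
  of the spectral factor is decided. Numerator and denominator of the gain are both divided by D^p,
  the order to which the autoregressive filter vanishes there.\<close>

lemma gain_seq:
  assumes D: "\<And>n. 0 < D n" "\<And>n. D n < \<delta>0" and lim: "D \<longlonglongrightarrow> 0"
  shows "(\<lambda>n. gain_at (D n)) \<longlonglongrightarrow> blaschke_value"
proof -
  have Dr: "filterlim D (at_right 0) sequentially"
    using lim D(1) by (auto simp: filterlim_at less_imp_neq[THEN not_sym] intro!: always_eventually)
  note S = sampled[OF D]
  have tpos: "0 < \<sigma>Z (D n)" for n using sampled_carma.tau_pos[OF S] .
  \<comment> \<open>Chosen so that the modulus of \<open>T n\<close> on the image of the unit circle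
    is the square root of the quantity in \<open>tendsto_energy\<close>.\<close>
  define c where "c n = sqrt (D n) * \<sigma>Z (D n) / D n^p" for n
  have c: "0 < c n" for n using D(1)[of n] tpos by (simp add: c_def)
  define T where "T n = smult (c n) (pcompose (\<Theta> (D n)) [:1, - D n:])" for n
  have pT: "poly (cpoly (T n)) z = of_real (c n) * poly (cpoly (\<Theta> (D n))) (1 - of_real (D n) * z)" for n z
    unfolding T_def by (rule poly_cpoly_rescaled)
  \<comment> \<open>\<open>w n \<omega>\<close> and \<open>x n\<close> are the points that the
    substitution sends to exp (- i \<omega> D) and exp (- D).\<close>
  define w where "w n \<omega> = (1 - exp (- (\<i> * of_real \<omega> * of_real (D n)))) / of_real (D n)" for n \<omega>
  define x where "x n = (1 - exp (- D n)) / D n" for n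
  have wD: "1 - of_real (D n) * w n \<omega> = exp (- (\<i> * of_real \<omega>) * of_real (D n))" for n \<omega>
    using D(1)[of n] by (simp add: w_def)
  have pTx: "poly (T n) (x n) = c n * poly (\<Theta> (D n)) (exp (- D n))" for n
    using D(1)[of n] by (simp add: T_def x_def poly_pcompose)
  have "(\<lambda>n. complex_of_real (x n)) \<longlonglongrightarrow> 1"
    using tendsto_exp_quotient[OF lim D(1), of 1] by (simp add: x_def exp_of_real flip: of_real_minus)
  hence xlim: "x \<longlonglongrightarrow> 1" using tendsto_Re by fastforce
  have Tlim: "(\<lambda>n. poly (T n) (x n)) \<longlonglongrightarrow> min_phase_value"
  proof (rule min_phase_limit[OF mu_nonzero, where d = "p - 1" and w = w])
    show "degree (T n) \<le> p - 1" for n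
      using sampled_carma.degree_Theta[OF S, of n] by (simp add: T_def degree_pcompose)
    show "(\<lambda>n. w n \<omega>) \<longlonglongrightarrow> \<i> * \<omega>" for \<omega>
      unfolding w_def by (rule tendsto_exp_quotient[OF lim D(1)])
    show "(\<lambda>n. norm (poly (cpoly (T n)) (w n \<omega>))) \<longlonglongrightarrow> \<sigma> * norm (B (\<i> * \<omega>))" for \<omega>
    proof -
      have "(\<lambda>n. sqrt (D n * energy \<omega> (D n) / (D n^p)^2)) \<longlonglongrightarrow> sqrt ((\<sigma> * norm (B (\<i> * \<omega>)))^2)"
        by (intro tendsto_real_sqrt filterlim_compose[OF tendsto_energy Dr])
      moreover have "sqrt (D n * energy \<omega> (D n) / (D n^p)^2) = norm (poly (cpoly (T n)) (w n \<omega>))" for n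
      proof -
        define t where "t = norm (poly (cpoly (\<Theta> (D n))) (exp (- (\<i> * of_real \<omega>) * of_real (D n))))"
        have "D n * energy \<omega> (D n) / (D n^p)^2 = (c n * t)^2"
          using D(1)[of n] unfolding sampled_carma.energy_Theta[OF S] t_def[symmetric]
          by (simp add: c_def power_mult_distrib power_divide)
        moreover have "norm (poly (cpoly (T n)) (w n \<omega>)) = c n * t"
          unfolding pT wD norm_mult t_def[symmetric] using c[of n] by simp
        moreover have "0 \<le> c n * t" using c[of n] by (simp add: t_def)
        ultimately show ?thesis by (simp only: real_sqrt_abs abs_of_nonneg)
      qed
      moreover have "0 \<le> \<sigma> * norm (B (\<i> * \<omega>))" using sigma_pos by simp
      ultimately show ?thesis by (simp only: real_sqrt_abs abs_of_nonneg)
    qed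
    show "\<exists>r>0. eventually (\<lambda>n. \<forall>z\<in>ball s r. poly (cpoly (T n)) z \<noteq> 0) sequentially" if s: "0 < Re s" for s
    proof (intro exI conjI)
      show "0 < Re s / 2" using s by simp
      \<comment> \<open>A bound for |z| on the ball, where Re z also exceeds Re s / 2. The point 1 -
        D z lies in the open unit disc exactly when D |z|^2 < 2 Re z, so D \<rho>^2 < Re s is
        sufficient.\<close>
      define \<rho> where "\<rho> = norm s + Re s / 2"
      have "(\<lambda>n. D n * \<rho>^2) \<longlonglongrightarrow> 0 * \<rho>^2" by (intro tendsto_intros lim)
      hence "eventually (\<lambda>n. D n * \<rho>^2 < Re s) sequentially" using s by (intro order_tendstoD(2)) auto
      thus "eventually (\<lambda>n. \<forall>z\<in>ball s (Re s / 2). poly (cpoly (T n)) z \<noteq> 0) sequentially"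
      proof eventually_elim
        case (elim n)
        show ?case
        proof
          fix z assume "z \<in> ball s (Re s / 2)"
          hence d: "norm (s - z) < Re s / 2" by (simp add: dist_norm)
          have "Re s - Re z < Re s / 2" using abs_Re_le_cmod[of "s - z"] d by simp
          hence Rz: "Re s < 2 * Re z" by simp
          have "norm z \<le> \<rho>" using norm_triangle_ineq3[of z s] d by (simp add: \<rho>_def norm_minus_commute)
          hence "D n * (norm z)^2 \<le> D n * \<rho>^2" using D(1)[of n] by (intro mult_left_mono power_mono) auto
          hence "D n * (norm z)^2 < 2 * Re z" using elim Rz by linarith
          hence "D n * (D n * (norm z)^2) < D n * (2 * Re z)" using D(1)[of n] by (intro mult_strict_left_mono)
          moreover have "(norm (1 - of_real (D n) * z))^2 = 1 - D n * (2 * Re z) + D n * (D n * (norm z)^2)"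
            unfolding cmod_power2 by (simp add: power2_eq_square algebra_simps)
          ultimately have "(norm (1 - of_real (D n) * z))^2 < 1^2" by simp
          hence "norm (1 - of_real (D n) * z) < 1" by (rule power2_less_imp_less) simp
          thus "poly (cpoly (T n)) z \<noteq> 0"
            unfolding pT using sampled_carma.Theta_nonzero[OF S] c[of n] by simp
        qed
      qed
    qed
    show "0 \<le> poly (T n) (x n)" for n
      unfolding pTx using c[of n] sampled_carma.Theta_exp_pos[OF S, of n] by simp
  qed (rule xlim)
  have "(\<lambda>n. Re (\<Phi> (D n) (exp (- 1 * of_real (D n))) / of_real (D n)^p * (\<sigma> * B 1 / A 1))) \<longlonglongrightarrow> Re (A 1 * (\<sigma> * B 1 / A 1))"
    by (intro tendsto_intros filterlim_compose[OF tendsto_Phi Dr])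
  hence num: "(\<lambda>n. Re (\<Phi> (D n) (exp (- 1 * of_real (D n))) / of_real (D n)^p * (\<sigma> * B 1 / A 1))) \<longlonglongrightarrow> \<sigma> * Re (B 1)"
    using A_nonzero[of 1] by simp
  have mpv: "min_phase_value \<noteq> 0" using reflected_norm_pos sigma_pos by (simp add: min_phase_value_def)
  have "gain_at (D n) = Re (\<Phi> (D n) (exp (- 1 * of_real (D n))) / of_real (D n)^p * (\<sigma> * B 1 / A 1)) / poly (T n) (x n)" for n
  proof -
    have "Re (\<Phi> (D n) (exp (- 1 * of_real (D n))) / of_real (D n)^p * (\<sigma> * B 1 / A 1)) =
      Re (\<Phi> (D n) (exp (- of_real (D n))) * (\<sigma> * B 1 / A 1) / of_real (D n^p))" by (simp add: mult_ac)
    also have "\<dots> = sampled_carma.H lam mu \<sigma> (D n) / D n^p"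
      unfolding Re_divide_of_real sampled_carma.H_def[OF S] ..
    finally show ?thesis
      unfolding gain_at_def sampled_carma.gain_def[OF S] pTx c_def using D(1)[of n] by simp
  qed
  with tendsto_divide[OF num Tlim mpv] show ?thesis
    using sigma_pos by (simp add: blaschke_value_def min_phase_value_def)
qed

lemma tendsto_gain: "(gain_at \<longlongrightarrow> blaschke_value) (at_right 0)"
  unfolding tendsto_at_iff_sequentially
proof (intro allI impI)
  fix X :: "nat \<Rightarrow> real"
  assume X: "\<forall>i. X i \<in> {0<..} - {0}" and lim: "X \<longlonglongrightarrow> 0"
  obtain k where k: "\<And>n. k \<le> n \<Longrightarrow> X n < \<delta>0"
    using order_tendstoD(2)[OF lim delta0] by (auto simp: eventually_sequentially)
  have "(\<lambda>n. gain_at (X (n + k))) \<longlonglongrightarrow> blaschke_value"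
    using X k by (intro gain_seq LIMSEQ_ignore_initial_segment lim) auto
  thus "(gain_at \<circ> X) \<longlonglongrightarrow> blaschke_value" unfolding comp_def by (rule LIMSEQ_offset)
qed

lemma B_one: "B 1 = of_real (poly b 1)"
  using poly_cpoly_of_real[of b 1] by (simp add: B_poly)

text \<open>No entry is reflected, so the quotient is b(1) / |b(1)| and only its sign is at stake.
  \<open>b\<close> is monic without real zeroes from 1 onwards, hence positive at 1.\<close>

lemma blaschke_value_invertible:
  assumes "\<forall>m\<in>set mu. 0 < Re m"
  shows "blaschke_value = 1"
proof -
  have "reflected = mu" unfolding reflected_def by (rule map_idI) (use assms in auto)
  hence n: "norm (\<Prod>m\<leftarrow>reflected. 1 + m) = \<bar>poly b 1\<bar>"
    using B_one by (metis B_def norm_of_real)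
  have nz: "poly b x \<noteq> 0" if "1 \<le> x" for x
  proof
    assume "poly b x = 0"
    hence "B (of_real x) = 0" by (simp add: B_poly poly_cpoly_of_real)
    then obtain m where "m \<in> set mu" "of_real x + m = 0" by (auto simp: B_def prod_list_zero_iff)
    moreover from this(2) have "x + Re m = 0" by (metis Re_complex_of_real plus_complex.sel(1) zero_complex.sel(1))
    ultimately show False using assms that by auto
  qed
  have "0 < poly b 1"
  proof (rule ccontr)
    assume "\<not> ?thesis"
    hence neg: "poly b 1 < 0" using nz[of 1] by simp
    have "complex_of_real (lead_coeff b) = 1"
      using lead_coeff_prod_linear[of "\<lambda>m. m" mu] arg_cong[OF b_roots, of "\<lambda>p. coeff p (length mu)"]
      by (simp add: degree_b)
    hence "lead_coeff b = 1" by (simp only: of_real_eq_1_iff)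
    then obtain y where y: "\<And>x. y \<le> x \<Longrightarrow> 1 \<le> poly b x"
      using poly_pinfty_gt_lc[of b] by auto
    have "0 < poly b (max 2 y)" using y[of "max 2 y"] by simp
    moreover have "1 < max 2 y" by simp
    ultimately obtain x where "1 < x" "poly b x = 0" using poly_IVT_pos[OF _ neg, of "max 2 y"] by blast
    thus False using nz[of x] by simp
  qed
  thus ?thesis unfolding blaschke_value_def n B_one by simp
qed

text \<open>|1 + m|^2 - |1 - m|^2 = 4 Re m, so every reflection strictly enlarges the corresponding
  factor of the denominator.\<close>

lemma blaschke_value_noninvertible:
  assumes "\<exists>m\<in>set mu. \<not> 0 < Re m"
  shows "blaschke_value < 1"
proof -
  define r where "r m = (if 0 < Re m then m else - m)" for m :: complex
  have one: "norm (1 + m) \<le> norm (1 + r m)" "0 < norm (1 + r m)" "\<not> 0 < Re m \<Longrightarrow> norm (1 + m) < norm (1 + r m)"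
    if "Re m \<noteq> 0" for m
  proof -
    have lt: "norm (1 + m) < norm (1 + r m)" if "\<not> 0 < Re m"
    proof (rule power2_less_imp_less)
      show "(norm (1 + m))^2 < (norm (1 + r m))^2"
        unfolding cmod_power2 using that \<open>Re m \<noteq> 0\<close> by (simp add: r_def power2_eq_square algebra_simps)
    qed simp
    show "norm (1 + m) \<le> norm (1 + r m)" using lt by (cases "0 < Re m") (auto simp: r_def)
    have "0 < Re (r m)" using that by (auto simp: r_def)
    hence "1 + r m \<noteq> 0" by (auto simp: complex_eq_iff)
    thus "0 < norm (1 + r m)" by simp
    show "norm (1 + m) < norm (1 + r m)" if "\<not> 0 < Re m" using lt that .
  qed
  \<comment> \<open>Positivity of the reflected product is part of the induction because a strict
    gain in one factor survives multiplication only by positive quantities.\<close>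
  have "norm (\<Prod>m\<leftarrow>ms. 1 + m) \<le> norm (\<Prod>m\<leftarrow>map r ms. 1 + m) \<and> 0 < norm (\<Prod>m\<leftarrow>map r ms. 1 + m) \<and>
     ((\<exists>m\<in>set ms. \<not> 0 < Re m) \<longrightarrow> norm (\<Prod>m\<leftarrow>ms. 1 + m) < norm (\<Prod>m\<leftarrow>map r ms. 1 + m))"
    if "\<forall>m\<in>set ms. Re m \<noteq> 0" for ms
    using that
  proof (induction ms)
    case (Cons m ms)
    hence IH: "norm (\<Prod>m\<leftarrow>ms. 1 + m) \<le> norm (\<Prod>m\<leftarrow>map r ms. 1 + m)" "0 < norm (\<Prod>m\<leftarrow>map r ms. 1 + m)"
      "(\<exists>m\<in>set ms. \<not> 0 < Re m) \<Longrightarrow> norm (\<Prod>m\<leftarrow>ms. 1 + m) < norm (\<Prod>m\<leftarrow>map r ms. 1 + m)" and m: "Re m \<noteq> 0"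
      by auto
    have "norm (1 + m) * norm (\<Prod>m\<leftarrow>ms. 1 + m) \<le> norm (1 + r m) * norm (\<Prod>m\<leftarrow>map r ms. 1 + m)"
      using one(1)[OF m] IH(1) by (intro mult_mono) auto
    moreover have "norm (1 + m) * norm (\<Prod>m\<leftarrow>ms. 1 + m) < norm (1 + r m) * norm (\<Prod>m\<leftarrow>map r ms. 1 + m)"
      if "\<exists>m\<in>set (m # ms). \<not> 0 < Re m"
    proof (cases "0 < Re m")
      case False
      have "norm (1 + m) * norm (\<Prod>m\<leftarrow>ms. 1 + m) \<le> norm (1 + m) * norm (\<Prod>m\<leftarrow>map r ms. 1 + m)"
        using IH(1) by (intro mult_left_mono) auto
      also have "\<dots> < norm (1 + r m) * norm (\<Prod>m\<leftarrow>map r ms. 1 + m)"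
        using one(3)[OF m False] IH(2) by (intro mult_strict_right_mono)
      finally show ?thesis .
    next
      case True
      with that have "norm (\<Prod>m\<leftarrow>ms. 1 + m) < norm (\<Prod>m\<leftarrow>map r ms. 1 + m)" by (intro IH(3)) auto
      hence "norm (1 + r m) * norm (\<Prod>m\<leftarrow>ms. 1 + m) < norm (1 + r m) * norm (\<Prod>m\<leftarrow>map r ms. 1 + m)"
        using one(2)[OF m] by (intro mult_strict_left_mono)
      thus ?thesis using True by (simp add: r_def)
    qed
    ultimately show ?case using one(2)[OF m] IH(2) by (simp add: norm_mult)
  qed simp
  moreover have "reflected = map r mu" unfolding reflected_def by (rule map_cong) (simp_all add: r_def)
  ultimately have "norm (\<Prod>m\<leftarrow>mu. 1 + m) < norm (\<Prod>m\<leftarrow>reflected. 1 + m)"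
    using mu_nonzero assms by simp
  moreover have "Re (B 1) \<le> norm (\<Prod>m\<leftarrow>mu. 1 + m)" using complex_Re_le_cmod[of "B 1"] by (simp add: B_def)
  ultimately show ?thesis using reflected_norm_pos by (simp add: blaschke_value_def)
qed

section \<open>Convergence of the partial sums and its converse\<close>

definition noise_sum :: "real \<Rightarrow> nat \<Rightarrow> 'a \<Rightarrow> real" where
  "noise_sum \<Delta> n \<omega> = (\<Sum>i=1..n. sqrt \<Delta> / \<sigma>Z \<Delta> * Z \<Delta> (int i) \<omega>)"

lemma noise_sum_eq:
  assumes "0 < \<Delta>" "\<Delta> < \<delta>0"
  shows "noise_sum \<Delta> n \<omega> = (\<Sum>i=1..n. sampled_carma.Zn \<Delta> (Z \<Delta>) (\<sigma>Z \<Delta>) (int i) \<omega>)"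
  by (simp add: noise_sum_def sampled_carma.Zn_def[OF sampled[OF assms]])

lemma noise_sum_square_integrable:
  assumes "0 < \<Delta>" "\<Delta> < \<delta>0"
  shows "square_integrable M (noise_sum \<Delta> n)"
  unfolding noise_sum_eq[OF assms, abs_def]
  by (intro square_integrable_sum sampled_carma.Zn_square_integrable[OF sampled[OF assms]])

text \<open>The bound of \<open>ou_square_approx\<close> as a function of the mesh. Since \<Delta> /
  (1 - exp (- 2 \<Delta>)) tends to 1/2, it tends to 1 minus the Blaschke value.\<close>

definition defect :: "real \<Rightarrow> real" where
  "defect \<Delta> = \<Delta> / (1 - exp (- 2 * \<Delta>)) * (1 - 2 * gain_at \<Delta>) + 1 / 2 + \<Delta>"

lemma tendsto_exp_ratio:
  fixes c :: real
  assumes "0 < c"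
  shows "((\<lambda>\<Delta>. \<Delta> / (1 - exp (- c * \<Delta>))) \<longlongrightarrow> 1 / c) (at_right 0)"
proof -
  have "((\<lambda>x. exp (- c * x)) has_real_derivative - c) (at 0)"
    by (auto intro!: derivative_eq_intros)
  hence "((\<lambda>x. (exp (- c * x) - 1) / x) \<longlongrightarrow> - c) (at 0)"
    by (simp add: has_field_derivative_iff)
  from tendsto_inverse[OF tendsto_minus[OF this]] assms
  have "((\<lambda>x. inverse (- ((exp (- c * x) - 1) / x))) \<longlongrightarrow> inverse c) (at 0)" by simp
  moreover have "inverse (- ((exp (- c * x) - 1) / x)) = x / (1 - exp (- c * x))" for x
    by (simp add: minus_divide_left)
  ultimately show ?thesis
    by (simp add: inverse_eq_divide filterlim_at_split)
qed

text \<open>The grid time below \<open>t\<close> misses it by less than \<Delta>, and the increment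
  of \<open>L\<close> over this gap has second moment at most \<Delta>. This is the final
  summand.\<close>

lemma noise_sum_error:
  assumes D: "0 < \<Delta>" "\<Delta> < \<delta>0" and t: "0 < t"
  shows "(\<integral>\<omega>. (noise_sum \<Delta> (nat \<lfloor>t / \<Delta>\<rfloor>) \<omega> - L t \<omega>)^2 \<partial>M) \<le>
     2 * (6 * defect \<Delta> * (2 + (real (nat \<lfloor>t / \<Delta>\<rfloor>) * \<Delta>)^2) + 2 * (real (nat \<lfloor>t / \<Delta>\<rfloor>) * \<Delta>)^2 * \<Delta>) + 2 * \<Delta>"
proof -
  define n where "n = nat \<lfloor>t / \<Delta>\<rfloor>"
  have "0 \<le> t / \<Delta>" using t D by simp
  hence "real n \<le> t / \<Delta>" "t / \<Delta> < real n + 1" unfolding n_def by linarith+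
  hence n: "real n * \<Delta> \<le> t" "t < real n * \<Delta> + \<Delta>" using D by (auto simp: field_simps)
  note sS = noise_sum_square_integrable[OF D, of n]
  have "(\<integral>\<omega>. (noise_sum \<Delta> n \<omega> - L t \<omega>)^2 \<partial>M) =
     (\<integral>\<omega>. ((noise_sum \<Delta> n \<omega> - (L (real n * \<Delta>) \<omega> - L 0 \<omega>)) + (L (real n * \<Delta>) \<omega> - L t \<omega>))^2 \<partial>M)"
  proof (rule integral_cong_AE)
    show "AE \<omega> in M. (noise_sum \<Delta> n \<omega> - L t \<omega>)^2 =
      ((noise_sum \<Delta> n \<omega> - (L (real n * \<Delta>) \<omega> - L 0 \<omega>)) + (L (real n * \<Delta>) \<omega> - L t \<omega>))^2"
      using L_zero by eventually_elim simp
  qed (use square_integrable_measurable[OF sS] in measurable)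
  also have "\<dots> \<le> 2 * (\<integral>\<omega>. (noise_sum \<Delta> n \<omega> - (L (real n * \<Delta>) \<omega> - L 0 \<omega>))^2 \<partial>M) + 2 * (\<integral>\<omega>. (L (real n * \<Delta>) \<omega> - L t \<omega>)^2 \<partial>M)"
    by (intro integral_square_add_le square_integrable_diff sS incr_square_integrable)
  also have "(\<integral>\<omega>. (L (real n * \<Delta>) \<omega> - L t \<omega>)^2 \<partial>M) \<le> \<Delta>" using n by (simp add: incr_second_moment)
  also have "(\<integral>\<omega>. (noise_sum \<Delta> n \<omega> - (L (real n * \<Delta>) \<omega> - L 0 \<omega>))^2 \<partial>M) \<le>
     6 * defect \<Delta> * (2 + (real n * \<Delta>)^2) + 2 * (real n * \<Delta>)^2 * \<Delta>"
    unfolding noise_sum_eq[OF D] defect_def gain_at_def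
    by (rule sampled_carma.partial_sum_estimate[OF sampled[OF D]])
  finally show ?thesis by (simp add: n_def)
qed

lemma noise_sum_nn:
  assumes "0 < \<Delta>" "\<Delta> < \<delta>0" "0 < t"
  shows "(\<integral>\<^sup>+ \<omega>. ennreal ((noise_sum \<Delta> n \<omega> - L t \<omega>)^2) \<partial>M) = ennreal (\<integral>\<omega>. (noise_sum \<Delta> n \<omega> - L t \<omega>)^2 \<partial>M)"
  using assms by (intro nn_integral_square square_integrable_diff noise_sum_square_integrable L_square_integrable) auto

lemma eventually_small: "eventually (\<lambda>\<Delta>. 0 < \<Delta> \<and> \<Delta> < \<delta>0) (at_right 0)"
  by (rule eventually_at_rightI[of 0 \<delta>0]) (use delta0 in auto)

lemma convergence_if_invertible:
  assumes inv: "\<forall>m\<in>set mu. 0 < Re m" and t: "0 < t"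
  shows "((\<lambda>\<Delta>. \<integral>\<^sup>+ \<omega>. ennreal ((noise_sum \<Delta> (nat \<lfloor>t / \<Delta>\<rfloor>) \<omega> - L t \<omega>)^2) \<partial>M) \<longlongrightarrow> 0) (at_right 0)"
proof -
  define e where "e \<Delta> = (\<integral>\<omega>. (noise_sum \<Delta> (nat \<lfloor>t / \<Delta>\<rfloor>) \<omega> - L t \<omega>)^2 \<partial>M)" for \<Delta>
  define c where "c \<Delta> = real (nat \<lfloor>t / \<Delta>\<rfloor>) * \<Delta>" for \<Delta>
  have "((\<lambda>\<Delta>. \<Delta> / (1 - exp (- 2 * \<Delta>)) * (1 - 2 * gain_at \<Delta>) + 1 / 2 + \<Delta>) \<longlongrightarrow> 1 / 2 * (1 - 2 * blaschke_value) + 1 / 2 + 0) (at_right 0)"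
    by (intro tendsto_intros tendsto_gain tendsto_exp_ratio) simp
  hence def: "(defect \<longlongrightarrow> 0) (at_right 0)"
    by (simp add: defect_def[abs_def] blaschke_value_invertible[OF inv])
  have le: "eventually (\<lambda>\<Delta>. norm (e \<Delta>) \<le> 2 * (6 * \<bar>defect \<Delta>\<bar> * (2 + t^2) + 2 * t^2 * \<Delta>) + 2 * \<Delta>) (at_right 0)"
    using eventually_small
  proof eventually_elim
    case (elim \<Delta>)
    hence D: "0 < \<Delta>" "\<Delta> < \<delta>0" by auto
    have "0 \<le> t / \<Delta>" using t D by simp
    hence "real (nat \<lfloor>t / \<Delta>\<rfloor>) \<le> t / \<Delta>" by linarith
    hence c: "0 \<le> c \<Delta>" "c \<Delta> \<le> t" using D by (auto simp: c_def field_simps)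
    hence c2: "(c \<Delta>)^2 \<le> t^2" by (intro power_mono) auto
    have "e \<Delta> \<le> 2 * (6 * defect \<Delta> * (2 + (c \<Delta>)^2) + 2 * (c \<Delta>)^2 * \<Delta>) + 2 * \<Delta>"
      unfolding e_def c_def by (rule noise_sum_error[OF D t])
    also have "6 * defect \<Delta> * (2 + (c \<Delta>)^2) \<le> 6 * \<bar>defect \<Delta>\<bar> * (2 + t^2)"
      by (rule mult_mono) (use c2 in auto)
    also have "2 * (c \<Delta>)^2 * \<Delta> \<le> 2 * t^2 * \<Delta>" using c2 D by (intro mult_right_mono) auto
    finally show ?case by (simp add: e_def)
  qed
  have "((\<lambda>\<Delta>. 2 * (6 * \<bar>defect \<Delta>\<bar> * (2 + t^2) + 2 * t^2 * \<Delta>) + 2 * \<Delta>) \<longlongrightarrow> 2 * (6 * \<bar>0\<bar> * (2 + t^2) + 2 * t^2 * 0) + 2 * 0) (at_right 0)"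
    by (intro tendsto_intros def)
  hence "(e \<longlongrightarrow> 0) (at_right 0)" by (intro Lim_null_comparison[OF le]) simp
  hence "((\<lambda>\<Delta>. ennreal (e \<Delta>)) \<longlongrightarrow> ennreal 0) (at_right 0)" by (rule tendsto_ennrealI)
  moreover have "eventually (\<lambda>\<Delta>. ennreal (e \<Delta>) = (\<integral>\<^sup>+ \<omega>. ennreal ((noise_sum \<Delta> (nat \<lfloor>t / \<Delta>\<rfloor>) \<omega> - L t \<omega>)^2) \<partial>M)) (at_right 0)"
    using eventually_small by eventually_elim (use t in \<open>simp add: noise_sum_nn e_def\<close>)
  ultimately show ?thesis by (simp add: Lim_transform_eventually)
qed

lemma L_ou_cov: "(\<integral>\<omega>. (L 1 \<omega> - L 0 \<omega>) * ou 1 \<omega> \<partial>M) = 1 - exp (- 1)"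
proof -
  have "(\<integral>\<omega>. (L 1 \<omega> - L 0 \<omega>) * ou 1 \<omega> \<partial>M) = (\<integral>u. indicator {0<..1} u * ou_kernel 1 u \<partial>lborel)"
    by (rule wiener_isometry[OF wiener_integral_incr ou]) auto
  also have "\<dots> = (\<integral>u. exp (- 1) * (exp (1 * u) * indicator {..1} u) - exp (- 1) * (exp (1 * u) * indicator {..0} u) \<partial>lborel)"
    by (intro Bochner_Integration.integral_cong refl)
       (auto simp: indicator_def ou_kernel_def simp flip: exp_add)
  also have "\<dots> = exp (- 1) * (exp (1 * 1) / 1) - exp (- 1) * (exp (1 * 0) / 1)"
    by (intro has_bochner_integral_integral_eq has_bochner_integral_diff has_bochner_integral_mult_right
        has_bochner_integral_exp_atMost) simp_all
  finally show ?thesis by (simp flip: exp_add)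
qed

text \<open>Mean-square convergence carries covariances along. Against the test variable at time 1
  the sums give the limiting gain times 1 - exp (- 1), whereas \<open>L 1\<close> gives 1 - exp (-
  1).\<close>

lemma invertible_if_convergence:
  assumes conv: "((\<lambda>\<Delta>. \<integral>\<^sup>+ \<omega>. ennreal ((noise_sum \<Delta> (nat \<lfloor>1 / \<Delta>\<rfloor>) \<omega> - L 1 \<omega>)^2) \<partial>M) \<longlongrightarrow> 0) (at_right 0)"
  shows "blaschke_value = 1"
proof -
  obtain k :: nat where k: "1 / real (Suc k) < \<delta>0" using nat_approx_posE[OF delta0] by blast
  \<comment> \<open>Reciprocals of integers put time 1 exactly on the grid, so the last noise index
    and the test variable belong to the same time. The shift by \<open>k\<close> keeps the mesh
    below \<delta>0.\<close>
  define D where "D n = inverse (real (Suc (n + k)))" for n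
  have D: "0 < D n" "D n < \<delta>0" for n
  proof -
    have "inverse (real (Suc (n + k))) \<le> inverse (real (Suc k))" by (intro le_imp_inverse_le) auto
    thus "D n < \<delta>0" using k by (simp add: D_def inverse_eq_divide del: of_nat_Suc)
  qed (simp add: D_def)
  have Dlim: "D \<longlonglongrightarrow> 0"
    unfolding D_def using LIMSEQ_ignore_initial_segment[OF LIMSEQ_inverse_real_of_nat, of k] .
  have Dr: "filterlim D (at_right 0) sequentially"
    using Dlim D(1) by (auto simp: filterlim_at less_imp_neq[THEN not_sym] intro!: always_eventually)
  have flo: "nat \<lfloor>1 / D n\<rfloor> = Suc (n + k)" for n
    by (simp add: D_def inverse_eq_divide del: of_nat_Suc)
  define X where "X n = noise_sum (D n) (Suc (n + k))" for n
  have sX: "square_integrable M (X n)" for n unfolding X_def by (rule noise_sum_square_integrable[OF D])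
  have sL: "square_integrable M (L 1)" by (rule L_square_integrable) simp
  have "(\<lambda>n. \<integral>\<^sup>+ \<omega>. ennreal ((L 1 \<omega> - X n \<omega>)^2) \<partial>M) \<longlonglongrightarrow> 0"
    using filterlim_compose[OF conv Dr] by (simp add: flo X_def power2_commute)
  hence lim2: "(\<lambda>n. \<integral>\<omega>. (X n \<omega> - L 1 \<omega>)^2 \<partial>M) \<longlonglongrightarrow> 0"
    by (rule square_integrable_limit(2)[rotated 2]) (use sX sL in \<open>auto simp: square_integrable_def\<close>)
  have "(\<lambda>n. \<integral>\<omega>. X n \<omega> * ou 1 \<omega> \<partial>M) \<longlonglongrightarrow> (\<integral>\<omega>. L 1 \<omega> * ou 1 \<omega> \<partial>M)"
    by (rule tendsto_integral_mult[OF sX sL ou_square_integrable ou_square_integrable lim2]) simp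
  also have "(\<integral>\<omega>. L 1 \<omega> * ou 1 \<omega> \<partial>M) = (\<integral>\<omega>. (L 1 \<omega> - L 0 \<omega>) * ou 1 \<omega> \<partial>M)"
    using L_zero square_integrable_measurable[OF ou_square_integrable[of 1]]
    by (intro integral_cong_AE) (auto elim!: eventually_mono)
  finally have l1: "(\<lambda>n. \<integral>\<omega>. X n \<omega> * ou 1 \<omega> \<partial>M) \<longlonglongrightarrow> 1 - exp (- 1)" by (simp only: L_ou_cov)
  have one: "real (Suc (n + k)) * D n = 1" for n by (simp add: D_def del: of_nat_Suc)
  have eq: "(\<integral>\<omega>. X n \<omega> * ou 1 \<omega> \<partial>M) = gain_at (D n) * (D n / (1 - exp (- 1 * D n))) * (1 - exp (- 1))" for n
    using sampled_carma.partial_sum_ou_cov[OF sampled[OF D], of n "Suc (n + k)"]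
    unfolding one by (simp add: X_def noise_sum_eq[OF D] gain_at_def)
  have "(\<lambda>n. gain_at (D n) * (D n / (1 - exp (- 1 * D n))) * (1 - exp (- 1))) \<longlonglongrightarrow> blaschke_value * (1 / 1) * (1 - exp (- 1))"
    by (intro tendsto_intros filterlim_compose[OF tendsto_gain Dr] filterlim_compose[OF tendsto_exp_ratio Dr]) simp
  from LIMSEQ_unique[OF l1[unfolded eq] this] show ?thesis by simp
qed

end

theorem theorem3p2:
  fixes M :: "'a measure" and L Y :: "real \<Rightarrow> 'a \<Rightarrow> real"
    and a b :: "real poly" and lam mu :: "complex list"
    and \<sigma> \<delta>0 :: real
    and \<Theta> :: "real \<Rightarrow> real poly" and Z :: "real \<Rightarrow> int \<Rightarrow> 'a \<Rightarrow> real"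
    and \<sigma>Z :: "real \<Rightarrow> real"
  assumes levy: "levy_process M L"
    and second_order: "second_order_standard M L"
    and sigma_pos: "0 < \<sigma>"
    and pq: "length mu < length lam"
    and a_roots: "map_poly complex_of_real a = (\<Prod>l\<leftarrow>lam. [:- l, 1:])"
    and b_roots: "map_poly complex_of_real b = (\<Prod>m\<leftarrow>mu. [:m, 1:])"
    and coprime_ab: "\<forall>z. poly (map_poly complex_of_real a) z = 0 \<longrightarrow>
                         poly (map_poly complex_of_real b) z \<noteq> 0"
    and causal: "\<forall>l\<in>set lam. Re l < 0"
    and mu_nonzero: "\<forall>m\<in>set mu. Re m \<noteq> 0"
    and Y_def: "\<forall>t. wiener_integral M L (\<lambda>u. carma_kernel \<sigma> a b (t - u)) (Y t)"
    and delta0: "0 < \<delta>0"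
    and arma: "\<forall>\<Delta>\<in>{0<..<\<delta>0}. 0 < \<sigma>Z \<Delta> \<and> white_noise M (Z \<Delta>) ((\<sigma>Z \<Delta>)^2) \<and>
                 min_phase_ma (length lam) (\<Theta> \<Delta>) \<and> sampled_arma M Y \<Delta> lam (\<Theta> \<Delta>) (Z \<Delta>)"
  shows "(\<forall>t>0. ((\<lambda>\<Delta>. \<integral>\<^sup>+ \<omega>. ennreal
              (((\<Sum>i=1..nat \<lfloor>t / \<Delta>\<rfloor>. sqrt \<Delta> / \<sigma>Z \<Delta> * Z \<Delta> (int i) \<omega>) - L t \<omega>)^2) \<partial>M)
           \<longlongrightarrow> 0) (at_right 0))
         \<longleftrightarrow> (\<forall>m\<in>set mu. 0 < Re m)"
proof -
  interpret prob_space M using levy by (simp add: levy_process_def)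
  interpret C: carma a b lam mu \<sigma>
    using sigma_pos pq a_roots b_roots causal by unfold_locales
  interpret W: standard_levy M L
    using levy second_order by unfold_locales
  interpret S: sampled_carma_family a b lam mu \<sigma> M L Y \<delta>0 \<Theta> Z \<sigma>Z
  proof (intro sampled_carma_family.intro sampled_carma_family_axioms.intro)
    show "sampled_carma a b lam mu \<sigma> M L Y \<Delta> (\<Theta> \<Delta>) (Z \<Delta>) (\<sigma>Z \<Delta>)" if "0 < \<Delta>" "\<Delta> < \<delta>0" for \<Delta>
      using arma Y_def that by unfold_locales auto
  qed (fact C.carma_axioms W.standard_levy_axioms mu_nonzero delta0)+
  show ?thesis
    unfolding S.noise_sum_def[symmetric]
  proof (intro iffI)
    assume conv: "\<forall>t>0. ((\<lambda>\<Delta>. \<integral>\<^sup>+ \<omega>. ennreal ((S.noise_sum \<Delta> (nat \<lfloor>t / \<Delta>\<rfloor>) \<omega> - L t \<omega>)^2) \<partial>M) \<longlongrightarrow> 0) (at_right 0)"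
    \<comment> \<open>Time 1 alone decides the converse: a single reflected zero would push the
      value strictly below 1.\<close>
    have "S.blaschke_value = 1" by (rule S.invertible_if_convergence[OF conv[rule_format, OF zero_less_one]])
    thus "\<forall>m\<in>set mu. 0 < Re m" using S.blaschke_value_noninvertible by fastforce
  qed (intro allI impI S.convergence_if_invertible)
qed

end
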